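(* Let $(\Omega,\mathcal{F},\mathbb{F}=(\mathcal{F}_t)_{t\ge 0},\mathbf{P})$ be a filtered probability space satisfying the usual assumptions. Let $\tau$ be an $\mathbb{F}$-pseudo-stopping time, and assume that $Z_t^\tau=\mathbf{P}[\tau>t\mid\mathcal{F}_t]>0$ for all $t\ge 0$. Let $\Gamma$ be the hazard process and $\Lambda$ the $\mathbb{F}$-martingale hazard process of $\tau$. (i) If $\tau$ avoids every $\mathbb{F}$-stopping time, i.e. $\mathbf{P}[\tau=T]=0$ for every $\mathbb{F}$-stopping time $T$, then $\Gamma$ is continuous and $\Gamma_t=\Lambda_t=-\ln Z^\tau_t$. (ii) If all $\mathbb{F}$-martingales are continuous and if $\Lambda$ is continuous, then $\Gamma_t=\Lambda_t=-\ln Z^\tau_t$.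
   Context: A random time is a nonnegative $\mathcal{F}$-measurable random variable $\tau:\Omega\to[0,\infty]$. It is an $\mathbb{F}$-pseudo-stopping time if $\mathbf{E}M_\tau=\mathbf{E}M_0$ for every $\mathbb{F}$-martingale $M$ in $\mathcal{H}^1$. $Z^\tau$ is taken càdlàg. The hazard process (defined when $Z^\tau_t>0$ for all $t\ge0$) is $\Gamma_t=-\ln Z^\tau_t$. $\mathbb{G}=(\mathcal{G}_t)$ is the smallest filtration satisfying the usual assumptions, containing $\mathbb{F}$ and making $\tau$ a stopping time: $\mathcal{G}_t=\mathcal{K}_{t+}$ with $\mathcal{K}_t=\mathcal{F}_t\vee\sigma(\tau\wedge t)$. An $\mathbb{F}$-martingale hazard process of $\tau$ is an $\mathbb{F}$-predictable right-continuous increasing process $\Lambda$ such that $\mathbf{1}_{\tau\le t}-\Lambda_{t\wedge\tau}$ is a $\mathbb{G}$-martingale; when $Z^\tau_t>0$ for all $t$ it exists and is unique.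
   Formalization: The martingale hazard process is normalized by Λ_0 = 0 (needed for its uniqueness), and (ii) additionally assumes P[τ = 0] = 0; without it (ii) fails, e.g. trivial filtration with τ = 0 with probability 1/2 and Exp(1) otherwise. *)

theory Defs
  imports "HOL-Probability.Probability"
begin

text \<open>
  Time is \<open>[0,\<infinity>)\<close>. Filtrations and processes are functions on \<^typ>\<open>real\<close> whose values at negative
  times are never used; random times take values in \<open>[0,\<infinity>]\<close>, i.e. in \<^typ>\<open>ennreal\<close>.
  Path properties are required almost surely, and equality of processes means
  indistinguishability.
\<close>

subsection \<open>Filtered probability spaces\<close>

text \<open>
  The library notions \<^const>\<open>filtration\<close> and \<^const>\<open>stopping_time\<close> use one type both for the time
  index and for the values of stopping times, so they are applied to the following extension of
  \<open>F\<close> to \<open>[0,\<infinity>]\<close>. The choice at \<open>\<infinity>\<close> does not affect stopping times (see the lemma below), and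
  it turns \<open>F t \<subseteq> M\<close> into a special case of monotonicity.
\<close>

definition extend_filtration :: "'a measure \<Rightarrow> (real \<Rightarrow> 'a measure) \<Rightarrow> ennreal \<Rightarrow> 'a measure" where
  "extend_filtration M F t = (if t = \<infinity> then M else F (enn2real t))"

locale usual_filtered_prob_space =
  prob_space M + complete_measure M + filtration "space M" "extend_filtration M F"
  for M :: "'a measure" and F :: "real \<Rightarrow> 'a measure" +
  assumes null_sets_F0: "null_sets M \<subseteq> sets (F 0)"
    and right_continuous_F: "\<And>t. 0 \<le> t \<Longrightarrow> sets (F t) = (\<Inter>s\<in>{t<..}. sets (F s))"

abbreviation random_stopping_time ::
  "'a measure \<Rightarrow> (real \<Rightarrow> 'a measure) \<Rightarrow> ('a \<Rightarrow> ennreal) \<Rightarrow> bool" where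
  "random_stopping_time M F T \<equiv> stopping_time (extend_filtration M F) T"

lemma random_stopping_time_iff:
  assumes "\<And>t. 0 \<le> t \<Longrightarrow> space (F t) = space M"
  shows "random_stopping_time M F T \<longleftrightarrow>
    (\<forall>t\<ge>0. {\<omega> \<in> space M. T \<omega> \<le> ennreal t} \<in> sets (F t))"
proof
  assume T: "random_stopping_time M F T"
  show "\<forall>t\<ge>0. {\<omega> \<in> space M. T \<omega> \<le> ennreal t} \<in> sets (F t)"
  proof (intro allI impI)
    fix t :: real assume "0 \<le> t"
    then show "{\<omega> \<in> space M. T \<omega> \<le> ennreal t} \<in> sets (F t)"
      using stopping_timeD[OF T, of "ennreal t"] assms[of t]
      by (simp add: extend_filtration_def pred_def)
  qed
next
  assume *: "\<forall>t\<ge>0. {\<omega> \<in> space M. T \<omega> \<le> ennreal t} \<in> sets (F t)"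
  show "random_stopping_time M F T"
  proof
    fix t :: ennreal
    show "Measurable.pred (extend_filtration M F t) (\<lambda>\<omega>. T \<omega> \<le> t)"
    proof (cases t)
      case (real r)
      then show ?thesis
        using * assms[of r] by (simp add: extend_filtration_def pred_def)
    next
      case top
      then show ?thesis by (simp add: extend_filtration_def)
    qed
  qed
qed

subsection \<open>Processes and martingales\<close>

definition adapted :: "(real \<Rightarrow> 'a measure) \<Rightarrow> (real \<Rightarrow> 'a \<Rightarrow> real) \<Rightarrow> bool" where
  "adapted F X \<longleftrightarrow> (\<forall>t\<ge>0. X t \<in> borel_measurable (F t))"

definition right_continuous_paths :: "'a measure \<Rightarrow> (real \<Rightarrow> 'a \<Rightarrow> real) \<Rightarrow> bool" where
  "right_continuous_paths M X \<longleftrightarrow>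
    (AE \<omega> in M. \<forall>t\<ge>0. continuous (at_right t) (\<lambda>s. X s \<omega>))"

definition cadlag_paths :: "'a measure \<Rightarrow> (real \<Rightarrow> 'a \<Rightarrow> real) \<Rightarrow> bool" where
  "cadlag_paths M X \<longleftrightarrow> right_continuous_paths M X \<and>
    (AE \<omega> in M. \<forall>t>0. \<exists>l. ((\<lambda>s. X s \<omega>) \<longlongrightarrow> l) (at_left t))"

definition continuous_paths :: "'a measure \<Rightarrow> (real \<Rightarrow> 'a \<Rightarrow> real) \<Rightarrow> bool" where
  "continuous_paths M X \<longleftrightarrow> (AE \<omega> in M. continuous_on {0..} (\<lambda>t. X t \<omega>))"

definition increasing_paths :: "'a measure \<Rightarrow> (real \<Rightarrow> 'a \<Rightarrow> real) \<Rightarrow> bool" where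
  "increasing_paths M X \<longleftrightarrow> (AE \<omega> in M. mono_on {0..} (\<lambda>t. X t \<omega>))"

text \<open>
  As usual for filtrations satisfying the usual assumptions, martingales are taken cadlag.
\<close>

definition martingale :: "'a measure \<Rightarrow> (real \<Rightarrow> 'a measure) \<Rightarrow> (real \<Rightarrow> 'a \<Rightarrow> real) \<Rightarrow> bool" where
  "martingale M F X \<longleftrightarrow> adapted F X \<and> cadlag_paths M X \<and>
    (\<forall>t\<ge>0. integrable M (X t)) \<and>
    (\<forall>s\<ge>0. \<forall>t\<ge>s. AE \<omega> in M. real_cond_exp M (F s) (X t) \<omega> = X s \<omega>)"

definition H1_martingale ::
  "'a measure \<Rightarrow> (real \<Rightarrow> 'a measure) \<Rightarrow> (real \<Rightarrow> 'a \<Rightarrow> real) \<Rightarrow> bool" where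
  "H1_martingale M F X \<longleftrightarrow> martingale M F X \<and>
    (\<integral>\<^sup>+\<omega>. (SUP t\<in>{0..}. ennreal \<bar>X t \<omega>\<bar>) \<partial>M) < \<infinity>"

definition predictable_sigma :: "'a measure \<Rightarrow> (real \<Rightarrow> 'a measure) \<Rightarrow> (real \<times> 'a) measure" where
  "predictable_sigma M F = sigma ({0..} \<times> space M)
    ({{0} \<times> A | A. A \<in> sets (F 0)} \<union>
     {{s<..t} \<times> A | s t A. 0 \<le> s \<and> s \<le> t \<and> A \<in> sets (F s)})"

definition predictable ::
  "'a measure \<Rightarrow> (real \<Rightarrow> 'a measure) \<Rightarrow> (real \<Rightarrow> 'a \<Rightarrow> real) \<Rightarrow> bool" where
  "predictable M F X \<longleftrightarrow> (\<lambda>(t, \<omega>). X t \<omega>) \<in> borel_measurable (predictable_sigma M F)"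

subsection \<open>Random times\<close>

text \<open>
  On \<open>{T = \<infinity>}\<close> the value \<open>X\<^sub>T\<close> is \<open>X\<^sub>\<infinity> = lim\<^bsub>t\<rightarrow>\<infinity>\<^esub> X\<^sub>t\<close>, which exists almost surely for the
  \<open>H\<^sup>1\<close>-martingales considered below.
\<close>

definition value_at :: "(real \<Rightarrow> 'a \<Rightarrow> real) \<Rightarrow> ('a \<Rightarrow> ennreal) \<Rightarrow> 'a \<Rightarrow> real" where
  "value_at X T \<omega> =
    (if T \<omega> = \<infinity> then Lim at_top (\<lambda>t. X t \<omega>) else X (enn2real (T \<omega>)) \<omega>)"

definition pseudo_stopping_time ::
  "'a measure \<Rightarrow> (real \<Rightarrow> 'a measure) \<Rightarrow> ('a \<Rightarrow> ennreal) \<Rightarrow> bool" where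
  "pseudo_stopping_time M F \<tau> \<longleftrightarrow> \<tau> \<in> borel_measurable M \<and>
    (\<forall>X. H1_martingale M F X \<longrightarrow> (\<integral>\<omega>. value_at X \<tau> \<omega> \<partial>M) = (\<integral>\<omega>. X 0 \<omega> \<partial>M))"

text \<open>\<open>Z\<close> is a cadlag version of \<open>t \<mapsto> P[\<tau> > t | F t]\<close>.\<close>

definition azema_supermartingale ::
  "'a measure \<Rightarrow> (real \<Rightarrow> 'a measure) \<Rightarrow> ('a \<Rightarrow> ennreal) \<Rightarrow> (real \<Rightarrow> 'a \<Rightarrow> real) \<Rightarrow> bool" where
  "azema_supermartingale M F \<tau> Z \<longleftrightarrow> adapted F Z \<and> cadlag_paths M Z \<and>
    (\<forall>t\<ge>0. AE \<omega> in M.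
      Z t \<omega> = real_cond_exp M (F t) (indicator {\<omega>' \<in> space M. ennreal t < \<tau> \<omega>'}) \<omega>)"

definition hazard_process :: "(real \<Rightarrow> 'a \<Rightarrow> real) \<Rightarrow> real \<Rightarrow> 'a \<Rightarrow> real" where
  "hazard_process Z t \<omega> = - ln (Z t \<omega>)"

definition enlargement_pre ::
  "'a measure \<Rightarrow> (real \<Rightarrow> 'a measure) \<Rightarrow> ('a \<Rightarrow> ennreal) \<Rightarrow> real \<Rightarrow> 'a measure" where
  "enlargement_pre M F \<tau> t = sigma (space M)
    (sets (F t) \<union> sets (vimage_algebra (space M) (\<lambda>\<omega>. min (\<tau> \<omega>) (ennreal t)) borel))"

definition enlargement ::
  "'a measure \<Rightarrow> (real \<Rightarrow> 'a measure) \<Rightarrow> ('a \<Rightarrow> ennreal) \<Rightarrow> real \<Rightarrow> 'a measure" where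
  "enlargement M F \<tau> t = sigma (space M) (\<Inter>s\<in>{t<..}. sets (enlargement_pre M F \<tau> s))"

text \<open>
  The normalisation \<open>\<Lambda>\<^sub>0 = 0\<close> is the usual convention for increasing processes; without it \<open>\<Lambda>\<close>
  would be determined only up to an additive integrable \<open>F 0\<close>-measurable random variable.
\<close>

definition martingale_hazard_process ::
  "'a measure \<Rightarrow> (real \<Rightarrow> 'a measure) \<Rightarrow> ('a \<Rightarrow> ennreal) \<Rightarrow> (real \<Rightarrow> 'a \<Rightarrow> real) \<Rightarrow> bool" where
  "martingale_hazard_process M F \<tau> \<Lambda> \<longleftrightarrow>
    predictable M F \<Lambda> \<and> right_continuous_paths M \<Lambda> \<and> increasing_paths M \<Lambda> \<and>
    (AE \<omega> in M. \<Lambda> 0 \<omega> = 0) \<and>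
    martingale M (enlargement M F \<tau>)
      (\<lambda>t \<omega>. indicator {\<omega>' \<in> space M. \<tau> \<omega>' \<le> ennreal t} \<omega>
             - \<Lambda> (enn2real (min (ennreal t) (\<tau> \<omega>))) \<omega>)"

end

theory Submission
  imports Defs
begin

text \<open>
  Suppose first that \<open>\<Lambda>\<close> is continuous, and put \<open>X = Z + \<integral>Z d\<Lambda>\<close>. Since \<open>1\<^bsub>\<tau> \<le> t\<^esub> - \<Lambda>\<^bsub>t \<and> \<tau>\<^esub>\<close> is a
  martingale, so is \<open>X\<close>, and \<open>Z \<le> 1\<close> makes \<open>X\<close> square integrable. The pseudo-stopping property of
  \<open>\<tau>\<close> is needed only for \<open>X\<close> stopped at a fixed time \<open>t\<close>, where it reads \<open>E X\<^bsub>t \<and> \<tau>\<^esub> = E X\<^sub>0 = 1\<close>.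
  If \<open>X\<close> does not jump at \<open>\<tau>\<close>, then \<open>X\<^bsub>t \<and> \<tau>\<^esub>\<close> is a limit of sums with left endpoints, whose
  expectation is \<open>E \<integral>X\<^sub>- dC + E X\<^sub>t Z\<^sub>t\<close> with \<open>C = \<integral>Z d\<Lambda>\<close>; as \<open>C\<close> is continuous, this is
  \<open>E X\<^sub>t C\<^sub>t + E X\<^sub>t Z\<^sub>t = E X\<^sub>t\<^sup>2\<close>. So \<open>X\<^sub>t\<close> has variance zero, \<open>Z = 1 - \<integral>Z d\<Lambda>\<close>, and \<open>Z = exp (- \<Lambda>)\<close>.

  In case (ii) \<open>X\<close> is continuous by hypothesis. In case (i) \<open>\<tau>\<close> avoids the jumps of every cadlag
  adapted process, hence those of \<open>Z\<close>. It also avoids those of \<open>\<Lambda>\<close>: the measures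
  \<open>B \<mapsto> P ((\<tau>, \<cdot>) \<in> B)\<close> and \<open>B \<mapsto> E \<integral>\<^bsub>(0, \<tau>]\<^esub> 1\<^sub>B d\<Lambda>\<close> agree on predictable sets, in particular on the
  set of jump times of \<open>\<Lambda>\<close>, and so \<open>\<Lambda>\<close> is continuous.
\<close>

subsection \<open>Paths and grids\<close>

text \<open>Stieltjes integrals against \<open>\<Lambda>\<close> are taken over levels: as
  \<open>x\<close> runs through Lebesgue measure, the time at which \<open>\<Lambda>\<close> first
  reaches \<open>x\<close> runs through the Stieltjes measure. Expectations of such integrals become
  integrals over a product space, where Fubini's theorem and conditioning at grid times apply level
  by level. The same device gives the second measure in case (i). That the two measures agree
  excludes jumps of \<open>\<Lambda>\<close> only up to \<open>\<tau>\<close>. A jump before a fixed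
  \<open>t\<close> is captured by an event of \<open>F t\<close> that almost surely misses
  \<open>t < \<tau>\<close>; the integral of \<open>Z t\<close> over it is therefore 0, and
  positivity of \<open>Z t\<close> makes it null. The formula for \<open>E X\<^sub>t\<^sup>2\<close>
  is used in one direction only: squared increments of \<open>Z\<close> are nonnegative, which
  yields \<open>E X\<^sub>t\<^sup>2 \<le> 1\<close>. The error term is the quadratic variation of
  \<open>C\<close>, which vanishes because \<open>C\<close> is continuous and increasing. The
  vanishing of such quadratic variations also solves the final equation for \<open>Z\<close> and
  serves as the test for continuity of \<open>\<Lambda>\<close>.\<close>

lemma continuous_at_right_of_continuous_on:
  fixes f :: "real \<Rightarrow> real"
  assumes "continuous_on {0..} f" "0 \<le> t" shows "continuous (at_right t) f"
proof -
  have "continuous (at t within {0..}) f"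
    using assms by (simp add: continuous_on_eq_continuous_within)
  then show ?thesis by (rule continuous_within_subset) (use assms in auto)
qed

lemma tendsto_at_left_of_continuous_on:
  fixes f :: "real \<Rightarrow> real"
  assumes "continuous_on {0..} f" "0 < t" shows "(f \<longlongrightarrow> f t) (at_left t)"
proof -
  have "isCont f t"
    using assms by (intro continuous_on_interior[of "{0..}"]) (auto simp: interior_real_atLeast)
  then show ?thesis by (simp add: isCont_def filterlim_at_split)
qed

lemma tendsto_right_continuous_seq:
  fixes f :: "real \<Rightarrow> real"
  assumes f: "continuous (at_right s) f" and p: "p \<longlonglongrightarrow> s" and ge: "\<And>n. s \<le> p n"
  shows "(\<lambda>n. f (p n)) \<longlonglongrightarrow> f s"
proof -
  have "continuous (at s within {s..}) f"
    using f by (simp add: continuous_within at_within_Ici_at_right)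
  then show ?thesis
    using p ge by (auto simp: continuous_within_sequentially o_def)
qed

lemma tendsto_at_left_seq:
  fixes f :: "real \<Rightarrow> real"
  assumes f: "(f \<longlongrightarrow> l) (at_left s)" and p: "p \<longlonglongrightarrow> s" and less: "\<And>n. p n < s"
  shows "(\<lambda>n. f (p n)) \<longlonglongrightarrow> l"
proof -
  have "filterlim p (at_left s) sequentially"
    using p less by (auto simp: filterlim_at less_imp_neq)
  then show ?thesis by (rule filterlim_compose[OF f])
qed

lemma mesh_tendsto_0: "(\<lambda>n. c / real (Suc n)) \<longlonglongrightarrow> (0 :: real)"
  by (intro real_tendsto_divide_at_top filterlim_compose[OF filterlim_real_sequentially filterlim_Suc]) auto

text \<open>Grid \<open>n\<close> has \<open>Suc n\<close> cells, so that \<open>n = 0\<close> needs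
  no separate treatment and both endpoints are hit exactly.\<close>

definition grid :: "real \<Rightarrow> real \<Rightarrow> nat \<Rightarrow> nat \<Rightarrow> real" where
  "grid s t n i = s + (t - s) * real i / real (Suc n)"

lemma grid_0 [simp]: "grid s t n 0 = s"
  by (simp add: grid_def)

lemma grid_last [simp]: "grid s t n (Suc n) = t"
  by (simp add: grid_def del: of_nat_Suc)

lemma grid_mono: "s \<le> t \<Longrightarrow> i \<le> j \<Longrightarrow> grid s t n i \<le> grid s t n j"
  unfolding grid_def by (intro add_left_mono divide_right_mono mult_left_mono) auto

lemma grid_ge: "s \<le> t \<Longrightarrow> s \<le> grid s t n i"
  using grid_mono[of s t 0 i n] by simp

lemma grid_le: "s \<le> t \<Longrightarrow> i \<le> Suc n \<Longrightarrow> grid s t n i \<le> t"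
  using grid_mono[of s t i "Suc n" n] by simp

lemma grid_Suc: "grid s t n (Suc i) = grid s t n i + (t - s) / real (Suc n)"
  by (simp only: grid_def of_nat_Suc[of i] distrib_left add_divide_distrib mult_1_right add_ac)

text \<open>\<open>k\<close> is the predecessor of the least index whose grid point reaches
  \<open>x\<close>. The equivalence is for every \<open>i\<close>, which lets a sum over cells
  collapse to a single term.\<close>

lemma grid_cell:
  assumes "s < x" "x \<le> t"
  obtains k where "k < Suc n"
    "\<And>i. grid s t n i < x \<and> x \<le> grid s t n (Suc i) \<longleftrightarrow> i = k"
proof -
  have st: "s \<le> t" using assms by simp
  define j where "j = (LEAST i. x \<le> grid s t n i)"
  have last: "x \<le> grid s t n (Suc n)" using assms by simp
  have j: "x \<le> grid s t n j" unfolding j_def by (rule LeastI, rule last)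
  have least: "j \<le> i" if "x \<le> grid s t n i" for i unfolding j_def using that by (rule Least_le)
  have "j \<noteq> 0" using j assms by (intro notI) simp
  then obtain k where k: "j = Suc k" by (cases j) auto
  show thesis
  proof (rule that[of k])
    show "k < Suc n" using least[OF last] k by simp
    fix i
    show "grid s t n i < x \<and> x \<le> grid s t n (Suc i) \<longleftrightarrow> i = k"
    proof
      assume *: "grid s t n i < x \<and> x \<le> grid s t n (Suc i)"
      have "j \<le> Suc i" using * least by simp
      moreover have "i < j"
        using * j grid_mono[OF st, of j i n] by (meson leD le_less_trans less_le_trans linorder_not_less)
      ultimately show "i = k" using k by simp
    next
      assume "i = k"
      then show "grid s t n i < x \<and> x \<le> grid s t n (Suc i)"
        using j k least[of k] by (auto simp: not_le[symmetric])
    qed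
  qed
qed

lemma grid_cell_tendsto:
  assumes "\<And>n. grid s t n (k n) < x" "\<And>n. x \<le> grid s t n (Suc (k n))" 
  shows "(\<lambda>n. grid s t n (k n)) \<longlonglongrightarrow> x" and "(\<lambda>n. grid s t n (Suc (k n))) \<longlonglongrightarrow> x"
proof -
  have h: "(\<lambda>n. (t - s) / real (Suc n)) \<longlonglongrightarrow> 0" by (rule mesh_tendsto_0)
  have l: "(\<lambda>n. x - (t - s) / real (Suc n)) \<longlonglongrightarrow> x" 
    using tendsto_diff[OF tendsto_const h, of x] by simp
  have u: "(\<lambda>n. x + (t - s) / real (Suc n)) \<longlonglongrightarrow> x" 
    using tendsto_add[OF tendsto_const h, of x] by simp
  have e: "x \<le> grid s t n (k n) + (t - s) / real (Suc n)" for n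
    using assms(2)[of n] by (simp add: grid_Suc)
  show "(\<lambda>n. grid s t n (k n)) \<longlonglongrightarrow> x"
    by (rule tendsto_sandwich[OF _ _ l tendsto_const])
      (use assms e in \<open>auto intro!: always_eventually simp: less_imp_le algebra_simps\<close>)
  show "(\<lambda>n. grid s t n (Suc (k n))) \<longlonglongrightarrow> x"
    by (rule tendsto_sandwich[OF _ _ tendsto_const u])
      (use assms in \<open>auto intro!: always_eventually simp: less_imp_le grid_Suc\<close>)
qed

text \<open>Constant on the left-open cells. With values taken at right ends it approximates right
  continuous functions, with values at left ends left continuous ones, as elementary predictable
  integrands do.\<close>

definition grid_step :: "real \<Rightarrow> real \<Rightarrow> nat \<Rightarrow> (nat \<Rightarrow> real) \<Rightarrow> real \<Rightarrow> real" where
  "grid_step s t n a x = (\<Sum>i<Suc n. if grid s t n i < x \<and> x \<le> grid s t n (Suc i) then a i else 0)"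

lemma grid_step_cell:
  assumes "s < x" "x \<le> t"
  obtains k where "k < Suc n" "grid s t n k < x" "x \<le> grid s t n (Suc k)"
    "\<And>a. grid_step s t n a x = a k"
proof -
  obtain k where k: "k < Suc n" "\<And>i. grid s t n i < x \<and> x \<le> grid s t n (Suc i) \<longleftrightarrow> i = k"
    using grid_cell[OF assms] by blast
  show thesis
    using k by (intro that[of k]) (auto simp: grid_step_def sum.delta simp del: sum.lessThan_Suc)
qed

lemma grid_step_outside:
  assumes "s \<le> t" "\<not> (s < x \<and> x \<le> t)"
  shows "grid_step s t n a x = 0"
  unfolding grid_step_def
proof (rule sum.neutral, intro ballI)
  fix i assume "i \<in> {..<Suc n}"
  then show "(if grid s t n i < x \<and> x \<le> grid s t n (Suc i) then a i else 0) = 0"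
    using assms grid_ge[OF assms(1), of n i] grid_le[OF assms(1), of "Suc i" n] by auto
qed

text \<open>The right end of the cell around \<open>x\<close> tends to \<open>x\<close> without
  passing below it, so right continuity at \<open>x\<close> alone is enough.\<close>

lemma grid_step_right_tendsto:
  assumes "s \<le> t" and f: "s < x \<Longrightarrow> x \<le> t \<Longrightarrow> continuous (at_right x) f"
  shows "(\<lambda>n. grid_step s t n (\<lambda>i. f (grid s t n (Suc i))) x)
    \<longlonglongrightarrow> (if s < x \<and> x \<le> t then f x else 0)"
proof (cases "s < x \<and> x \<le> t")
  case True
  have "\<forall>n. \<exists>k. grid s t n k < x \<and> x \<le> grid s t n (Suc k) \<and> (\<forall>a. grid_step s t n a x = a k)"
    using True by (blast elim: grid_step_cell)
  then obtain k where k: "\<And>n. grid s t n (k n) < x" "\<And>n. x \<le> grid s t n (Suc (k n))"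
    "\<And>n a. grid_step s t n a x = a (k n)" by metis
  show ?thesis
    using True tendsto_right_continuous_seq[OF f grid_cell_tendsto(2)[OF k(1,2)] k(2)]
    by (simp add: k(3))
next
  case False
  then show ?thesis by (simp add: grid_step_outside[OF assms(1) False] if_not_P[OF False] del: de_Morgan_conj)
qed

text \<open>Left ends stay strictly below \<open>x\<close>, so the limit only sees the left limit of
  \<open>f\<close>; it equals \<open>f x\<close> because \<open>f\<close> has no jump there.\<close>

lemma grid_step_left_tendsto:
  assumes "s \<le> t" and f: "s < x \<Longrightarrow> x \<le> t \<Longrightarrow> continuous (at_left x) f"
  shows "(\<lambda>n. grid_step s t n (\<lambda>i. f (grid s t n i)) x)
    \<longlonglongrightarrow> (if s < x \<and> x \<le> t then f x else 0)"
proof (cases "s < x \<and> x \<le> t")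
  case True
  have "\<forall>n. \<exists>k. grid s t n k < x \<and> x \<le> grid s t n (Suc k) \<and> (\<forall>a. grid_step s t n a x = a k)"
    using True by (blast elim: grid_step_cell)
  then obtain k where k: "\<And>n. grid s t n (k n) < x" "\<And>n. x \<le> grid s t n (Suc (k n))"
    "\<And>n a. grid_step s t n a x = a (k n)" by metis
  show ?thesis
    using True f tendsto_at_left_seq[OF _ grid_cell_tendsto(1)[OF k(1,2)] k(1)]
    by (simp add: k(3) continuous_within)
next
  case False
  then show ?thesis by (simp add: grid_step_outside[OF assms(1) False] if_not_P[OF False] del: de_Morgan_conj)
qed

lemma grid_step_bounds:
  assumes "s \<le> t" "\<And>i. i \<le> n \<Longrightarrow> 0 \<le> a i" "\<And>i. i \<le> n \<Longrightarrow> a i \<le> b" "0 \<le> b"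
  shows "0 \<le> grid_step s t n a x" "grid_step s t n a x \<le> b"
proof -
  have "0 \<le> grid_step s t n a x \<and> grid_step s t n a x \<le> b"
  proof (cases "s < x \<and> x \<le> t")
    case True
    then obtain k where "k < Suc n" "\<And>a. grid_step s t n a x = a k"
      by (blast elim: grid_step_cell)
    then show ?thesis using assms by simp
  qed (use assms in \<open>simp add: grid_step_outside[OF assms(1)]\<close>)
  then show "0 \<le> grid_step s t n a x" "grid_step s t n a x \<le> b" by auto
qed

text \<open>Continuous increasing functions have zero quadratic variation: by uniform continuity
  every increment is eventually at most \<open>e\<close>, and the other factor of each square
  telescopes to \<open>h t - h s\<close>.\<close>

lemma sum_square_increments_tendsto_0:
  fixes h :: "real \<Rightarrow> real"
  assumes st: "s \<le> t" and mono: "mono_on {s..t} h" and cont: "continuous_on {s..t} h"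
  shows "(\<lambda>n. \<Sum>i<Suc n. (h (grid s t n (Suc i)) - h (grid s t n i))\<^sup>2) \<longlonglongrightarrow> 0"
proof (rule LIMSEQ_I)
  fix r :: real assume r: "0 < r"
  \<comment> \<open>The added 1 covers constant \<open>h\<close> and makes
    \<open>e * (h t - h s) < r\<close> strict.\<close>
  define e where "e = r / (1 + (h t - h s))"
  have d0: "0 \<le> h t - h s" using mono_onD[OF mono, of s t] st by simp
  then have e: "0 < e" using r by (simp add: e_def)
  have "uniformly_continuous_on {s..t} h"
    by (rule compact_uniformly_continuous[OF cont compact_Icc])
  then obtain d where d: "0 < d"
    "\<And>x y. x \<in> {s..t} \<Longrightarrow> y \<in> {s..t} \<Longrightarrow> dist y x < d \<Longrightarrow> dist (h y) (h x) < e"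
    using e unfolding uniformly_continuous_on_def by metis
  have lim: "(\<lambda>n. (t - s) / real (Suc n)) \<longlonglongrightarrow> 0" by (rule mesh_tendsto_0)
  obtain N where N: "\<And>n. N \<le> n \<Longrightarrow> (t - s) / real (Suc n) < d"
    using order_tendstoD(2)[OF lim d(1)] by (auto simp: eventually_sequentially)
  have "norm ((\<Sum>i<Suc n. (h (grid s t n (Suc i)) - h (grid s t n i))\<^sup>2) - 0) < r" if n: "N \<le> n" for n
  proof -
    have *: "(h (grid s t n (Suc i)) - h (grid s t n i))\<^sup>2 \<le> e * (h (grid s t n (Suc i)) - h (grid s t n i))"
      if "i \<in> {..<Suc n}" for i
    proof -
      have in1: "grid s t n i \<in> {s..t}" "grid s t n (Suc i) \<in> {s..t}"
        using that st by (auto intro: grid_ge grid_le)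
      have "dist (grid s t n (Suc i)) (grid s t n i) < d"
        using N[OF n] st by (simp add: grid_Suc dist_real_def)
      from d(2)[OF in1 this] have "h (grid s t n (Suc i)) - h (grid s t n i) \<le> e"
        by (auto simp: dist_real_def)
      moreover have "0 \<le> h (grid s t n (Suc i)) - h (grid s t n i)"
        using mono_onD[OF mono in1] grid_mono[OF st, of i "Suc i" n] by simp
      ultimately show ?thesis unfolding power2_eq_square by (intro mult_right_mono)
    qed
    have "(\<Sum>i<Suc n. (h (grid s t n (Suc i)) - h (grid s t n i))\<^sup>2)
      \<le> (\<Sum>i<Suc n. e * (h (grid s t n (Suc i)) - h (grid s t n i)))"
      by (rule sum_mono) (rule *)
    also have "\<dots> = e * (h t - h s)"
      unfolding sum_distrib_left[symmetric]
      by (subst sum_lessThan_telescope[where f = "\<lambda>i. h (grid s t n i)"]) simp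
    also have "\<dots> < r"
      using r d0 by (simp add: e_def field_simps)
    finally show ?thesis by (simp add: sum_nonneg del: sum.lessThan_Suc)
  qed
  then show "\<exists>no. \<forall>n\<ge>no. norm ((\<Sum>i<Suc n. (h (grid s t n (Suc i)) - h (grid s t n i))\<^sup>2) - 0) < r" by blast
qed

text \<open>\<open>lower\<close> and \<open>upper\<close> express dz = -z dl for a decreasing
  \<open>z\<close> without an integral. On each interval both \<open>l v - l u\<close> and
  \<open>ln (z u) - ln (z v)\<close> lie between \<open>(z u - z v) / z u\<close> and
  \<open>(z u - z v) / z v\<close>, so \<open>l + ln z\<close> changes by at most a multiple of the
  squared increment of \<open>z\<close>, and these squares sum to zero in the limit.\<close>

lemma exp_of_integral_equation:
  fixes z l :: "real \<Rightarrow> real"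
  assumes t: "0 \<le> t" and pos: "\<And>u. 0 \<le> u \<Longrightarrow> u \<le> t \<Longrightarrow> 0 < z u"
    and cont: "continuous_on {0..t} z" and z0: "z 0 = 1" and l0: "l 0 = 0"
    and anti: "\<And>u v. 0 \<le> u \<Longrightarrow> u \<le> v \<Longrightarrow> v \<le> t \<Longrightarrow> z v \<le> z u"
    and lower: "\<And>u v. 0 \<le> u \<Longrightarrow> u \<le> v \<Longrightarrow> v \<le> t \<Longrightarrow> z v * (l v - l u) \<le> z u - z v"
    and upper: "\<And>u v. 0 \<le> u \<Longrightarrow> u \<le> v \<Longrightarrow> v \<le> t \<Longrightarrow> z u - z v \<le> z u * (l v - l u)"
  shows "l t = - ln (z t)"
proof -
  define D where "D u = l u + ln (z u)" for u
  have D: "\<bar>D v - D u\<bar> \<le> (z v - z u)\<^sup>2 / (z t)\<^sup>2" if uv: "0 \<le> u" "u \<le> v" "v \<le> t" for u v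
  proof -
    have p: "0 < z u" "0 < z v" "0 < z t" using uv pos t by auto
    have m: "z v \<le> z u" "z t \<le> z v" "z t \<le> z u" using uv by (auto intro: anti)
    have l: "(z u - z v) / z u \<le> l v - l u" "l v - l u \<le> (z u - z v) / z v"
      using lower[OF uv] upper[OF uv] p by (simp_all add: pos_divide_le_eq pos_le_divide_eq mult.commute)
    have "ln (z u / z v) \<le> z u / z v - 1" using p by (intro ln_le_minus_one) auto
    moreover have "ln (z v / z u) \<le> z v / z u - 1" using p by (intro ln_le_minus_one) auto
    ultimately have g: "(z u - z v) / z u \<le> ln (z u) - ln (z v)" "ln (z u) - ln (z v) \<le> (z u - z v) / z v"
      using p by (simp_all add: ln_div diff_divide_distrib)
    have "\<bar>D v - D u\<bar> \<le> (z u - z v) / z v - (z u - z v) / z u"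
      using l g unfolding D_def by linarith
    also have "\<dots> = (z v - z u)\<^sup>2 / (z u * z v)"
      using p by (simp add: field_simps power2_eq_square)
    also have "\<dots> \<le> (z v - z u)\<^sup>2 / (z t)\<^sup>2"
      unfolding power2_eq_square[of "z t"] using p m by (intro divide_left_mono mult_mono) auto
    finally show ?thesis .
  qed
  \<comment> \<open>The signs turn the decreasing \<open>z\<close> into the increasing function that
    \<open>sum_square_increments_tendsto_0\<close> asks for.\<close>
  define Q where "Q n = (\<Sum>i<Suc n. ((- z (grid 0 t n (Suc i))) - (- z (grid 0 t n i)))\<^sup>2)" for n
  have "\<bar>D t\<bar> \<le> Q n / (z t)\<^sup>2" for n
  proof -
    have "D t = (\<Sum>i<Suc n. D (grid 0 t n (Suc i)) - D (grid 0 t n i))"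
      by (subst sum_lessThan_telescope[where f = "\<lambda>i. D (grid 0 t n i)"]) (simp add: D_def z0 l0)
    also have "\<bar>\<dots>\<bar> \<le> (\<Sum>i<Suc n. \<bar>D (grid 0 t n (Suc i)) - D (grid 0 t n i)\<bar>)"
      by (rule sum_abs)
    also have "\<dots> \<le> (\<Sum>i<Suc n. (z (grid 0 t n (Suc i)) - z (grid 0 t n i))\<^sup>2 / (z t)\<^sup>2)"
      using t by (intro sum_mono D grid_ge grid_mono grid_le) auto
    also have "\<dots> = Q n / (z t)\<^sup>2"
      unfolding Q_def sum_divide_distrib by (intro sum.cong refl) (simp add: power2_eq_square algebra_simps)
    finally show ?thesis .
  qed
  moreover have "(\<lambda>n. Q n / (z t)\<^sup>2) \<longlonglongrightarrow> 0 / (z t)\<^sup>2"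
    unfolding Q_def using t pos[of t] anti cont
    by (intro tendsto_divide tendsto_const sum_square_increments_tendsto_0)
      (auto intro!: mono_onI continuous_intros)
  ultimately have "\<bar>D t\<bar> \<le> 0" by (intro LIMSEQ_le_const) auto
  then show ?thesis by (simp add: D_def)
qed

text \<open>Reduces all possible jump times to countably many first times of oscillation, indexed by
  a rational starting time \<open>q\<close> and a threshold. Rational \<open>r\<close> suffice in
  the infimum because right continuity carries the jump at \<open>u\<close> to times shortly after
  \<open>u\<close>.\<close>

lemma jump_time_is_oscillation_time:
  fixes f :: "real \<Rightarrow> real"
  assumes u: "0 < u" and rc: "continuous (at_right u) f" and ll: "(f \<longlongrightarrow> l) (at_left u)"
    and ne: "l \<noteq> f u"
  obtains q k where "q \<in> \<rat>" "0 \<le> q"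
    "(INF r\<in>{r\<in>\<rat>. q < r \<and> 1 / real (Suc k) < \<bar>f r - f q\<bar>}. ennreal r) = ennreal u"
proof -
  \<comment> \<open>The threshold is below half the jump: close to the left of \<open>u\<close> two
    values differ by less than \<open>e\<close>, whereas \<open>f u\<close> is more than
    \<open>e\<close> away from each of them.\<close>
  obtain k where k: "1 / real (Suc k) < \<bar>f u - l\<bar> / 2"
    using ne by (elim nat_approx_posE[of "\<bar>f u - l\<bar> / 2", rotated]) auto
  define e where "e = 1 / real (Suc k)"
  have e: "0 < e" "2 * e < \<bar>f u - l\<bar>" using k by (auto simp: e_def)
  have "\<forall>\<^sub>F v in at_left u. dist (f v) l < e / 2"
    using ll e by (intro tendstoD) auto
  then obtain b where b: "b < u" "\<And>v. b < v \<Longrightarrow> v < u \<Longrightarrow> dist (f v) l < e / 2"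
    unfolding eventually_at_left_field by blast
  obtain q where q: "q \<in> \<rat>" "max 0 b < q" "q < u"
    using Rats_dense_in_real[of "max 0 b" u] u b by auto
  have fq: "\<bar>f q - l\<bar> < e / 2" using b(2)[of q] q by (simp add: dist_real_def)
  have before: "\<bar>f r - f q\<bar> < e" if "q < r" "r < u" for r
    using b(2)[of r] that q fq unfolding dist_real_def by linarith
  have "e < \<bar>f u - f q\<bar>" using fq e by linarith
  moreover have "((\<lambda>v. \<bar>f v - f q\<bar>) \<longlongrightarrow> \<bar>f u - f q\<bar>) (at_right u)"
    using rc by (intro tendsto_intros) (simp add: continuous_within)
  ultimately have "\<forall>\<^sub>F v in at_right u. e < \<bar>f v - f q\<bar>"
    by (intro order_tendstoD(1))
  then obtain c where c: "u < c" "\<And>v. u < v \<Longrightarrow> v < c \<Longrightarrow> e < \<bar>f v - f q\<bar>"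
    by (auto simp: eventually_at_right_field)
  let ?R = "{r\<in>\<rat>. q < r \<and> e < \<bar>f r - f q\<bar>}"
  have "(INF r\<in>?R. ennreal r) = ennreal u"
  proof (rule antisym)
    show "ennreal u \<le> (INF r\<in>?R. ennreal r)"
    proof (rule INF_greatest)
      fix r assume "r \<in> ?R"
      then show "ennreal u \<le> ennreal r" using before[of r] by (intro ennreal_leI) force
    qed
    show "(INF r\<in>?R. ennreal r) \<le> ennreal u"
    proof (rule ennreal_le_epsilon)
      fix d :: real assume d: "0 < d"
      obtain r where r: "r \<in> \<rat>" "u < r" "r < min c (u + d)"
        using Rats_dense_in_real[of u "min c (u + d)"] c d by auto
      then have "r \<in> ?R" using c q by auto
      then have "(INF r\<in>?R. ennreal r) \<le> ennreal r" by (rule INF_lower)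
      also have "\<dots> \<le> ennreal u + ennreal d"
        using r u d by (simp add: ennreal_plus[symmetric] ennreal_leI del: ennreal_plus)
      finally show "(INF r\<in>?R. ennreal r) \<le> ennreal u + ennreal d" .
    qed
  qed
  then show thesis using that[of q k] q by (simp add: e_def)
qed

subsection \<open>First passage times\<close>

text \<open>The generalised inverse of \<open>l\<close>, which carries Lebesgue measure on the
  levels to the Stieltjes measure of \<open>l\<close>. For a level that is never reached the infimum
  is over the empty set, hence the later guards \<open>x \<le> L t w\<close>.\<close>

definition first_passage :: "(real \<Rightarrow> real) \<Rightarrow> real \<Rightarrow> real" where
  "first_passage l x = Inf {u. 0 \<le> u \<and> x \<le> l u}"

text \<open>Right continuity makes the infimum a minimum; monotonicity then gives the adjunction
  between \<open>first_passage l\<close> and \<open>l\<close>.\<close>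

lemma
  assumes mono: "mono_on {0..} l" and rc: "\<And>u. 0 \<le> u \<Longrightarrow> continuous (at_right u) l"
    and t: "0 \<le> t" "x \<le> l t"
  shows first_passage_le_iff: "\<And>u. 0 \<le> u \<Longrightarrow> first_passage l x \<le> u \<longleftrightarrow> x \<le> l u"
    and first_passage_nonneg: "0 \<le> first_passage l x"
proof -
  let ?S = "{u. 0 \<le> u \<and> x \<le> l u}"
  have ne: "t \<in> ?S" using t by simp
  have bdd: "bdd_below ?S" by (rule bdd_belowI[of _ 0]) simp
  show nonneg: "0 \<le> first_passage l x"
    unfolding first_passage_def using ne by (intro cInf_greatest) auto
  have "x \<le> l v" if "first_passage l x < v" for v
  proof -
    have "?S \<noteq> {}" "Inf ?S < v" using ne that by (auto simp: first_passage_def)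
    then obtain s where "s \<in> ?S" "s < v" by (meson cInf_lessD)
    then show ?thesis using mono_onD[OF mono, of s v] by simp
  qed
  then have "\<forall>\<^sub>F v in at_right (first_passage l x). x \<le> l v"
    by (intro eventually_at_right_less[THEN eventually_mono]) auto
  then have att: "x \<le> l (first_passage l x)"
    using rc[OF nonneg] by (intro tendsto_lowerbound) (auto simp: continuous_within)
  show "first_passage l x \<le> u \<longleftrightarrow> x \<le> l u" if "0 \<le> u" for u
  proof
    assume "first_passage l x \<le> u"
    then show "x \<le> l u" using mono_onD[OF mono, of "first_passage l x" u] att nonneg by simp
  next
    assume "x \<le> l u"
    then show "first_passage l x \<le> u"
      unfolding first_passage_def using that bdd by (intro cInf_lower) auto
  qed
qed

section \<open>Inclusions and measurability in the filtration\<close>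

context usual_filtered_prob_space
begin

lemma extend_filtration_ennreal: "0 \<le> t \<Longrightarrow> extend_filtration M F (ennreal t) = F t"
  by (simp add: extend_filtration_def)

lemma space_F_eq: "0 \<le> t \<Longrightarrow> space (F t) = space M"
  using space_F[of "ennreal t"] by (simp add: extend_filtration_ennreal)

lemma sets_F_le: "0 \<le> s \<Longrightarrow> s \<le> t \<Longrightarrow> sets (F s) \<subseteq> sets (F t)"
  using sets_F_mono[of "ennreal s" "ennreal t"] by (simp add: extend_filtration_ennreal ennreal_leI)

lemma sets_F_subset: "0 \<le> t \<Longrightarrow> sets (F t) \<subseteq> sets M"
  using sets_F_mono[of "ennreal t" \<infinity>] by (simp add: extend_filtration_ennreal)
    (simp add: extend_filtration_def)

lemma subalgebra_F: "0 \<le> t \<Longrightarrow> subalgebra M (F t)"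
  by (simp add: subalgebra_def space_F_eq sets_F_subset)

lemma subalgebra_F_F: "0 \<le> s \<Longrightarrow> s \<le> t \<Longrightarrow> subalgebra (F t) (F s)"
  by (simp add: subalgebra_def space_F_eq sets_F_le)

lemma sigma_finite_subalgebra_F: "0 \<le> t \<Longrightarrow> sigma_finite_subalgebra M (F t)"
  by (intro finite_measure_subalgebra_is_sigma_finite)
    (simp add: finite_measure_subalgebra_def finite_measure_subalgebra_axioms_def
      finite_measure_axioms subalgebra_F)

lemma borel_measurable_F_mono:
  "f \<in> borel_measurable (F s) \<Longrightarrow> 0 \<le> s \<Longrightarrow> s \<le> t \<Longrightarrow> f \<in> borel_measurable (F t)"
  using measurable_from_subalg[OF subalgebra_F_F] by blast

lemma borel_measurable_F_M: "f \<in> borel_measurable (F s) \<Longrightarrow> 0 \<le> s \<Longrightarrow> f \<in> borel_measurable M"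
  using measurable_from_subalg[OF subalgebra_F] by blast

end

section \<open>Evaluation at the random time\<close>

definition stopped_at :: "('a \<Rightarrow> ennreal) \<Rightarrow> real \<Rightarrow> 'a \<Rightarrow> real" where
  "stopped_at \<tau> t w = enn2real (min (ennreal t) (\<tau> w))"

text \<open>Says that \<open>Y\<close> has no jump at \<open>\<tau>\<close>, with the values 0 and
  \<infinity> of \<open>\<tau>\<close> exempted.\<close>

abbreviation left_limit_at :: "('a \<Rightarrow> ennreal) \<Rightarrow> (real \<Rightarrow> 'a \<Rightarrow> real) \<Rightarrow> 'a \<Rightarrow> bool" where
  "left_limit_at \<tau> Y w \<equiv> 0 < \<tau> w \<and> \<tau> w < \<infinity> \<longrightarrow>
    ((\<lambda>s. Y s w) \<longlongrightarrow> Y (enn2real (\<tau> w)) w) (at_left (enn2real (\<tau> w)))"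

lemma stopped_at_before: "ennreal t < \<tau> w \<Longrightarrow> 0 \<le> t \<Longrightarrow> stopped_at \<tau> t w = t"
  by (auto simp: stopped_at_def min_def)

lemma stopped_at_after: "\<tau> w \<le> ennreal t \<Longrightarrow> stopped_at \<tau> t w = enn2real (\<tau> w)"
  by (auto simp: stopped_at_def min_def)

lemma stopped_at_nonneg: "0 \<le> stopped_at \<tau> t w"
  by (simp add: stopped_at_def)

lemma stopped_at_mono: "s \<le> t \<Longrightarrow> stopped_at \<tau> s w \<le> stopped_at \<tau> t w"
  unfolding stopped_at_def by (intro enn2real_mono min.mono ennreal_leI) (auto simp: min_less_iff_disj)

text \<open>Where \<open>\<tau>\<close> is infinite the stopped process is eventually constant, so
  the limit in \<open>value_at\<close> is just \<open>Y t w\<close>.\<close>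

lemma value_at_stopped:
  assumes t: "0 \<le> t"
  shows "value_at (\<lambda>u. Y (min u t)) \<tau> w = Y (stopped_at \<tau> t w) w"
proof (cases "\<tau> w" rule: ennreal_cases)
  case (real r)
  then show ?thesis
    using t by (auto simp: value_at_def stopped_at_def min_def ennreal_le_iff split: if_splits)
next
  case top
  have "\<forall>\<^sub>F u in at_top. Y (min u t) w = Y t w"
    using eventually_ge_at_top[of t] by eventually_elim simp
  then have "Lim at_top (\<lambda>u. Y (min u t) w) = Y t w"
    by (intro tendsto_Lim tendsto_eventually) auto
  then show ?thesis using top t by (simp add: value_at_def stopped_at_def)
qed

text \<open>
  The regularity of paths is required for every \<open>w\<close>. Processes for which it holds only almost surely
  are modified on a null set, which belongs to \<open>F 0\<close>.
\<close>

locale hazard_setting = usual_filtered_prob_space M F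
  for M :: "'a measure" and F :: "real \<Rightarrow> 'a measure" +
  fixes \<tau> :: "'a \<Rightarrow> ennreal" and Z L :: "real \<Rightarrow> 'a \<Rightarrow> real"
  assumes tau_measurable [measurable]: "\<tau> \<in> borel_measurable M"
    and Z_adapted: "\<And>t. 0 \<le> t \<Longrightarrow> Z t \<in> borel_measurable (F t)"
    and Z_right: "\<And>w t. w \<in> space M \<Longrightarrow> 0 \<le> t \<Longrightarrow> continuous (at_right t) (\<lambda>s. Z s w)"
    and Z_left: "\<And>w t. w \<in> space M \<Longrightarrow> 0 < t \<Longrightarrow> \<exists>l. ((\<lambda>s. Z s w) \<longlongrightarrow> l) (at_left t)"
    and Z_pos: "\<And>w t. w \<in> space M \<Longrightarrow> 0 \<le> t \<Longrightarrow> 0 < Z t w"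
    and Z_le_1: "\<And>w t. w \<in> space M \<Longrightarrow> 0 \<le> t \<Longrightarrow> Z t w \<le> 1"
    and Z_cond: "\<And>t. 0 \<le> t \<Longrightarrow>
      AE w in M. Z t w = real_cond_exp M (F t) (indicator {w' \<in> space M. ennreal t < \<tau> w'}) w"
    and L_adapted: "\<And>t. 0 \<le> t \<Longrightarrow> L t \<in> borel_measurable (F t)"
    and L_right: "\<And>w t. w \<in> space M \<Longrightarrow> 0 \<le> t \<Longrightarrow> continuous (at_right t) (\<lambda>s. L s w)"
    and L_mono_on: "\<And>w. w \<in> space M \<Longrightarrow> mono_on {0..} (\<lambda>t. L t w)"
    and L_0: "\<And>w. w \<in> space M \<Longrightarrow> L 0 w = 0"
    and L_integrable: "\<And>t. 0 \<le> t \<Longrightarrow> integrable M (\<lambda>w. L (stopped_at \<tau> t w) w)"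
    and L_compensates: "\<And>s t A. 0 \<le> s \<Longrightarrow> s \<le> t \<Longrightarrow> A \<in> sets (F s) \<Longrightarrow>
      (\<integral>w. indicator A w * (L (stopped_at \<tau> t w) w - L (stopped_at \<tau> s w) w) \<partial>M)
      = measure M {w \<in> A. ennreal s < \<tau> w \<and> \<tau> w \<le> ennreal t}"
begin

abbreviation L_tau :: "real \<Rightarrow> 'a \<Rightarrow> real" where
  "L_tau t w \<equiv> L (stopped_at \<tau> t w) w"

lemma L_mono: "w \<in> space M \<Longrightarrow> 0 \<le> s \<Longrightarrow> s \<le> t \<Longrightarrow> L s w \<le> L t w"
  using mono_onD[OF L_mono_on, of w s t] by simp

lemma L_nonneg: "w \<in> space M \<Longrightarrow> 0 \<le> t \<Longrightarrow> 0 \<le> L t w"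
  using L_mono[of w 0 t] by (simp add: L_0)

section \<open>Passage times of the levels of \<open>L\<close>\<close>

abbreviation passage :: "real \<Rightarrow> 'a \<Rightarrow> real" where
  "passage x w \<equiv> first_passage (\<lambda>u. L u w) x"

lemma passage_le_iff:
  assumes "w \<in> space M" "0 \<le> t" "x \<le> L t w" "0 \<le> u"
  shows "passage x w \<le> u \<longleftrightarrow> x \<le> L u w"
  using assms by (intro first_passage_le_iff[OF L_mono_on L_right]) auto

lemma passage_interval:
  assumes "w \<in> space M" "0 \<le> s" "s \<le> t" "L s w < x" "x \<le> L t w"
  shows "s < passage x w" "passage x w \<le> t"
  using passage_le_iff[of w t x s] passage_le_iff[of w t x t] assms by auto

text \<open>The adjunction carries cells of levels to cells of time. The left-hand side involves
  \<open>L\<close> only at grid points and is therefore measurable; the right-hand side is a step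
  function of the passage time.\<close>

lemma sum_cells_eq:
  assumes w: "w \<in> space M" and st: "0 \<le> s" "s \<le> t"
  shows "(\<Sum>i<Suc n. if L (grid s t n i) w < x \<and> x \<le> L (grid s t n (Suc i)) w then a i else 0)
    = (if L s w < x \<and> x \<le> L t w then grid_step s t n a (passage x w) else 0)"
proof (cases "L s w < x \<and> x \<le> L t w")
  case True
  have "(L (grid s t n i) w < x \<and> x \<le> L (grid s t n (Suc i)) w) \<longleftrightarrow>
      (grid s t n i < passage x w \<and> passage x w \<le> grid s t n (Suc i))" for i
    using passage_le_iff[OF w, of t x "grid s t n i"] passage_le_iff[OF w, of t x "grid s t n (Suc i)"]
      True st order_trans[OF st(1) grid_ge[OF st(2)]] by (auto simp: not_le[symmetric])
  then show ?thesis using True by (simp add: grid_step_def)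
next
  case False
  have "\<not> (L (grid s t n i) w < x \<and> x \<le> L (grid s t n (Suc i)) w)" if "i \<in> {..<Suc n}" for i
  proof -
    have "s \<le> grid s t n i" "s \<le> grid s t n (Suc i)" "grid s t n (Suc i) \<le> t"
      using that st by (auto intro: grid_ge grid_le)
    then have "L s w \<le> L (grid s t n i) w" "L (grid s t n (Suc i)) w \<le> L t w"
      using st by (auto intro!: L_mono[OF w])
    then show ?thesis using False by linarith
  qed
  then have "(\<Sum>i<Suc n. if L (grid s t n i) w < x \<and> x \<le> L (grid s t n (Suc i)) w then a i else 0) = 0"
    by (intro sum.neutral) auto
  then show ?thesis using False by auto
qed

lemma sum_cells_tendsto:
  fixes f :: "real \<Rightarrow> real"
  assumes w: "w \<in> space M" and st: "0 \<le> s" "s \<le> t"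
    and f: "\<And>u. 0 \<le> u \<Longrightarrow> continuous (at_right u) f"
  shows "(\<lambda>n. \<Sum>i<Suc n. if L (grid s t n i) w < x \<and> x \<le> L (grid s t n (Suc i)) w
      then f (grid s t n (Suc i)) else 0)
    \<longlonglongrightarrow> (if L s w < x \<and> x \<le> L t w then f (passage x w) else 0)"
proof (cases "L s w < x \<and> x \<le> L t w")
  case True
  then have "s < passage x w" "passage x w \<le> t" using passage_interval[OF w st] by auto
  then show ?thesis
    using True grid_step_right_tendsto[OF st(2), of "passage x w" f] f[of "passage x w"] st
    by (simp add: sum_cells_eq[OF w st] del: sum.lessThan_Suc)
next
  case False
  then show ?thesis by (simp only: sum_cells_eq[OF w st]) auto
qed

lemma sum_cells_bounds:
  fixes f :: "real \<Rightarrow> real"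
  assumes w: "w \<in> space M" and st: "0 \<le> s" "s \<le> t"
    and f: "\<And>u. 0 \<le> u \<Longrightarrow> 0 \<le> f u" "\<And>u. 0 \<le> u \<Longrightarrow> f u \<le> 1"
  shows "\<bar>\<Sum>i<Suc n. if L (grid s t n i) w < x \<and> x \<le> L (grid s t n (Suc i)) w
      then f (grid s t n (Suc i)) else 0\<bar> \<le> 1"
  unfolding sum_cells_eq[OF w st]
  using grid_step_bounds[OF st(2), of n "\<lambda>i. f (grid s t n (Suc i))" 1 "passage x w"] f
    order_trans[OF st(1) grid_ge[OF st(2)]]
  by auto

text \<open>\<open>f\<close> at the passage time is a pointwise limit of sums that involve
  \<open>f\<close> and \<open>L\<close> at finitely many times between \<open>s\<close> and
  \<open>t\<close>. The space \<open>N\<close> is left open because both \<open>M\<close> and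
  \<open>F t\<close> are needed, the latter for adaptedness of \<open>C\<close>.\<close>

lemma passage_measurable:
  fixes f :: "real \<Rightarrow> 'a \<Rightarrow> real"
  assumes st: "0 \<le> s" "s \<le> t"
    and f: "\<And>w u. w \<in> space M \<Longrightarrow> 0 \<le> u \<Longrightarrow> continuous (at_right u) (\<lambda>u. f u w)"
    and N: "space N = space M" "\<And>u. s \<le> u \<Longrightarrow> u \<le> t \<Longrightarrow> L u \<in> borel_measurable N"
      "\<And>u. s \<le> u \<Longrightarrow> u \<le> t \<Longrightarrow> f u \<in> borel_measurable N"
  shows "(\<lambda>(w, x). if L s w < x \<and> x \<le> L t w then f (passage x w) w else 0)
    \<in> borel_measurable (N \<Otimes>\<^sub>M lborel)"
proof (rule borel_measurable_LIMSEQ_real)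
  fix p :: "'a \<times> real" assume "p \<in> space (N \<Otimes>\<^sub>M lborel)"
  then obtain w x where p: "p = (w, x)" "w \<in> space M" by (auto simp: space_pair_measure N(1))
  show "(\<lambda>n. (\<lambda>(w, x). \<Sum>i<Suc n. if L (grid s t n i) w < x \<and> x \<le> L (grid s t n (Suc i)) w
      then f (grid s t n (Suc i)) w else 0) p) \<longlonglongrightarrow>
      (\<lambda>(w, x). if L s w < x \<and> x \<le> L t w then f (passage x w) w else 0) p"
    using sum_cells_tendsto[OF p(2) st f[OF p(2)]] unfolding p(1) by simp
next
  fix n
  have [measurable]: "L (grid s t n i) \<in> borel_measurable N" if "i \<le> Suc n" for i
    using that st by (intro N grid_ge grid_le) auto
  have [measurable]: "f (grid s t n i) \<in> borel_measurable N" if "i \<le> Suc n" for i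
    using that st by (intro N grid_ge grid_le) auto
  have "(\<lambda>p. \<Sum>i<Suc n. if L (grid s t n i) (fst p) < snd p \<and> snd p \<le> L (grid s t n (Suc i)) (fst p)
      then f (grid s t n (Suc i)) (fst p) else 0) \<in> borel_measurable (N \<Otimes>\<^sub>M lborel)"
    by (intro borel_measurable_sum) (auto intro!: measurable_If simp: pred_def[symmetric])
  then show "(\<lambda>(w, x). \<Sum>i<Suc n. if L (grid s t n i) w < x \<and> x \<le> L (grid s t n (Suc i)) w
      then f (grid s t n (Suc i)) w else 0) \<in> borel_measurable (N \<Otimes>\<^sub>M lborel)"
    by (simp only: split_beta')
qed

definition Z_passage :: "real \<Rightarrow> real \<Rightarrow> 'a \<Rightarrow> real \<Rightarrow> real" where
  "Z_passage s t w x = (if L s w < x \<and> x \<le> L t w then Z (passage x w) w else 0)"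

lemma Z_passage_measurable:
  assumes st: "0 \<le> s" "s \<le> t"
    and N: "space N = space M" "\<And>u. s \<le> u \<Longrightarrow> u \<le> t \<Longrightarrow> L u \<in> borel_measurable N"
      "\<And>u. s \<le> u \<Longrightarrow> u \<le> t \<Longrightarrow> Z u \<in> borel_measurable N"
  shows "(\<lambda>(w, x). Z_passage s t w x) \<in> borel_measurable (N \<Otimes>\<^sub>M lborel)"
  unfolding Z_passage_def by (rule passage_measurable[OF st Z_right N])

end

text \<open>Puts the survival indicator on the same footing as \<open>Z\<close>: right continuous in
  time, so that it can be approximated at passage times by right ends of cells.\<close>

lemma continuous_at_right_less_indicator:
  assumes "0 \<le> u"
  shows "continuous (at_right u) (\<lambda>v. if ennreal v < a then 1 else 0 :: real)"
proof (cases "ennreal u < a")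
  case True
  have "(ennreal \<longlongrightarrow> ennreal u) (at_right u)"
    by (intro tendsto_ennrealI tendsto_ident_at)
  then have "\<forall>\<^sub>F v in at_right u. ennreal v < a"
    using True by (rule order_tendstoD)
  then have "\<forall>\<^sub>F v in at_right u. (if ennreal v < a then 1 else 0 :: real) = 1"
    by eventually_elim simp
  then show ?thesis using True by (simp add: continuous_within tendsto_eventually)
next
  case False
  have "\<forall>\<^sub>F v in at_right u. (if ennreal v < a then 1 else 0 :: real) = 0"
    using eventually_at_right_less[of u]
  proof eventually_elim
    fix v assume "u < v"
    then have "ennreal u \<le> ennreal v" by (intro ennreal_leI) simp
    then show "(if ennreal v < a then 1 else 0 :: real) = 0" using False by auto
  qed
  then show ?thesis using False by (simp add: continuous_within tendsto_eventually)
qed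

section \<open>The Stieltjes integral of \<open>Z\<close> against \<open>L\<close>\<close>

context hazard_setting
begin

lemma Z_integrable_mult:
  assumes "0 \<le> t" "Y \<in> borel_measurable (F t)" "integrable M Y"
  shows "(\<integral>w. Y w * Z t w \<partial>M) = (\<integral>w. Y w * (if ennreal t < \<tau> w then 1 else 0) \<partial>M)"
proof -
  interpret G: sigma_finite_subalgebra M "F t" by (rule sigma_finite_subalgebra_F[OF assms(1)])
  let ?I = "indicator {w' \<in> space M. ennreal t < \<tau> w'} :: 'a \<Rightarrow> real"
  have [measurable]: "Y \<in> borel_measurable M" "Z t \<in> borel_measurable M"
    using assms Z_adapted borel_measurable_F_M by auto
  have "(\<integral>w. Y w * Z t w \<partial>M) = (\<integral>w. Y w * real_cond_exp M (F t) ?I w \<partial>M)"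
    using Z_cond[OF assms(1)] by (intro integral_cong_AE) auto
  also have "\<dots> = (\<integral>w. Y w * ?I w \<partial>M)"
  proof (rule G.real_cond_exp_intg(2))
    show "integrable M (\<lambda>w. Y w * ?I w)"
      by (rule Bochner_Integration.integrable_bound[OF assms(3)]) (auto simp: indicator_def)
  qed (use assms in auto)
  also have "\<dots> = (\<integral>w. Y w * (if ennreal t < \<tau> w then 1 else 0) \<partial>M)"
    by (intro Bochner_Integration.integral_cong) auto
  finally show ?thesis .
qed

lemma Z_passage_bounds: 
  assumes w: "w \<in> space M" and st: "0 \<le> s" "s \<le> t"
    and Z: "\<And>u. s \<le> u \<Longrightarrow> u \<le> t \<Longrightarrow> c \<le> Z u w" "\<And>u. s \<le> u \<Longrightarrow> u \<le> t \<Longrightarrow> Z u w \<le> d"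
  shows "c * indicator {L s w<..L t w} x \<le> Z_passage s t w x"
    and "Z_passage s t w x \<le> d * indicator {L s w<..L t w} x"
  using passage_interval[OF w st, of x] Z by (auto simp: Z_passage_def indicator_def)

lemma Z_passage_0_1:
  assumes w: "w \<in> space M" and st: "0 \<le> s" "s \<le> t"
  shows "0 \<le> Z_passage s t w x" "Z_passage s t w x \<le> indicator {L s w<..L t w} x"
  using Z_passage_bounds[OF w st, of 0 1 x] Z_pos[OF w] Z_le_1[OF w] st by (auto simp: less_imp_le)

lemma Z_passage_integrable:
  assumes w: "w \<in> space M" and st: "0 \<le> s" "s \<le> t"
  shows "integrable lborel (Z_passage s t w)"
proof (rule Bochner_Integration.integrable_bound)
  show "integrable lborel (indicator {L s w<..L t w} :: real \<Rightarrow> real)"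
    using L_mono[OF w st] by (intro integrable_real_indicator) auto
  have "(\<lambda>(w, x). Z_passage s t w x) \<in> borel_measurable (M \<Otimes>\<^sub>M lborel)"
    using st by (intro Z_passage_measurable) (auto intro: borel_measurable_F_M[OF L_adapted] borel_measurable_F_M[OF Z_adapted])
  from measurable_Pair2[OF this w]
  show "Z_passage s t w \<in> borel_measurable lborel" by simp
  show "AE x in lborel. norm (Z_passage s t w x) \<le> norm (indicator {L s w<..L t w} x :: real)"
    using Z_passage_0_1[OF w st] by (auto intro!: AE_I2 simp: abs_of_nonneg)
qed

text \<open>\<open>C t\<close> is the Stieltjes integral of \<open>Z\<close> against \<open>L\<close> over \<open>(0, t]\<close>, written as a Lebesgue
  integral over the values of \<open>L\<close> so that Fubini's theorem applies to the product of \<open>M\<close> with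
  Lebesgue measure.\<close>

definition C :: "real \<Rightarrow> 'a \<Rightarrow> real" where
  "C t w = (\<integral>x. Z_passage 0 t w x \<partial>lborel)"

lemma C_diff:
  assumes w: "w \<in> space M" and st: "0 \<le> s" "s \<le> t"
  shows "C t w - C s w = (\<integral>x. Z_passage s t w x \<partial>lborel)"
proof -
  have "Z_passage s t w x = Z_passage 0 t w x - Z_passage 0 s w x" for x
    using L_mono[OF w st] L_nonneg[OF w st(1)] L_0[OF w] by (auto simp: Z_passage_def)
  then show ?thesis
    unfolding C_def using st
    by (simp only:) (intro Bochner_Integration.integral_diff[symmetric] Z_passage_integrable[OF w]; simp)
qed

lemma C_diff_bounds:
  assumes w: "w \<in> space M" and st: "0 \<le> s" "s \<le> t"
    and Z: "\<And>u. s \<le> u \<Longrightarrow> u \<le> t \<Longrightarrow> c \<le> Z u w" "\<And>u. s \<le> u \<Longrightarrow> u \<le> t \<Longrightarrow> Z u w \<le> d"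
  shows "c * (L t w - L s w) \<le> C t w - C s w" "C t w - C s w \<le> d * (L t w - L s w)"
proof -
  have i: "(\<integral>x. k * indicator {L s w<..L t w} x \<partial>lborel) = k * (L t w - L s w)"
    "integrable lborel (\<lambda>x. k * indicator {L s w<..L t w} x)" for k
    using L_mono[OF w st] by (auto simp: integrable_real_indicator)
  show "c * (L t w - L s w) \<le> C t w - C s w"
    unfolding C_diff[OF w st] i(1)[symmetric]
    by (intro integral_mono i(2) Z_passage_integrable[OF w st] Z_passage_bounds[OF w st Z])
  show "C t w - C s w \<le> d * (L t w - L s w)"
    unfolding C_diff[OF w st] i(1)[symmetric]
    by (intro integral_mono i(2) Z_passage_integrable[OF w st] Z_passage_bounds[OF w st Z])
qed

lemma C_0: "w \<in> space M \<Longrightarrow> C 0 w = 0"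
  by (simp add: C_def Z_passage_def L_0 less_le_not_le cong: if_cong)

lemma C_mono: "w \<in> space M \<Longrightarrow> 0 \<le> s \<Longrightarrow> s \<le> t \<Longrightarrow> C s w \<le> C t w"
  and C_diff_le: "w \<in> space M \<Longrightarrow> 0 \<le> s \<Longrightarrow> s \<le> t \<Longrightarrow> C t w - C s w \<le> L t w - L s w"
  using C_diff_bounds[of w s t 0 1] Z_pos[of w] Z_le_1[of w] by (auto simp: less_imp_le)

lemma C_nonneg: "w \<in> space M \<Longrightarrow> 0 \<le> t \<Longrightarrow> 0 \<le> C t w"
  using C_mono[of w 0 t] by (simp add: C_0)

lemma C_adapted:
  assumes t: "0 \<le> t" shows "C t \<in> borel_measurable (F t)"
proof -
  have "(\<lambda>(w, x). Z_passage 0 t w x) \<in> borel_measurable (F t \<Otimes>\<^sub>M lborel)"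
    using t by (intro Z_passage_measurable space_F_eq) (auto intro: borel_measurable_F_mono L_adapted Z_adapted)
  then have "(\<lambda>w. \<integral>x. Z_passage 0 t w x \<partial>lborel) \<in> borel_measurable (F t)"
    by (rule lborel.borel_measurable_lebesgue_integral)
  then show ?thesis by (simp add: C_def[abs_def])
qed

text \<open>Optional sampling at the passage time: it is approximated from above by grid times,
  where the defining property of \<open>Z\<close> applies, and both \<open>Z\<close> and the
  survival indicator are right continuous.\<close>

lemma expectation_at_passage:
  assumes st: "0 \<le> s" "s \<le> t" and A: "A \<in> sets (F s)"
  shows "(\<integral>w. indicator A w * Z_passage s t w x \<partial>M)
    = (\<integral>w. indicator A w * (if L s w < x \<and> x \<le> L t w then
        if ennreal (passage x w) < \<tau> w then 1 else 0 else 0) \<partial>M)" (is "_ = (\<integral>w. ?g w \<partial>M)")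
    and "(\<lambda>w. indicator A w * (if L s w < x \<and> x \<le> L t w then
        if ennreal (passage x w) < \<tau> w then 1 else 0 else 0 :: real)) \<in> borel_measurable M"
proof -
  define h :: "real \<Rightarrow> 'a \<Rightarrow> real" where "h u w = (if ennreal u < \<tau> w then 1 else 0)" for u w
  have h_right: "continuous (at_right u) (\<lambda>u. h u w)" if "0 \<le> u" for u w
    unfolding h_def by (rule continuous_at_right_less_indicator[OF that])
  have g_eq: "?g w = indicator A w * (if L s w < x \<and> x \<le> L t w then h (passage x w) w else 0)" for w
    by (simp add: h_def)
  have [measurable]: "h u \<in> borel_measurable M" for u unfolding h_def[abs_def] by measurable
  have [measurable]: "A \<in> sets M" using A sets_F_subset[OF st(1)] by auto
  define cell where "cell n i w = (L (grid s t n i) w < x \<and> x \<le> L (grid s t n (Suc i)) w)" for n i w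
  have grid0: "0 \<le> grid s t n i" "s \<le> grid s t n i" for n i
    using grid_ge[OF st(2), of n i] st by auto
  have Lm [measurable]: "L (grid s t n i) \<in> borel_measurable M" for n i
    by (rule borel_measurable_F_M[OF L_adapted]) (use grid0 in auto)
  have Zm [measurable]: "Z (grid s t n i) \<in> borel_measurable M" for n i
    by (rule borel_measurable_F_M[OF Z_adapted]) (use grid0 in auto)
  have [measurable]: "Measurable.pred M (cell n i)" for n i
    unfolding cell_def[abs_def] by measurable
  \<comment> \<open>The event \<open>cell n i\<close> is decided only at the right end of the cell,
    so \<open>Z\<close> is evaluated there.\<close>
  have termwise: "(\<integral>w. (indicator A w * (if cell n i w then 1 else 0)) * Z (grid s t n (Suc i)) w \<partial>M)
      = (\<integral>w. (indicator A w * (if cell n i w then 1 else 0)) * h (grid s t n (Suc i)) w \<partial>M)" for n i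
    unfolding h_def
  proof (rule Z_integrable_mult)
    show "0 \<le> grid s t n (Suc i)" by (rule grid0)
    have le: "grid s t n i \<le> grid s t n (Suc i)" using grid_mono[OF st(2), of i "Suc i" n] by simp
    have [measurable]: "A \<in> sets (F (grid s t n (Suc i)))"
      using A sets_F_le[OF st(1) grid0(2)] by auto
    have [measurable]: "L (grid s t n (Suc i)) \<in> borel_measurable (F (grid s t n (Suc i)))"
      "L (grid s t n i) \<in> borel_measurable (F (grid s t n (Suc i)))"
      using L_adapted grid0 borel_measurable_F_mono[OF L_adapted grid0(1) le] by auto
    show "(\<lambda>w. indicator A w * (if cell n i w then 1 else 0 :: real))
        \<in> borel_measurable (F (grid s t n (Suc i)))"
      unfolding cell_def by measurable
    show "integrable M (\<lambda>w. indicator A w * (if cell n i w then 1 else 0 :: real))"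
      by (rule integrable_const_bound[of _ 1]) (auto simp: indicator_def)
  qed
  define SZ where "SZ n w = (\<Sum>i<Suc n. if cell n i w then Z (grid s t n (Suc i)) w else 0)" for n w
  define Sh where "Sh n w = (\<Sum>i<Suc n. if cell n i w then h (grid s t n (Suc i)) w else 0)" for n w
  have eq: "(\<integral>w. indicator A w * SZ n w \<partial>M) = (\<integral>w. indicator A w * Sh n w \<partial>M)" for n
  proof -
    have "(\<integral>w. indicator A w * SZ n w \<partial>M)
      = (\<integral>w. (\<Sum>i<Suc n. (indicator A w * (if cell n i w then 1 else 0)) * Z (grid s t n (Suc i)) w) \<partial>M)"
      unfolding SZ_def sum_distrib_left by (intro Bochner_Integration.integral_cong sum.cong) auto
    also have "\<dots> = (\<Sum>i<Suc n. \<integral>w. (indicator A w * (if cell n i w then 1 else 0)) * Z (grid s t n (Suc i)) w \<partial>M)"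
      by (intro Bochner_Integration.integral_sum integrable_const_bound[of _ 1])
        (auto simp: indicator_def abs_of_pos Z_pos Z_le_1 grid0 less_imp_le intro!: AE_I2)
    also have "\<dots> = (\<Sum>i<Suc n. \<integral>w. (indicator A w * (if cell n i w then 1 else 0)) * h (grid s t n (Suc i)) w \<partial>M)"
      by (simp only: termwise)
    also have "\<dots> = (\<integral>w. (\<Sum>i<Suc n. (indicator A w * (if cell n i w then 1 else 0)) * h (grid s t n (Suc i)) w) \<partial>M)"
      by (intro Bochner_Integration.integral_sum[symmetric] integrable_const_bound[of _ 1])
        (auto simp: indicator_def h_def)
    also have "\<dots> = (\<integral>w. indicator A w * Sh n w \<partial>M)"
      unfolding Sh_def sum_distrib_left by (intro Bochner_Integration.integral_cong sum.cong) auto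
    finally show ?thesis .
  qed
  have SZ_lim: "(\<lambda>n. indicator A w * SZ n w) \<longlonglongrightarrow> indicator A w * Z_passage s t w x" if "w \<in> space M" for w
    unfolding SZ_def Z_passage_def cell_def
    by (intro tendsto_mult tendsto_const sum_cells_tendsto[OF that st Z_right[OF that]])
  have Sh_lim: "(\<lambda>n. indicator A w * Sh n w) \<longlonglongrightarrow> ?g w" if "w \<in> space M" for w
    unfolding Sh_def g_eq cell_def
    by (intro tendsto_mult tendsto_const sum_cells_tendsto[OF that st h_right])
  have SZ_bound: "\<bar>indicator A w * SZ n w\<bar> \<le> 1" if "w \<in> space M" for n w
    using sum_cells_bounds[OF that st, of "\<lambda>u. Z u w" n x] Z_pos[OF that] Z_le_1[OF that]
    unfolding SZ_def cell_def by (auto simp: indicator_def less_imp_le simp del: sum.lessThan_Suc)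
  have Sh_bound: "\<bar>indicator A w * Sh n w\<bar> \<le> 1" if "w \<in> space M" for n w
    using sum_cells_bounds[OF that st, of "\<lambda>u. h u w" n x]
    unfolding Sh_def cell_def by (auto simp: indicator_def h_def simp del: sum.lessThan_Suc)
  have mSZ [measurable]: "(\<lambda>w. indicator A w * SZ n w) \<in> borel_measurable M" for n
    unfolding SZ_def by measurable
  have mSh [measurable]: "(\<lambda>w. indicator A w * Sh n w) \<in> borel_measurable M" for n
    unfolding Sh_def by measurable
  show g [measurable]: "?g \<in> borel_measurable M"
    by (rule borel_measurable_LIMSEQ_real[OF Sh_lim mSh])
  have [measurable]: "(\<lambda>w. indicator A w * Z_passage s t w x) \<in> borel_measurable M"
    by (rule borel_measurable_LIMSEQ_real[OF SZ_lim mSZ])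
  have "(\<lambda>n. \<integral>w. indicator A w * SZ n w \<partial>M) \<longlonglongrightarrow> (\<integral>w. indicator A w * Z_passage s t w x \<partial>M)"
    using SZ_bound SZ_lim by (intro integral_dominated_convergence[where w = "\<lambda>_. 1"]) auto
  moreover have "(\<lambda>n. \<integral>w. indicator A w * Sh n w \<partial>M) \<longlonglongrightarrow> (\<integral>w. ?g w \<partial>M)"
    using Sh_bound Sh_lim by (intro integral_dominated_convergence[where w = "\<lambda>_. 1"]) auto
  ultimately show "(\<integral>w. indicator A w * Z_passage s t w x \<partial>M) = (\<integral>w. ?g w \<partial>M)"
    unfolding eq by (rule LIMSEQ_unique)
qed

end

section \<open>The compensation identity for \<open>C\<close> when \<open>L\<close> is
  continuous\<close>

locale continuous_hazard_setting = hazard_setting +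
  assumes L_continuous: "\<And>w. w \<in> space M \<Longrightarrow> continuous_on {0..} (\<lambda>t. L t w)"
begin

lemma L_continuous_left:
  assumes "w \<in> space M" "0 < t"
  shows "((\<lambda>s. L s w) \<longlongrightarrow> L t w) (at_left t)"
  using assms by (intro tendsto_at_left_of_continuous_on L_continuous)

text \<open>A level is passed before \<open>\<tau>\<close> exactly when it lies below the value of
  \<open>L\<close> at \<open>\<tau>\<close>, up to one exceptional level. Continuity of
  \<open>L\<close> enters here: a jump of \<open>L\<close> at \<open>\<tau>\<close> would consist of
  levels passed at \<open>\<tau>\<close> itself, and these would be lost.\<close>

lemma nn_integral_passage_before:
  assumes w: "w \<in> space M" and st: "0 \<le> s" "s \<le> t"
  shows "(\<integral>\<^sup>+x. ennreal (if L s w < x \<and> x \<le> L t w then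
        if ennreal (passage x w) < \<tau> w then 1 else 0 else 0) \<partial>lborel)
    = ennreal (L_tau t w - L_tau s w)"
proof -
  let ?a = "L_tau s w" and ?b = "L_tau t w"
  \<comment> \<open>The level \<open>?b\<close> may be reached for the first time at
    \<open>\<tau>\<close>; being a single point it is null.\<close>
  have pt: "ennreal (if L s w < x \<and> x \<le> L t w then
      if ennreal (passage x w) < \<tau> w then 1 else 0 else 0) = indicator {?a<..?b} x" if x: "x \<noteq> ?b" for x
  proof (cases "\<tau> w \<le> ennreal s")
    case True
    then have "\<tau> w \<le> ennreal t" using st by (meson ennreal_leI order_trans)
    then have "?a = ?b" using True by (simp add: stopped_at_after)
    moreover have "\<not> ennreal (passage x w) < \<tau> w" if "L s w < x" "x \<le> L t w"
      using passage_interval(1)[OF w st that] True ennreal_leI[of s "passage x w"]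
      by (meson less_imp_le not_less order_trans)
    ultimately show ?thesis by auto
  next
    case False
    then have a: "?a = L s w" using st by (simp add: stopped_at_before)
    show ?thesis
    proof (cases "ennreal t < \<tau> w")
      case True
      have "ennreal (passage x w) < \<tau> w" if "L s w < x" "x \<le> L t w"
        using passage_interval(2)[OF w st that] True by (meson ennreal_leI le_less_trans)
      moreover have "?b = L t w" using True st by (simp add: stopped_at_before)
      ultimately show ?thesis using a by auto
    next
      case t: False
      define r where "r = enn2real (\<tau> w)"
      have "\<tau> w \<noteq> \<top>" using t by (metis ennreal_less_top)
      then have r: "\<tau> w = ennreal r" "0 \<le> r" by (simp_all add: r_def less_top)
      have "ennreal r \<le> ennreal t" using t unfolding r(1) not_less .
      moreover have "\<not> ennreal r \<le> ennreal s" using False unfolding r(1) .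
      ultimately have sr: "s < r" "r \<le> t"
        using ennreal_leI[of r s] st by (auto simp: not_le[symmetric])
      have b: "?b = L r w" using t r by (simp add: stopped_at_after)
      have key: "ennreal (passage x w) < \<tau> w \<longleftrightarrow> x \<le> L r w" if in1: "L s w < x" "x \<le> L t w"
      proof -
        have p: "s < passage x w" using passage_interval(1)[OF w st that] .
        have "passage x w < r \<longleftrightarrow> x \<le> L r w"
        proof
          assume "passage x w < r"
          then show "x \<le> L r w" using passage_le_iff[OF w _ in1(2), of r] sr st by simp
        next
          assume "x \<le> L r w"
          then have "x < L r w" using x b by simp
          \<comment> \<open>By left continuity a level strictly below \<open>L r w\<close> is
            exceeded already before \<open>r\<close>.\<close>
          then have "\<forall>\<^sub>F u in at_left r. x < L u w"
            using L_continuous_left[OF w, of r] sr st by (intro order_tendstoD) auto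
          with eventually_at_left_real[OF sr(1)]
          have "\<forall>\<^sub>F u in at_left r. x < L u w \<and> u \<in> {s<..<r}"
            by eventually_elim simp
          then obtain u where "x < L u w" "s < u" "u < r"
            using eventually_happens'[OF trivial_limit_at_left_real] by fastforce
          then show "passage x w < r"
            using passage_le_iff[OF w _ in1(2), of u] st sr by simp
        qed
        then show ?thesis using p st r by (simp add: ennreal_less_iff)
      qed
      have "L r w \<le> L t w" using sr st by (intro L_mono[OF w]) auto
      then show ?thesis using a b key by (auto simp: indicator_def)
    qed
  qed
  have "(\<integral>\<^sup>+x. ennreal (if L s w < x \<and> x \<le> L t w then
        if ennreal (passage x w) < \<tau> w then 1 else 0 else 0) \<partial>lborel)
    = (\<integral>\<^sup>+x. indicator {?a<..?b} x \<partial>lborel)"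
    using AE_lborel_singleton[of ?b] by (intro nn_integral_cong_AE) (elim eventually_mono pt)
  also have "\<dots> = ennreal (?b - ?a)"
    using L_mono[OF w stopped_at_nonneg stopped_at_mono[OF st(2), of \<tau> w]] by simp
  finally show ?thesis .
qed

text \<open>After exchanging the integrals over sample points and levels,
  \<open>expectation_at_passage\<close> replaces \<open>Z\<close> by the survival indicator for each
  level separately. The integrals are extended nonnegative ones because integrability of
  \<open>C\<close> is only derived from this identity.\<close>

lemma C_expectation:
  assumes st: "0 \<le> s" "s \<le> t" and A: "A \<in> sets (F s)"
  shows "(\<integral>\<^sup>+w. ennreal (indicator A w * (C t w - C s w)) \<partial>M)
    = (\<integral>\<^sup>+w. ennreal (indicator A w * (L_tau t w - L_tau s w)) \<partial>M)"
proof -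
  interpret P: pair_sigma_finite M lborel ..
  define g where "g w x = indicator A w * (if L s w < x \<and> x \<le> L t w then
        if ennreal (passage x w) < \<tau> w then 1 else 0 else 0 :: real)" for w x
  define f where "f w x = indicator A w * Z_passage s t w x" for w x
  have A' [measurable]: "A \<in> sets M" using A sets_F_subset[OF st(1)] by auto
  have Lm: "L u \<in> borel_measurable M" "Z u \<in> borel_measurable M" if "s \<le> u" for u
    using that st by (auto intro: borel_measurable_F_M[OF L_adapted] borel_measurable_F_M[OF Z_adapted])
  have fm: "(\<lambda>(w, x). f w x) \<in> borel_measurable (M \<Otimes>\<^sub>M lborel)"
  proof -
    have [measurable]: "(\<lambda>p. Z_passage s t (fst p) (snd p)) \<in> borel_measurable (M \<Otimes>\<^sub>M lborel)"
      using Z_passage_measurable[OF st, of M] Lm by (simp add: split_beta')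
    show ?thesis unfolding f_def split_beta' by measurable
  qed
  have gm: "(\<lambda>(w, x). g w x) \<in> borel_measurable (M \<Otimes>\<^sub>M lborel)"
  proof -
    have "(\<lambda>(w, x). if L s w < x \<and> x \<le> L t w then if ennreal (passage x w) < \<tau> w then 1 else 0 else 0 :: real)
      \<in> borel_measurable (M \<Otimes>\<^sub>M lborel)"
      using Lm by (intro passage_measurable[OF st, where f = "\<lambda>u w. if ennreal u < \<tau> w then 1 else 0"]
          continuous_at_right_less_indicator) auto
    then have [measurable]: "(\<lambda>p. if L s (fst p) < snd p \<and> snd p \<le> L t (fst p) then
        if ennreal (passage (snd p) (fst p)) < \<tau> (fst p) then 1 else 0 else 0 :: real)
      \<in> borel_measurable (M \<Otimes>\<^sub>M lborel)"
      by (simp add: split_beta')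
    show ?thesis unfolding g_def split_beta' by measurable
  qed
  have f01: "0 \<le> f w x" "f w x \<le> 1" if "w \<in> space M" for w x
    using Z_passage_0_1[OF that st, of x] order_trans[OF Z_passage_0_1(2)[OF that st, of x], of 1]
    by (auto simp: f_def indicator_def)
  have g01: "0 \<le> g w x" "g w x \<le> 1" for w x
    by (auto simp: g_def indicator_def)
  have fx [measurable]: "(\<lambda>w. f w x) \<in> borel_measurable M" for x
    using measurable_Pair1[OF fm, of x] by simp
  have gx [measurable]: "(\<lambda>w. g w x) \<in> borel_measurable M" for x
    using measurable_Pair1[OF gm, of x] by simp
  have fg: "(\<integral>\<^sup>+w. ennreal (f w x) \<partial>M) = (\<integral>\<^sup>+w. ennreal (g w x) \<partial>M)" for x
  proof -
    have "(\<integral>\<^sup>+w. ennreal (f w x) \<partial>M) = ennreal (\<integral>w. f w x \<partial>M)"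
      using f01 by (intro nn_integral_eq_integral integrable_const_bound[of _ 1]) auto
    also have "(\<integral>w. f w x \<partial>M) = (\<integral>w. g w x \<partial>M)"
      unfolding f_def g_def by (rule expectation_at_passage[OF st A])
    also have "ennreal \<dots> = (\<integral>\<^sup>+w. ennreal (g w x) \<partial>M)"
      using g01 by (intro nn_integral_eq_integral[symmetric] integrable_const_bound[of _ 1]) auto
    finally show ?thesis .
  qed
  have "(\<integral>\<^sup>+w. ennreal (indicator A w * (C t w - C s w)) \<partial>M)
      = (\<integral>\<^sup>+w. \<integral>\<^sup>+x. ennreal (f w x) \<partial>lborel \<partial>M)"
  proof (rule nn_integral_cong)
    fix w assume w: "w \<in> space M"
    have "(\<integral>\<^sup>+x. ennreal (f w x) \<partial>lborel) = ennreal (\<integral>x. f w x \<partial>lborel)"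
      unfolding f_def using Z_passage_0_1[OF w st]
      by (intro nn_integral_eq_integral integrable_mult_right Z_passage_integrable[OF w st]) auto
    also have "(\<integral>x. f w x \<partial>lborel) = indicator A w * (C t w - C s w)"
      by (simp add: f_def C_diff[OF w st])
    finally show "ennreal (indicator A w * (C t w - C s w)) = (\<integral>\<^sup>+x. ennreal (f w x) \<partial>lborel)" by simp
  qed
  also have "\<dots> = (\<integral>\<^sup>+x. \<integral>\<^sup>+w. ennreal (f w x) \<partial>M \<partial>lborel)"
    using fm by (intro P.Fubini'[symmetric]) (simp add: split_beta')
  also have "\<dots> = (\<integral>\<^sup>+x. \<integral>\<^sup>+w. ennreal (g w x) \<partial>M \<partial>lborel)"
    by (simp only: fg)
  also have "\<dots> = (\<integral>\<^sup>+w. \<integral>\<^sup>+x. ennreal (g w x) \<partial>lborel \<partial>M)"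
    using gm by (intro P.Fubini') (simp add: split_beta')
  also have "\<dots> = (\<integral>\<^sup>+w. ennreal (indicator A w * (L_tau t w - L_tau s w)) \<partial>M)"
  proof (rule nn_integral_cong)
    fix w assume w: "w \<in> space M"
    show "(\<integral>\<^sup>+x. ennreal (g w x) \<partial>lborel) = ennreal (indicator A w * (L_tau t w - L_tau s w))"
      using nn_integral_passage_before[OF w st] by (cases "w \<in> A") (simp_all add: g_def)
  qed
  finally show ?thesis .
qed

text \<open>Chains the identity for \<open>C\<close> with the compensation of \<open>\<tau>\<close>
  by \<open>L\<close> and with the definition of \<open>Z\<close>; the outcome is the martingale
  property of \<open>Z + C\<close>, tested on \<open>A\<close>. Only \<open>L\<close> stopped at
  \<open>\<tau>\<close> is assumed integrable, and \<open>C\<close> inherits integrability from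
  it.\<close>

lemma
  assumes st: "0 \<le> s" "s \<le> t" and A: "A \<in> sets (F s)"
  shows C_increment_integrable: "integrable M (\<lambda>w. indicator A w * (C t w - C s w))" (is ?int)
    and C_compensates: "(\<integral>w. indicator A w * (C t w - C s w) \<partial>M)
      = (\<integral>w. indicator A w * (Z s w - Z t w) \<partial>M)" (is ?eq)
proof -
  have t: "0 \<le> t" using st by simp
  have A' [measurable]: "A \<in> sets M" "A \<in> sets (F s)" "A \<in> sets (F t)"
    using A sets_F_subset[OF st(1)] sets_F_le[OF st] by auto
  have m [measurable]: "C s \<in> borel_measurable M" "C t \<in> borel_measurable M"
      "Z s \<in> borel_measurable M" "Z t \<in> borel_measurable M"
    using st t by (auto intro: borel_measurable_F_M[OF C_adapted] borel_measurable_F_M[OF Z_adapted])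
  let ?f = "\<lambda>w. indicator A w * (C t w - C s w)"
  let ?g = "\<lambda>w. indicator A w * (L_tau t w - L_tau s w)"
  have g: "integrable M ?g"
  proof (rule Bochner_Integration.integrable_bound)
    show "integrable M (\<lambda>w. L_tau t w - L_tau s w)"
      using st by (intro Bochner_Integration.integrable_diff L_integrable) auto
    then have [measurable]: "(\<lambda>w. L_tau t w - L_tau s w) \<in> borel_measurable M" by auto
    show "?g \<in> borel_measurable M" by measurable
  qed (auto simp: indicator_def)
  have nonneg: "AE w in M. 0 \<le> ?f w" "AE w in M. 0 \<le> ?g w"
    using C_mono[OF _ st] L_mono[OF _ stopped_at_nonneg stopped_at_mono[OF st(2)]]
    by (auto intro!: AE_I2 mult_nonneg_nonneg)
  have fin: "(\<integral>\<^sup>+w. ennreal (?f w) \<partial>M) < \<infinity>"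
    unfolding C_expectation[OF st A] using g nonneg
    by (subst nn_integral_eq_integral) auto
  show ?int
    by (rule integrableI_nonneg) (use nonneg fin in auto)
  have "(\<integral>w. ?f w \<partial>M) = (\<integral>w. ?g w \<partial>M)"
    using nonneg g by (simp add: integral_eq_nn_integral C_expectation[OF st A])
  also have "\<dots> = measure M {w \<in> A. ennreal s < \<tau> w \<and> \<tau> w \<le> ennreal t}"
    by (rule L_compensates[OF st A])
  also have "\<dots> = (\<integral>w. indicator A w * (if ennreal s < \<tau> w then 1 else 0)
      - indicator A w * (if ennreal t < \<tau> w then 1 else 0) \<partial>M)"
  proof -
    have sub: "A \<subseteq> space M" using A'(1) by (rule sets.sets_into_space)
    have B: "{w \<in> A. ennreal s < \<tau> w \<and> \<tau> w \<le> ennreal t} = A \<inter> {w \<in> space M. ennreal s < \<tau> w \<and> \<tau> w \<le> ennreal t}"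
      using sub by auto
    have [measurable]: "{w \<in> A. ennreal s < \<tau> w \<and> \<tau> w \<le> ennreal t} \<in> sets M"
      unfolding B by measurable
    have "measure M {w \<in> A. ennreal s < \<tau> w \<and> \<tau> w \<le> ennreal t}
      = (\<integral>w. indicator {w \<in> A. ennreal s < \<tau> w \<and> \<tau> w \<le> ennreal t} w \<partial>M)"
      by simp
    also have "\<dots> = (\<integral>w. indicator A w * (if ennreal s < \<tau> w then 1 else 0)
      - indicator A w * (if ennreal t < \<tau> w then 1 else 0) \<partial>M)"
      using ennreal_leI[OF st(2)]
      by (intro Bochner_Integration.integral_cong refl)
        (auto simp: indicator_def not_less not_le dest: le_less_trans order_trans)
    finally show ?thesis .
  qed
  also have "\<dots> = (\<integral>w. indicator A w * (if ennreal s < \<tau> w then 1 else 0) \<partial>M)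
      - (\<integral>w. indicator A w * (if ennreal t < \<tau> w then 1 else 0) \<partial>M)"
    by (intro Bochner_Integration.integral_diff integrable_const_bound[of _ 1]) (auto simp: indicator_def)
  also have "\<dots> = (\<integral>w. indicator A w * Z s w \<partial>M) - (\<integral>w. indicator A w * Z t w \<partial>M)"
    using st t by (subst (1 2) Z_integrable_mult) (auto intro!: integrable_const_bound[of _ 1] simp: indicator_def)
  also have "\<dots> = (\<integral>w. indicator A w * Z s w - indicator A w * Z t w \<partial>M)"
    using st t Z_pos Z_le_1
    by (intro Bochner_Integration.integral_diff[symmetric] integrable_const_bound[of _ 1])
      (auto simp: indicator_def abs_of_pos less_imp_le intro!: AE_I2)
  finally show ?eq by (simp add: right_diff_distrib)
qed

end

subsection \<open>The martingale Z + C\<close>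

text \<open>Summation by parts. For \<open>a = c N\<close> the right-hand side is
  \<open>(c N - c 0)\<^sup>2\<close>.\<close>

lemma sum_increments_telescope:
  fixes c :: "nat \<Rightarrow> real"
  shows "2 * (\<Sum>i<N. (c (Suc i) - c i) * (a - c (Suc i))) + (\<Sum>i<N. (c (Suc i) - c i)\<^sup>2)
    = 2 * a * (c N - c 0) - ((c N)\<^sup>2 - (c 0)\<^sup>2)"
  by (induction N) (simp_all add: algebra_simps power2_eq_square)

lemma sum_square_increments_le:
  fixes c :: "nat \<Rightarrow> real"
  assumes "\<And>i. i < N \<Longrightarrow> c i \<le> c (Suc i)" and "\<And>i. i \<le> N \<Longrightarrow> c i \<le> c N"
  shows "(\<Sum>i<N. (c (Suc i) - c i)\<^sup>2) \<le> (c N - c 0)\<^sup>2"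
proof -
  have "0 \<le> (\<Sum>i<N. (c (Suc i) - c i) * (c N - c (Suc i)))"
    using assms by (intro sum_nonneg mult_nonneg_nonneg) auto
  then show ?thesis
    using sum_increments_telescope[where c = c and N = N and a = "c N"] by (simp add: algebra_simps power2_eq_square)
qed

context continuous_hazard_setting
begin

lemma C_continuous:
  assumes w: "w \<in> space M"
  shows "continuous_on {0..} (\<lambda>t. C t w)"
  unfolding continuous_on_iff
proof (intro ballI allI impI)
  fix x e :: real assume x: "x \<in> {0..}" and e: "0 < e"
  obtain d where d: "0 < d" "\<And>y. y \<in> {0..} \<Longrightarrow> dist y x < d \<Longrightarrow> dist (L y w) (L x w) < e"
    using L_continuous[OF w] x e unfolding continuous_on_iff by blast
  have "dist (C y w) (C x w) \<le> dist (L y w) (L x w)" if y: "y \<in> {0..}" for y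
    using C_diff_le[OF w, of x y] C_diff_le[OF w, of y x] C_mono[OF w, of x y] C_mono[OF w, of y x] x y
    by (cases "x \<le> y") (auto simp: dist_real_def)
  then show "\<exists>d>0. \<forall>y\<in>{0..}. dist y x < d \<longrightarrow> dist (C y w) (C x w) < e"
    using d by (meson le_less_trans)
qed

lemma C_integrable: "0 \<le> t \<Longrightarrow> integrable M (C t)"
  and C_expectation_le: "0 \<le> t \<Longrightarrow> (\<integral>w. C t w \<partial>M) \<le> 1"
proof -
  assume t: "0 \<le> t"
  have sp: "space M \<in> sets (F 0)" using sets.top[of "F 0"] by (simp add: space_F_eq)
  have eq: "indicator (space M) w * (C t w - C 0 w) = C t w" if "w \<in> space M" for w
    using that by (simp add: C_0)
  show "integrable M (C t)"
    by (rule iffD1[OF Bochner_Integration.integrable_cong[OF refl eq] C_increment_integrable[OF order_refl t sp]])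
  have "(\<integral>w. C t w \<partial>M) = (\<integral>w. indicator (space M) w * (C t w - C 0 w) \<partial>M)"
    by (intro Bochner_Integration.integral_cong) (auto simp: C_0)
  also have "\<dots> = (\<integral>w. indicator (space M) w * (Z 0 w - Z t w) \<partial>M)"
    by (rule C_compensates[OF _ t sp]) simp
  also have "\<dots> \<le> (\<integral>w. 1 \<partial>M)"
  proof (rule integral_mono)
    show "indicator (space M) w * (Z 0 w - Z t w) \<le> 1" if "w \<in> space M" for w
      using that Z_le_1[OF that, of 0] Z_pos[OF that t] by simp
    have "Z 0 \<in> borel_measurable M" "Z t \<in> borel_measurable M"
      using t by (auto intro: borel_measurable_F_M[OF Z_adapted])
    moreover have "\<bar>Z 0 w - Z t w\<bar> \<le> 1" if "w \<in> space M" for w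
      using Z_le_1[OF that order_refl] Z_le_1[OF that t] Z_pos[OF that order_refl] Z_pos[OF that t]
      by linarith
    ultimately show "integrable M (\<lambda>w. indicator (space M) w * (Z 0 w - Z t w))"
      by (intro integrable_const_bound[of _ 1] AE_I2) auto
  qed simp
  finally show "(\<integral>w. C t w \<partial>M) \<le> 1" by (simp add: prob_space)
qed

definition X :: "real \<Rightarrow> 'a \<Rightarrow> real" where
  "X t w = Z t w + C t w"

lemma Z_measurable: "0 \<le> t \<Longrightarrow> Z t \<in> borel_measurable M"
  by (rule borel_measurable_F_M[OF Z_adapted])

lemma C_measurable: "0 \<le> t \<Longrightarrow> C t \<in> borel_measurable M"
  by (rule borel_measurable_F_M[OF C_adapted])

lemma Z_integrable: "0 \<le> t \<Longrightarrow> integrable M (Z t)"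
  using Z_measurable Z_pos Z_le_1
  by (intro integrable_const_bound[of _ 1] AE_I2) (auto simp: abs_le_iff less_imp_le intro: order_trans[of _ 0])

lemma X_adapted: "0 \<le> t \<Longrightarrow> X t \<in> borel_measurable (F t)"
  unfolding X_def[abs_def] by (intro borel_measurable_add Z_adapted C_adapted)

lemma X_measurable: "0 \<le> t \<Longrightarrow> X t \<in> borel_measurable M"
  by (rule borel_measurable_F_M[OF X_adapted])

lemma X_integrable: "0 \<le> t \<Longrightarrow> integrable M (X t)"
  unfolding X_def[abs_def] by (intro Bochner_Integration.integrable_add Z_integrable C_integrable)

lemma X_cond:
  assumes st: "0 \<le> s" "s \<le> t"
  shows "AE w in M. real_cond_exp M (F s) (X t) w = X s w"
proof -
  have t: "0 \<le> t" using st by simp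
  interpret G: sigma_finite_subalgebra M "F s" by (rule sigma_finite_subalgebra_F[OF st(1)])
  show ?thesis
  proof (rule G.real_cond_exp_charact)
    fix A assume A: "A \<in> sets (F s)"
    then have [measurable]: "A \<in> sets M" using sets_F_subset[OF st(1)] by auto
    have i: "integrable M (\<lambda>w. indicator A w * f w)" if "integrable M f" for f :: "'a \<Rightarrow> real"
      using integrable_mult_indicator[OF \<open>A \<in> sets M\<close> that] by simp
    have "(\<integral>w. indicator A w * X t w \<partial>M) - (\<integral>w. indicator A w * X s w \<partial>M)
      = (\<integral>w. indicator A w * X t w - indicator A w * X s w \<partial>M)"
      using st t by (intro Bochner_Integration.integral_diff[symmetric] i X_integrable)
    also have "\<dots> = (\<integral>w. indicator A w * (C t w - C s w) - indicator A w * (Z s w - Z t w) \<partial>M)"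
      by (intro Bochner_Integration.integral_cong) (auto simp: X_def algebra_simps)
    also have "\<dots> = (\<integral>w. indicator A w * (C t w - C s w) \<partial>M) - (\<integral>w. indicator A w * (Z s w - Z t w) \<partial>M)"
      using st t by (intro Bochner_Integration.integral_diff i C_integrable Z_integrable Bochner_Integration.integrable_diff)
    also have "\<dots> = 0" by (simp add: C_compensates[OF st A])
    finally show "set_lebesgue_integral M A (X t) = set_lebesgue_integral M A (X s)"
      by (simp add: set_lebesgue_integral_def)
  qed (use st t in \<open>auto intro: X_integrable X_adapted\<close>)
qed

lemma X_mult:
  assumes st: "0 \<le> s" "s \<le> t" and Y: "Y \<in> borel_measurable (F s)" "integrable M (\<lambda>w. Y w * X t w)"
  shows "(\<integral>w. Y w * X t w \<partial>M) = (\<integral>w. Y w * X s w \<partial>M)"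
proof -
  have t: "0 \<le> t" using st by simp
  interpret G: sigma_finite_subalgebra M "F s" by (rule sigma_finite_subalgebra_F[OF st(1)])
  have [measurable]: "Y \<in> borel_measurable M" "X s \<in> borel_measurable M" "X t \<in> borel_measurable M"
    using borel_measurable_F_M[OF Y(1) st(1)] st t X_measurable by auto
  note * = G.real_cond_exp_intg[OF Y(2) Y(1)]
  have ae: "AE w in M. Y w * real_cond_exp M (F s) (X t) w = Y w * X s w"
    using X_cond[OF st] by eventually_elim simp
  have "(\<integral>w. Y w * X s w \<partial>M) = (\<integral>w. Y w * real_cond_exp M (F s) (X t) w \<partial>M)"
    using ae by (intro integral_cong_AE) auto
  then show "(\<integral>w. Y w * X t w \<partial>M) = (\<integral>w. Y w * X s w \<partial>M)"
    using *(2) by simp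
qed

lemma X_right: "w \<in> space M \<Longrightarrow> 0 \<le> t \<Longrightarrow> continuous (at_right t) (\<lambda>s. X s w)"
  unfolding X_def by (intro continuous_add Z_right continuous_at_right_of_continuous_on C_continuous)

lemma X_martingale: "martingale M F X"
  unfolding martingale_def adapted_def cadlag_paths_def right_continuous_paths_def
proof (intro conjI allI impI)
  show "AE w in M. \<forall>t>0. \<exists>l. ((\<lambda>s. X s w) \<longlongrightarrow> l) (at_left t)"
  proof (intro AE_I2 allI impI)
    fix w and t :: real assume w: "w \<in> space M" and t: "0 < t"
    obtain l where "((\<lambda>s. Z s w) \<longlongrightarrow> l) (at_left t)" using Z_left[OF w t] by blast
    then have "((\<lambda>s. X s w) \<longlongrightarrow> l + C t w) (at_left t)"
      unfolding X_def by (intro tendsto_add tendsto_at_left_of_continuous_on[OF C_continuous[OF w] t])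
    then show "\<exists>l. ((\<lambda>s. X s w) \<longlongrightarrow> l) (at_left t)" by blast
  qed
qed (auto intro: X_adapted X_right X_integrable X_cond)

text \<open>
  Energy inequality: by the martingale property the later increments of \<open>C\<close> have conditional
  expectation at most 1. The truncation at \<open>K\<close> makes the sum of squared increments bounded, so that
  it vanishes in the limit by dominated convergence.
\<close>

lemma truncated_C_square_le:
  assumes t: "0 \<le> t" and K: "0 \<le> K"
  shows "(\<integral>w. (min (C t w) K)\<^sup>2 \<partial>M) \<le> 2"
proof -
  define c where "c u w = min (C u w) K" for u w
  have g0: "0 \<le> grid 0 t n i" for n i using grid_ge[OF t] by simp
  have cm [measurable]: "c (grid 0 t n i) \<in> borel_measurable M" for n i
    unfolding c_def[abs_def] by (intro borel_measurable_min C_measurable g0 borel_measurable_const)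
  have c_bounds: "0 \<le> c u w" "c u w \<le> K" if "w \<in> space M" "0 \<le> u" for u w
    using C_nonneg[OF that] K by (auto simp: c_def)
  have c_mono: "c u w \<le> c v w" if "w \<in> space M" "0 \<le> u" "u \<le> v" for u v w
    using C_mono[OF that] by (auto simp: c_def)
  have c_diff_le: "c v w - c u w \<le> C v w - C u w" if "w \<in> space M" "0 \<le> u" "u \<le> v" for u v w
    using C_mono[OF that] by (auto simp: c_def)
  have grid_Suc_ge: "grid 0 t n i \<le> grid 0 t n (Suc i)" for n i
    using grid_mono[OF t, of i "Suc i" n] by simp
  define Q where "Q n w = (\<Sum>i<Suc n. (c (grid 0 t n (Suc i)) w - c (grid 0 t n i) w)\<^sup>2)" for n w
  have Q_bounds: "0 \<le> Q n w" "Q n w \<le> K\<^sup>2" if w: "w \<in> space M" for n w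
  proof -
    show "0 \<le> Q n w" unfolding Q_def by (intro sum_nonneg) auto
    have "Q n w \<le> (c (grid 0 t n (Suc n)) w - c (grid 0 t n 0) w)\<^sup>2"
      unfolding Q_def using t
      by (intro sum_square_increments_le[of "Suc n" "\<lambda>i. c (grid 0 t n i) w"] c_mono[OF w] g0 grid_mono) auto
    also have "\<dots> \<le> K\<^sup>2"
      using c_bounds[OF w t] c_mono[OF w, of 0 t] t C_0[OF w] K by (intro power_mono) (auto simp: c_def)
    finally show "Q n w \<le> K\<^sup>2" .
  qed
  have [measurable]: "Q n \<in> borel_measurable M" for n unfolding Q_def[abs_def] by measurable
  have Q_lim: "(\<lambda>n. Q n w) \<longlonglongrightarrow> 0" if w: "w \<in> space M" for w
    unfolding Q_def
  proof (rule sum_square_increments_tendsto_0[OF t, of "\<lambda>u. c u w"])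
    show "mono_on {0..t} (\<lambda>u. c u w)" using c_mono[OF w] by (auto intro!: mono_onI)
    show "continuous_on {0..t} (\<lambda>u. c u w)"
      unfolding c_def by (intro continuous_on_min continuous_on_const continuous_on_subset[OF C_continuous[OF w]]) auto
  qed
  \<comment> \<open>The constant is twice the bound 1 on the expectation of \<open>C t\<close>, and
    thus independent of \<open>K\<close>.\<close>
  have bound: "(\<integral>w. (c t w)\<^sup>2 \<partial>M) \<le> 2 + (\<integral>w. Q n w \<partial>M)" for n
  proof -
    define D where "D i w = c (grid 0 t n (Suc i)) w - c (grid 0 t n i) w" for i w
    have Dm [measurable]: "D i \<in> borel_measurable M" for i unfolding D_def[abs_def] by measurable
    have D_bounds: "0 \<le> D i w" "D i w \<le> K" if w: "w \<in> space M" for i w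
      using c_bounds[OF w g0, of n "Suc i"] c_bounds[OF w g0, of n i] c_mono[OF w g0 grid_Suc_ge, of n i]
      by (auto simp: D_def)
    have D_int: "integrable M (D i)" for i
      using D_bounds by (intro integrable_const_bound[of _ K] AE_I2) auto
    \<comment> \<open>The increment \<open>D i\<close> is known only at the right end of its cell.
      For this reason the summation by parts pairs it with an increment that starts at that right
      end.\<close>
    have D_adapted: "D i \<in> borel_measurable (F (grid 0 t n (Suc i)))" for i
      unfolding D_def[abs_def] c_def
      by (intro borel_measurable_diff borel_measurable_min borel_measurable_const C_adapted g0
          borel_measurable_F_mono[OF C_adapted g0 grid_Suc_ge])
    have D_mult_int: "integrable M (\<lambda>w. D i w * f w)" if "integrable M f" for f i
    proof (rule Bochner_Integration.integrable_bound)
      show "integrable M (\<lambda>w. K * f w)" using that by simp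
      show "(\<lambda>w. D i w * f w) \<in> borel_measurable M" using that by (intro borel_measurable_times) auto
      show "AE w in M. norm (D i w * f w) \<le> norm (K * f w)"
        using D_bounds K by (intro AE_I2) (auto simp: abs_mult intro!: mult_right_mono)
    qed
    have cell_le: "(\<integral>w. D i w * (c t w - c (grid 0 t n (Suc i)) w) \<partial>M) \<le> (\<integral>w. D i w \<partial>M)"
      if i: "i < Suc n" for i
    proof -
      let ?u = "grid 0 t n (Suc i)"
      have u: "0 \<le> ?u" "?u \<le> t" using i t by (auto intro: g0 grid_le)
      have ct: "c t \<in> borel_measurable M" using cm[of n "Suc n"] by simp
      have "(\<integral>w. D i w * (c t w - c ?u w) \<partial>M) \<le> (\<integral>w. D i w * (C t w - C ?u w) \<partial>M)"
      proof (rule integral_mono)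
        show "integrable M (\<lambda>w. D i w * (c t w - c ?u w))"
          using c_bounds[OF _ t] c_bounds[OF _ u(1)] ct
          by (intro D_mult_int Bochner_Integration.integrable_diff integrable_const_bound[of _ K] AE_I2) auto
        show "integrable M (\<lambda>w. D i w * (C t w - C ?u w))"
          by (intro D_mult_int Bochner_Integration.integrable_diff C_integrable t u)
        show "D i w * (c t w - c ?u w) \<le> D i w * (C t w - C ?u w)" if "w \<in> space M" for w
          using D_bounds(1)[OF that] c_diff_le[OF that u] by (intro mult_left_mono)
      qed
      also have "\<dots> = (\<integral>w. (D i w * X t w - D i w * X ?u w) + D i w * (Z ?u w - Z t w) \<partial>M)"
        by (intro Bochner_Integration.integral_cong) (auto simp: X_def algebra_simps)
      also have "\<dots> = ((\<integral>w. D i w * X t w \<partial>M) - (\<integral>w. D i w * X ?u w \<partial>M)) + (\<integral>w. D i w * (Z ?u w - Z t w) \<partial>M)"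
        using t u by (simp add: D_mult_int X_integrable Z_integrable)
      also have "\<dots> = (\<integral>w. D i w * (Z ?u w - Z t w) \<partial>M)"
        using X_mult[OF u D_adapted D_mult_int[OF X_integrable[OF t]]] by simp
      also have "\<dots> \<le> (\<integral>w. D i w \<partial>M)"
      proof (rule integral_mono)
        show "D i w * (Z ?u w - Z t w) \<le> D i w" if "w \<in> space M" for w
          using D_bounds(1)[OF that, of i] Z_le_1[OF that u(1)] Z_pos[OF that t]
            mult_left_mono[of "Z ?u w - Z t w" 1 "D i w"] by simp
      qed (use t u D_int in \<open>auto intro!: D_mult_int Bochner_Integration.integrable_diff Z_integrable\<close>)
      finally show ?thesis .
    qed
    have ct_int: "integrable M (c t)"
      using c_bounds[OF _ t] cm[of n "Suc n"] by (intro integrable_const_bound[of _ K] AE_I2) auto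
    have prod_int: "integrable M (\<lambda>w. D i w * (c t w - c (grid 0 t n (Suc i)) w))" for i
      using c_bounds[OF _ g0]
      by (intro D_mult_int Bochner_Integration.integrable_diff ct_int integrable_const_bound[of _ K] AE_I2) auto
    have Q_int: "integrable M (Q n)"
      using Q_bounds by (intro integrable_const_bound[of _ "K\<^sup>2"] AE_I2) auto
    have id: "(c t w)\<^sup>2 = 2 * (\<Sum>i<Suc n. D i w * (c t w - c (grid 0 t n (Suc i)) w)) + Q n w"
      if "w \<in> space M" for w
      using sum_increments_telescope[where c = "\<lambda>i. c (grid 0 t n i) w" and N = "Suc n" and a = "c t w"] that K
      by (simp add: D_def Q_def c_def[of 0] C_0 power2_eq_square del: sum.lessThan_Suc)
    have "(\<integral>w. (c t w)\<^sup>2 \<partial>M) =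
      (\<integral>w. 2 * (\<Sum>i<Suc n. D i w * (c t w - c (grid 0 t n (Suc i)) w)) + Q n w \<partial>M)"
      by (intro Bochner_Integration.integral_cong refl id)
    also have "\<dots> = 2 * (\<Sum>i<Suc n. \<integral>w. D i w * (c t w - c (grid 0 t n (Suc i)) w) \<partial>M) + (\<integral>w. Q n w \<partial>M)"
      using prod_int Q_int by (simp add: Bochner_Integration.integrable_sum Bochner_Integration.integral_sum del: sum.lessThan_Suc)
    also have "(\<Sum>i<Suc n. \<integral>w. D i w * (c t w - c (grid 0 t n (Suc i)) w) \<partial>M) \<le> (\<Sum>i<Suc n. \<integral>w. D i w \<partial>M)"
      by (intro sum_mono cell_le) auto
    also have "(\<Sum>i<Suc n. \<integral>w. D i w \<partial>M) = (\<integral>w. (\<Sum>i<Suc n. D i w) \<partial>M)"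
      using D_int by (intro Bochner_Integration.integral_sum[symmetric])
    also have "\<dots> \<le> (\<integral>w. C t w \<partial>M)"
    proof (rule integral_mono)
      show "(\<Sum>i<Suc n. D i w) \<le> C t w" if "w \<in> space M" for w
        unfolding D_def using K C_0[OF that]
        by (subst sum_lessThan_telescope[where f = "\<lambda>i. c (grid 0 t n i) w"]) (simp add: c_def)
    qed (use t D_int C_integrable in auto)
    also have "\<dots> \<le> 1" by (rule C_expectation_le[OF t])
    finally show ?thesis by simp
  qed
  have "(\<lambda>n. \<integral>w. Q n w \<partial>M) \<longlonglongrightarrow> (\<integral>w. 0 \<partial>M)"
    using Q_lim Q_bounds by (intro integral_dominated_convergence[where w = "\<lambda>_. K\<^sup>2"]) auto
  then have "(\<lambda>n. 2 + (\<integral>w. Q n w \<partial>M)) \<longlonglongrightarrow> 2"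
    using tendsto_add[OF tendsto_const] by fastforce
  then have "(\<integral>w. (c t w)\<^sup>2 \<partial>M) \<le> 2"
    using bound by (intro LIMSEQ_le_const) auto
  then show ?thesis by (simp add: c_def)
qed

text \<open>Fatou's lemma applies because the bound on the truncated squares does not depend on the
  truncation.\<close>

lemma C_square_integrable:
  assumes t: "0 \<le> t" shows "integrable M (\<lambda>w. (C t w)\<^sup>2)"
proof (rule integrableI_nonneg)
  have [measurable]: "C t \<in> borel_measurable M" by (rule C_measurable[OF t])
  show "(\<lambda>w. (C t w)\<^sup>2) \<in> borel_measurable M" by measurable
  have lim: "(\<lambda>n. ennreal ((min (C t w) (real n))\<^sup>2)) \<longlonglongrightarrow> ennreal ((C t w)\<^sup>2)" for w
  proof (rule tendsto_eventually)
    obtain N where "C t w \<le> real N" using real_arch_simple by blast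
    then show "\<forall>\<^sub>F n in sequentially. ennreal ((min (C t w) (real n))\<^sup>2) = ennreal ((C t w)\<^sup>2)"
      by (intro eventually_mono[OF eventually_ge_at_top[of N]]) (simp add: min_def)
  qed
  have le: "(\<integral>\<^sup>+w. ennreal ((min (C t w) (real n))\<^sup>2) \<partial>M) \<le> 2" for n
  proof -
    have "integrable M (\<lambda>w. (min (C t w) (real n))\<^sup>2)"
      using C_nonneg[OF _ t]
      by (intro integrable_const_bound[of _ "(real n)\<^sup>2"] AE_I2) (auto intro!: power_mono)
    then have "(\<integral>\<^sup>+w. ennreal ((min (C t w) (real n))\<^sup>2) \<partial>M) = ennreal (\<integral>w. (min (C t w) (real n))\<^sup>2 \<partial>M)"
      by (intro nn_integral_eq_integral) auto
    also have "\<dots> \<le> ennreal 2" by (intro ennreal_leI truncated_C_square_le[OF t]) simp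
    finally show ?thesis by simp
  qed
  have "(\<integral>\<^sup>+w. ennreal ((C t w)\<^sup>2) \<partial>M) = (\<integral>\<^sup>+w. liminf (\<lambda>n. ennreal ((min (C t w) (real n))\<^sup>2)) \<partial>M)"
    using lim_imp_Liminf[OF sequentially_bot lim] by simp
  also have "\<dots> \<le> liminf (\<lambda>n. \<integral>\<^sup>+w. ennreal ((min (C t w) (real n))\<^sup>2) \<partial>M)"
    by (intro nn_integral_liminf) measurable
  also have "\<dots> \<le> 2"
    using le by (intro order_trans[OF Liminf_le_Limsup Limsup_bounded]) (auto intro!: always_eventually)
  finally show "(\<integral>\<^sup>+w. ennreal ((C t w)\<^sup>2) \<partial>M) < \<infinity>" by (simp add: le_less_trans)
qed auto

lemma X_square_integrable:
  assumes t: "0 \<le> t" shows "integrable M (\<lambda>w. (X t w)\<^sup>2)"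
proof (rule Bochner_Integration.integrable_bound)
  show "integrable M (\<lambda>w. 2 * (1 + (C t w)\<^sup>2))"
    by (intro integrable_mult_right Bochner_Integration.integrable_add C_square_integrable[OF t]) simp
  have [measurable]: "X t \<in> borel_measurable M" by (rule X_measurable[OF t])
  show "(\<lambda>w. (X t w)\<^sup>2) \<in> borel_measurable M" by measurable
  show "AE w in M. norm ((X t w)\<^sup>2) \<le> norm (2 * (1 + (C t w)\<^sup>2))"
  proof (rule AE_I2)
    fix w assume w: "w \<in> space M"
    have "(X t w)\<^sup>2 \<le> 2 * (Z t w)\<^sup>2 + 2 * (C t w)\<^sup>2"
      using sum_squares_bound[of "Z t w" "C t w"] by (simp add: X_def power2_sum)
    also have "(Z t w)\<^sup>2 \<le> 1"
      using Z_pos[OF w t] Z_le_1[OF w t] by (simp add: power_le_one)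
    finally show "norm ((X t w)\<^sup>2) \<le> norm (2 * (1 + (C t w)\<^sup>2))" by simp
  qed
qed

end

text \<open>Completeness makes \<open>g\<close> measurable whatever it is on the exceptional null
  set. It supplies the measurability of \<open>X\<close> evaluated at \<open>\<tau>\<close>, which
  is an almost sure limit of grid sums.\<close>

lemma (in complete_measure) borel_measurable_AE_limit:
  fixes f :: "nat \<Rightarrow> 'a \<Rightarrow> real"
  assumes f: "\<And>n. f n \<in> borel_measurable M" and lim: "AE x in M. (\<lambda>n. f n x) \<longlonglongrightarrow> g x"
  shows "g \<in> borel_measurable M"
proof (rule measurableI)
  fix A :: "real set" assume A: "A \<in> sets borel"
  let ?l = "\<lambda>x. lim (\<lambda>n. f n x)"
  have l: "?l \<in> borel_measurable M" using f by (rule borel_measurable_lim_metric)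
  show "g -` A \<inter> space M \<in> sets M"
  proof (rule in_sets_AE)
    show "?l -` A \<inter> space M \<in> sets M" using l A by (rule measurable_sets)
    show "AE x in M. (x \<in> ?l -` A \<inter> space M) = (x \<in> g -` A \<inter> space M)"
      using lim by eventually_elim (simp add: limI)
  qed auto
qed simp

section \<open>Vanishing of the variance of \<open>X\<close>\<close>

context continuous_hazard_setting
begin

text \<open>The expectations of the sums \<open>U n\<close> tend to 1 by the pseudo-stopping
  property. Summing an inequality over the cells bounds them below, and the limit reads
  \<open>1 \<ge> 1 + (E X\<^sub>t\<^sup>2 - 1) / 2\<close>. Hence
  \<open>E X\<^sub>t\<^sup>2 \<le> 1 = (E X\<^sub>t)\<^sup>2\<close>.\<close>

lemma X_eq_1:
  assumes t: "0 \<le> t"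
    and left: "AE w in M. left_limit_at \<tau> Z w"
    and tau_pos: "AE w in M. 0 < \<tau> w"
    and Z0: "AE w in M. Z 0 w = 1"
    and pseudo: "(\<integral>w. X (stopped_at \<tau> t w) w \<partial>M) = (\<integral>w. X 0 w \<partial>M)"
  shows "AE w in M. X t w = 1"
proof -
  define h :: "real \<Rightarrow> 'a \<Rightarrow> real" where "h u w = (if ennreal u < \<tau> w then 1 else 0)" for u w
  have hm [measurable]: "h u \<in> borel_measurable M" for u unfolding h_def[abs_def] by measurable
  have h01: "0 \<le> h u w" "h u w \<le> 1" for u w by (auto simp: h_def)
  \<comment> \<open>The difference of the two values of \<open>h\<close> is the indicator of the
    cell containing \<open>\<tau>\<close>. For positive \<open>\<tau>\<close> this makes
    \<open>U n\<close> the value of \<open>X\<close> at the left end of that cell, or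
    \<open>X t\<close> if \<open>\<tau>\<close> exceeds \<open>t\<close>.\<close>
  define U where "U n w = (\<Sum>i<Suc n. X (grid 0 t n i) w * (h (grid 0 t n i) w - h (grid 0 t n (Suc i)) w))
    + X t w * h t w" for n w
  have g0: "0 \<le> grid 0 t n i" for n i using grid_ge[OF t] by simp
  have gS: "grid 0 t n i \<le> grid 0 t n (Suc i)" for n i using grid_mono[OF t, of i "Suc i"] by simp
  have [measurable]: "X (grid 0 t n i) \<in> borel_measurable M" for n i by (rule X_measurable[OF g0])
  have [measurable]: "X t \<in> borel_measurable M" by (rule X_measurable[OF t])
  have U_m [measurable]: "U n \<in> borel_measurable M" for n unfolding U_def[abs_def] by measurable
  have X_nonneg: "0 \<le> X u w" if "w \<in> space M" "0 \<le> u" for u w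
    using Z_pos[OF that] C_nonneg[OF that] by (simp add: X_def)
  have X_le: "X u w \<le> 1 + C t w" if "w \<in> space M" "0 \<le> u" "u \<le> t" for u w
    using Z_le_1[OF that(1,2)] C_mono[OF that] by (simp add: X_def)
  have U_before: "U n w = X t w" if "ennreal t < \<tau> w" for n w
  proof -
    have "h (grid 0 t n i) w = 1" if "i \<le> Suc n" for i
      using \<open>ennreal t < \<tau> w\<close> ennreal_leI[OF grid_le[OF t that]] by (auto simp: h_def)
    moreover have "h t w = 1" using that by (simp add: h_def)
    ultimately show ?thesis unfolding U_def by simp
  qed
  have U_after: "U n w = grid_step 0 t n (\<lambda>i. X (grid 0 t n i) w) r"
    if r: "\<tau> w = ennreal r" "r \<le> t" "0 < r" for n w r
  proof -
    have h: "h u w = (if u < r then 1 else 0)" if "0 \<le> u" for u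
      using r that by (simp add: h_def ennreal_less_iff)
    have cell: "X (grid 0 t n i) w * (h (grid 0 t n i) w - h (grid 0 t n (Suc i)) w) =
        (if grid 0 t n i < r \<and> r \<le> grid 0 t n (Suc i) then X (grid 0 t n i) w else 0)" for i
      using gS[of n i] by (simp add: h g0)
    have "h t w = 0" using h[OF t] r by simp
    then show ?thesis unfolding U_def grid_step_def by (simp only: cell mult_zero_right add_0_right)
  qed
  have tau_cases: thesis if "\<tau> w > 0" "ennreal t < \<tau> w \<Longrightarrow> thesis"
    "\<And>r. \<tau> w = ennreal r \<Longrightarrow> r \<le> t \<Longrightarrow> 0 < r \<Longrightarrow> thesis" for w thesis
  proof (cases "ennreal t < \<tau> w")
    case False
    then have "\<tau> w \<noteq> \<top>" by (metis ennreal_less_top)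
    then obtain r where "\<tau> w = ennreal r" "0 \<le> r" by (cases "\<tau> w") auto
    then show thesis using False that(1) t
      by (intro that(3)[of r]) (auto simp: not_less ennreal_le_iff)
  qed (use that in blast)
  have U_bound: "\<bar>U n w\<bar> \<le> 1 + C t w" if "w \<in> space M" "\<tau> w > 0" for n w
    using that(2)
  proof (rule tau_cases)
    assume "ennreal t < \<tau> w"
    then show ?thesis using U_before X_nonneg[OF that(1) t] X_le[OF that(1) t] by simp
  next
    fix r assume r: "\<tau> w = ennreal r" "r \<le> t" "0 < r"
    show ?thesis unfolding U_after[OF r]
      using grid_step_bounds[OF t, of n "\<lambda>i. X (grid 0 t n i) w" "1 + C t w" r]
        X_nonneg[OF that(1) g0] X_le[OF that(1) g0] grid_le[OF t] C_nonneg[OF that(1) t] by auto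
  qed
  have U_lim: "AE w in M. (\<lambda>n. U n w) \<longlonglongrightarrow> X (stopped_at \<tau> t w) w"
    using left tau_pos AE_space
  proof eventually_elim
    fix w assume *: "left_limit_at \<tau> Z w"
      and pos: "0 < \<tau> w" and w: "w \<in> space M"
    from pos show "(\<lambda>n. U n w) \<longlonglongrightarrow> X (stopped_at \<tau> t w) w"
    proof (rule tau_cases)
      assume "ennreal t < \<tau> w"
      then show ?thesis using U_before t by (simp add: stopped_at_before)
    next
      fix r assume r: "\<tau> w = ennreal r" "r \<le> t" "0 < r"
      then have "((\<lambda>s. Z s w) \<longlongrightarrow> Z r w) (at_left r)" using * by simp
      then have "((\<lambda>s. X s w) \<longlongrightarrow> X r w) (at_left r)"
        unfolding X_def by (intro tendsto_add tendsto_at_left_of_continuous_on[OF C_continuous[OF w] r(3)])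
      moreover have "stopped_at \<tau> t w = r" using r t by (simp add: stopped_at_after ennreal_leI)
      ultimately show ?thesis
        using grid_step_left_tendsto[OF t, of r "\<lambda>s. X s w"] r
        by (simp add: U_after[OF r] continuous_within)
    qed
  qed
  have dom: "integrable M (\<lambda>w. 1 + C t w)" using C_integrable[OF t] by simp
  have "(\<lambda>n. \<integral>w. U n w \<partial>M) \<longlonglongrightarrow> (\<integral>w. X (stopped_at \<tau> t w) w \<partial>M)"
  proof (rule integral_dominated_convergence[OF borel_measurable_AE_limit[OF U_m U_lim] U_m dom U_lim])
    show "AE w in M. norm (U n w) \<le> 1 + C t w" for n
      using tau_pos AE_space by eventually_elim (simp add: U_bound)
  qed
  also have "(\<integral>w. X (stopped_at \<tau> t w) w \<partial>M) = (\<integral>w. X 0 w \<partial>M)" by (rule pseudo)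
  also have X0: "AE w in M. X 0 w = 1" 
    using Z0 AE_space by eventually_elim (simp add: X_def C_0)
  have [measurable]: "X 0 \<in> borel_measurable M" "Z 0 \<in> borel_measurable M"
    by (auto intro: X_measurable Z_measurable)
  have "(\<integral>w. X 0 w \<partial>M) = (\<integral>w. 1 \<partial>M)" using X0 by (intro integral_cong_AE) auto
  also have "(\<integral>w. (1::real) \<partial>M) = 1" by (simp add: prob_space)
  finally have U_E: "(\<lambda>n. \<integral>w. U n w \<partial>M) \<longlonglongrightarrow> 1" .

  have bdd_mult: "integrable M (\<lambda>w. f w * k w)"
    if "integrable M f" "k \<in> borel_measurable M" "\<And>w. w \<in> space M \<Longrightarrow> \<bar>k w\<bar> \<le> 1" for f k :: "'a \<Rightarrow> real"
    by (rule Bochner_Integration.integrable_bound[OF that(1)])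
      (use that in \<open>auto simp: abs_mult intro!: AE_I2 mult_left_le borel_measurable_times\<close>)
  have Z_abs: "\<bar>Z u w\<bar> \<le> 1" if "w \<in> space M" "0 \<le> u" for u w
    using Z_pos[OF that] Z_le_1[OF that] by simp
  have h_abs: "\<bar>h u w\<bar> \<le> 1" for u w by (simp add: h_def)
  have XZ_int: "integrable M (\<lambda>w. X u w * Z v w)" if "0 \<le> u" "0 \<le> v" for u v
    using that by (intro bdd_mult X_integrable Z_measurable Z_abs)
  have Xh_int: "integrable M (\<lambda>w. X u w * h v w)" if "0 \<le> u" for u v
    using that by (intro bdd_mult X_integrable hm h_abs)
  have Xh: "(\<integral>w. X u w * h v w \<partial>M) = (\<integral>w. X u w * Z v w \<partial>M)" if "0 \<le> u" "u \<le> v" for u v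
    using Z_integrable_mult[of v "X u"] borel_measurable_F_mono[OF X_adapted] X_integrable that
    by (simp add: h_def)
  have XX_int: "integrable M (\<lambda>w. X u w * X v w)" if "0 \<le> u" "0 \<le> v" for u v
  proof (rule Bochner_Integration.integrable_bound)
    show "integrable M (\<lambda>w. (X u w)\<^sup>2 + (X v w)\<^sup>2)"
      using that by (intro Bochner_Integration.integrable_add X_square_integrable)
    show "(\<lambda>w. X u w * X v w) \<in> borel_measurable M"
      using that by (intro borel_measurable_times X_measurable)
    show "AE w in M. norm (X u w * X v w) \<le> norm ((X u w)\<^sup>2 + (X v w)\<^sup>2)"
    proof (rule AE_I2)
      fix w
      have "2 * \<bar>X u w\<bar> * \<bar>X v w\<bar> \<le> (X u w)\<^sup>2 + (X v w)\<^sup>2"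
        using sum_squares_bound[of "\<bar>X u w\<bar>" "\<bar>X v w\<bar>"] by simp
      moreover have "0 \<le> \<bar>X u w\<bar> * \<bar>X v w\<bar>" by simp
      ultimately have "\<bar>X u w\<bar> * \<bar>X v w\<bar> \<le> (X u w)\<^sup>2 + (X v w)\<^sup>2" by linarith
      then show "norm (X u w * X v w) \<le> norm ((X u w)\<^sup>2 + (X v w)\<^sup>2)" by (simp add: abs_mult)
    qed
  qed
  have C_sq_int: "integrable M (\<lambda>w. (C v w - C u w)\<^sup>2)" if "0 \<le> u" "u \<le> v" for u v
  proof (rule Bochner_Integration.integrable_bound)
    show "integrable M (\<lambda>w. (C v w)\<^sup>2)" using that by (intro C_square_integrable) auto
    show "(\<lambda>w. (C v w - C u w)\<^sup>2) \<in> borel_measurable M"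
      using that by (intro borel_measurable_power borel_measurable_diff C_measurable) auto
    show "AE w in M. norm ((C v w - C u w)\<^sup>2) \<le> norm ((C v w)\<^sup>2)"
      using that C_mono C_nonneg by (auto intro!: AE_I2 power_mono)
  qed
  \<comment> \<open>Write dX, dZ, dC for the increments from \<open>u\<close> to \<open>v\<close>.
    By the martingale property the left side is E X_u Z_u - E X_v Z_v + E dX dZ, and E dX^2 is the
    increment of E X^2. Since dZ = dX - dC has a nonnegative square, dX dZ is at least (dX^2 - dC^2)
    / 2.\<close>
  have cell_ineq: "(\<integral>w. X u w * (h u w - h v w) \<partial>M) \<ge>
      ((\<integral>w. X u w * Z u w \<partial>M) - (\<integral>w. X v w * Z v w \<partial>M))
      + ((\<integral>w. (X v w)\<^sup>2 \<partial>M) - (\<integral>w. (X u w)\<^sup>2 \<partial>M)) / 2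
      - (\<integral>w. (C v w - C u w)\<^sup>2 \<partial>M) / 2" if uv: "0 \<le> u" "u \<le> v" for u v
  proof -
    have v: "0 \<le> v" using uv by simp
    note ints = XZ_int[OF uv(1) uv(1)] XZ_int[OF uv(1) v] XZ_int[OF v uv(1)] XZ_int[OF v v]
      XX_int[OF uv(1) uv(1)] XX_int[OF uv(1) v] XX_int[OF v v] C_sq_int[OF uv]
    have 1: "(\<integral>w. X u w * (h u w - h v w) \<partial>M) = (\<integral>w. X u w * Z u w \<partial>M) - (\<integral>w. X u w * Z v w \<partial>M)"
      using Xh_int[OF uv(1)] uv by (simp add: right_diff_distrib Xh)
    have 2: "(\<integral>w. X v w * Z u w \<partial>M) = (\<integral>w. X u w * Z u w \<partial>M)"
      using X_mult[OF uv Z_adapted[OF uv(1)]] XZ_int[OF v uv(1)] by (simp add: mult.commute)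
    have 3: "(\<integral>w. X u w * X v w \<partial>M) = (\<integral>w. X u w * X u w \<partial>M)"
      using X_mult[OF uv X_adapted[OF uv(1)] XX_int[OF uv(1) v]] by simp
    have "(\<integral>w. (X v w * X v w - 2 * (X u w * X v w) + X u w * X u w) / 2
        - (C v w - C u w)\<^sup>2 / 2 + (X v w * Z u w - X u w * Z u w) \<partial>M)
      \<le> (\<integral>w. X v w * Z v w - X u w * Z v w \<partial>M)"
    proof (rule integral_mono)
      fix w
      have "0 \<le> ((X v w - X u w) - (C v w - C u w))\<^sup>2" by simp
      then show "(X v w * X v w - 2 * (X u w * X v w) + X u w * X u w) / 2
        - (C v w - C u w)\<^sup>2 / 2 + (X v w * Z u w - X u w * Z u w)
        \<le> X v w * Z v w - X u w * Z v w"
        by (simp add: X_def power2_eq_square field_simps)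
    qed (use ints in simp_all)
    also have "(\<integral>w. X v w * Z v w - X u w * Z v w \<partial>M)
        = (\<integral>w. X v w * Z v w \<partial>M) - (\<integral>w. X u w * Z v w \<partial>M)"
      using ints by simp
    finally have "((\<integral>w. X v w * X v w \<partial>M) - 2 * (\<integral>w. X u w * X v w \<partial>M) + (\<integral>w. X u w * X u w \<partial>M)) / 2
        - (\<integral>w. (C v w - C u w)\<^sup>2 \<partial>M) / 2
        + ((\<integral>w. X v w * Z u w \<partial>M) - (\<integral>w. X u w * Z u w \<partial>M))
      \<le> (\<integral>w. X v w * Z v w \<partial>M) - (\<integral>w. X u w * Z v w \<partial>M)"
      using ints by simp
    then show ?thesis
      unfolding 1 power2_eq_square[of "X _ _"] 2 3 by argo
  qed
  \<comment> \<open>The total error of the cell inequalities is the quadratic variation of the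
    continuous increasing \<open>C\<close>. It vanishes in the limit, dominated by the integrable
    \<open>(C t)\<^sup>2\<close>.\<close>
  define Q where "Q n w = (\<Sum>i<Suc n. (C (grid 0 t n (Suc i)) w - C (grid 0 t n i) w)\<^sup>2)" for n w
  have Q_int: "integrable M (Q n)" for n
    unfolding Q_def[abs_def] by (intro Bochner_Integration.integrable_sum C_sq_int g0 gS)
  have "(\<lambda>n. \<integral>w. Q n w \<partial>M) \<longlonglongrightarrow> (\<integral>w. 0 \<partial>M)"
  proof (rule integral_dominated_convergence[where w = "\<lambda>w. (C t w)\<^sup>2"])
    show "AE w in M. (\<lambda>n. Q n w) \<longlonglongrightarrow> 0"
      unfolding Q_def
      by (intro AE_I2 sum_square_increments_tendsto_0 t mono_onI C_mono continuous_on_subset[OF C_continuous]) auto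
    show "AE w in M. norm (Q n w) \<le> (C t w)\<^sup>2" for n
    proof (rule AE_I2)
      fix w assume w: "w \<in> space M"
      have "Q n w \<le> (C (grid 0 t n (Suc n)) w - C (grid 0 t n 0) w)\<^sup>2"
        unfolding Q_def
        by (intro sum_square_increments_le[of "Suc n" "\<lambda>i. C (grid 0 t n i) w"] C_mono[OF w] g0 grid_mono t) auto
      moreover have "0 \<le> Q n w" unfolding Q_def by (intro sum_nonneg) auto
      ultimately show "norm (Q n w) \<le> (C t w)\<^sup>2" using C_0[OF w] by simp
    qed
  qed (use C_square_integrable[OF t] Q_int in auto)
  then have Q_E: "(\<lambda>n. \<integral>w. Q n w \<partial>M) \<longlonglongrightarrow> 0" by simp
  \<comment> \<open>The sums of \<open>a\<close> and \<open>b\<close> telescope; the final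
    \<open>a (Suc n)\<close> cancels against the expectation of the last term of \<open>U n\<close>,
    which leaves \<open>a 0 = 1\<close>.\<close>
  have main: "1 + ((\<integral>w. (X t w)\<^sup>2 \<partial>M) - 1) / 2 - (\<integral>w. Q n w \<partial>M) / 2 \<le> (\<integral>w. U n w \<partial>M)" for n
  proof -
    let ?g = "grid 0 t n"
    define a where "a i = (\<integral>w. X (?g i) w * Z (?g i) w \<partial>M)" for i
    define b where "b i = (\<integral>w. (X (?g i) w)\<^sup>2 \<partial>M)" for i
    define q where "q i = (\<integral>w. (C (?g (Suc i)) w - C (?g i) w)\<^sup>2 \<partial>M)" for i
    have "AE w in M. X 0 w * Z 0 w = 1" using X0 Z0 by eventually_elim simp
    then have "a 0 = (\<integral>w. 1 \<partial>M)" unfolding a_def grid_0 by (intro integral_cong_AE) auto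
    moreover have "AE w in M. (X 0 w)\<^sup>2 = 1" using X0 by eventually_elim simp
    then have "b 0 = (\<integral>w. 1 \<partial>M)" unfolding b_def grid_0 by (intro integral_cong_AE) auto
    ultimately have a0: "a 0 = 1" "b 0 = 1" by (simp_all add: prob_space)
    have "(\<integral>w. Q n w \<partial>M) = (\<Sum>i<Suc n. q i)"
      unfolding Q_def q_def by (intro Bochner_Integration.integral_sum C_sq_int g0 gS)
    moreover have "(\<Sum>i<Suc n. (a i - a (Suc i)) + (b (Suc i) - b i) / 2 - q i / 2)
        \<le> (\<Sum>i<Suc n. \<integral>w. X (?g i) w * (h (?g i) w - h (?g (Suc i)) w) \<partial>M)"
      unfolding a_def b_def q_def by (intro sum_mono cell_ineq g0 gS)
    moreover have "(\<Sum>i<Suc n. (a i - a (Suc i)) + (b (Suc i) - b i) / 2 - q i / 2)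
        = (a 0 - a (Suc n)) + (b (Suc n) - b 0) / 2 - (\<Sum>i<Suc n. q i) / 2"
      using sum_lessThan_telescope[of a "Suc n"] sum_lessThan_telescope[of b "Suc n"]
        sum_lessThan_telescope'[of a "Suc n"]
      by (simp add: sum.distrib sum_subtractf sum_divide_distrib[symmetric] del: sum.lessThan_Suc)
    moreover have "(\<integral>w. U n w \<partial>M)
        = (\<Sum>i<Suc n. \<integral>w. X (?g i) w * (h (?g i) w - h (?g (Suc i)) w) \<partial>M) + (\<integral>w. X t w * h t w \<partial>M)"
    proof -
      have "integrable M (\<lambda>w. X (?g i) w * (h (?g i) w - h (?g (Suc i)) w))" for i
        using Xh_int[OF g0] by (simp add: right_diff_distrib)
      then show ?thesis unfolding U_def using Xh_int[OF t]
        by (simp add: Bochner_Integration.integral_sum Bochner_Integration.integrable_sum del: sum.lessThan_Suc)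
    qed
    moreover have "(\<integral>w. X t w * h t w \<partial>M) = a (Suc n)" using Xh[OF t order_refl] by (simp add: a_def)
    moreover have "b (Suc n) = (\<integral>w. (X t w)\<^sup>2 \<partial>M)" by (simp add: b_def)
    ultimately show ?thesis using a0 by simp
  qed
  have "(\<lambda>n. 1 + ((\<integral>w. (X t w)\<^sup>2 \<partial>M) - 1) / 2 - (\<integral>w. Q n w \<partial>M) / 2)
      \<longlonglongrightarrow> 1 + ((\<integral>w. (X t w)\<^sup>2 \<partial>M) - 1) / 2 - 0 / 2"
    by (intro tendsto_intros Q_E) auto
  from LIMSEQ_le[OF this U_E] main
  have sq: "(\<integral>w. (X t w)\<^sup>2 \<partial>M) \<le> 1" by auto
  have "(\<integral>w. 1 * X t w \<partial>M) = (\<integral>w. 1 * X 0 w \<partial>M)"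
    using X_integrable[OF t] by (intro X_mult t) auto
  then have EX: "(\<integral>w. X t w \<partial>M) = 1"
    using \<open>(\<integral>w. X 0 w \<partial>M) = (\<integral>w. 1 \<partial>M)\<close> by (simp add: prob_space)
  have eq: "(X t w - 1)\<^sup>2 = (X t w)\<^sup>2 - 2 * X t w + 1" for w by (simp add: power2_diff)
  have int: "integrable M (\<lambda>w. (X t w - 1)\<^sup>2)"
    unfolding eq using X_square_integrable[OF t] X_integrable[OF t] by simp
  have "(\<integral>w. (X t w - 1)\<^sup>2 \<partial>M) = (\<integral>w. (X t w)\<^sup>2 \<partial>M) - 2 * (\<integral>w. X t w \<partial>M) + 1"
    unfolding eq using X_square_integrable[OF t] X_integrable[OF t] by (simp add: prob_space)
  moreover have "0 \<le> (\<integral>w. (X t w - 1)\<^sup>2 \<partial>M)" by simp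
  ultimately have "(\<integral>w. (X t w - 1)\<^sup>2 \<partial>M) = 0" using sq EX by linarith
  then have "AE w in M. (X t w - 1)\<^sup>2 = 0"
    using integral_nonneg_eq_0_iff_AE[OF int] by simp
  then show ?thesis by eventually_elim simp
qed

end

section \<open>From \<open>X = 1\<close> to the exponential formula\<close>

lemma right_continuous_le_of_rats:
  fixes f :: "real \<Rightarrow> real"
  assumes f: "continuous (at_right t) f" and le: "\<And>q. q \<in> \<rat> \<Longrightarrow> t < q \<Longrightarrow> f q \<le> c"
  shows "f t \<le> c"
proof (rule ccontr)
  assume "\<not> f t \<le> c"
  then have "\<forall>\<^sub>F s in at_right t. c < f s"
    using f by (intro order_tendstoD) (auto simp: continuous_within)
  then obtain b where b: "t < b" "\<And>s. t < s \<Longrightarrow> s < b \<Longrightarrow> c < f s"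
    by (auto simp: eventually_at_right_field)
  obtain q where "q \<in> \<rat>" "t < q" "q < b" using Rats_dense_in_real[OF b(1)] by blast
  then show False using b(2)[of q] le[of q] by simp
qed

lemma continuous_at_right_stopped:
  fixes f :: "real \<Rightarrow> real"
  assumes "continuous (at_right u) f"
  shows "continuous (at_right u) (\<lambda>s. f (min s t))"
proof (cases "u < t")
  case True
  have "\<forall>\<^sub>F s in at_right u. f s = f (min s t)"
    using eventually_at_right_real[OF True] by eventually_elim simp
  with assms True show ?thesis
    by (auto simp: continuous_within elim: Lim_transform_eventually)
next
  case False
  have "\<forall>\<^sub>F s in at_right u. f (min s t) = f t"
    using eventually_at_right_less[of u] by eventually_elim (use False in simp)
  with False show ?thesis by (simp add: continuous_within tendsto_eventually)
qed

lemma tendsto_at_left_stopped: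
  fixes f :: "real \<Rightarrow> real"
  assumes "(f \<longlongrightarrow> l) (at_left u)"
  shows "\<exists>l. ((\<lambda>s. f (min s t)) \<longlongrightarrow> l) (at_left u)"
proof (cases "u \<le> t")
  case True
  have "\<forall>\<^sub>F s in at_left u. f s = f (min s t)"
    using True by (auto simp: eventually_at_filter)
  with assms show ?thesis by (blast intro: Lim_transform_eventually)
next
  case False
  then have "\<forall>\<^sub>F s in at_left u. f (min s t) = f t"
    using eventually_at_left_real[of t u] by (auto elim: eventually_mono)
  then show ?thesis by (blast intro: tendsto_eventually)
qed

lemma (in usual_filtered_prob_space) stopped_martingale:
  assumes X: "martingale M F X" and t: "0 \<le> t"
  shows "martingale M F (\<lambda>u. X (min u t))"
  unfolding martingale_def adapted_def cadlag_paths_def right_continuous_paths_def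
proof (intro conjI allI impI)
  have ad: "\<And>u. 0 \<le> u \<Longrightarrow> X u \<in> borel_measurable (F u)"
    and int: "\<And>u. 0 \<le> u \<Longrightarrow> integrable M (X u)"
    and cond: "\<And>s u. 0 \<le> s \<Longrightarrow> s \<le> u \<Longrightarrow> AE w in M. real_cond_exp M (F s) (X u) w = X s w"
    and rc: "AE w in M. \<forall>t\<ge>0. continuous (at_right t) (\<lambda>s. X s w)"
    and ll: "AE w in M. \<forall>t>0. \<exists>l. ((\<lambda>s. X s w) \<longlongrightarrow> l) (at_left t)"
    using X unfolding martingale_def adapted_def cadlag_paths_def right_continuous_paths_def by auto
  show "AE w in M. \<forall>u\<ge>0. continuous (at_right u) (\<lambda>s. X (min s t) w)"
    using rc
  proof eventually_elim
    fix w assume *: "\<forall>t\<ge>0. continuous (at_right t) (\<lambda>s. X s w)"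
    show "\<forall>u\<ge>0. continuous (at_right u) (\<lambda>s. X (min s t) w)"
      using * by (intro allI impI continuous_at_right_stopped[where f = "\<lambda>s. X s w"]) simp
  qed
  show "AE w in M. \<forall>u>0. \<exists>l. ((\<lambda>s. X (min s t) w) \<longlongrightarrow> l) (at_left u)"
    using ll
  proof eventually_elim
    fix w assume *: "\<forall>t>0. \<exists>l. ((\<lambda>s. X s w) \<longlongrightarrow> l) (at_left t)"
    show "\<forall>u>0. \<exists>l. ((\<lambda>s. X (min s t) w) \<longlongrightarrow> l) (at_left u)"
      using * tendsto_at_left_stopped[where f = "\<lambda>s. X s w"] by blast
  qed
  show "X (min u t) \<in> borel_measurable (F u)" if "0 \<le> u" for u
    using that t by (intro borel_measurable_F_mono[OF ad]) auto
  show "integrable M (X (min u t))" if "0 \<le> u" for u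
    using that t by (intro int) auto
  show "AE w in M. real_cond_exp M (F s) (X (min u t)) w = X (min s t) w" if su: "0 \<le> s" "s \<le> u" for s u
  proof (cases "s \<le> t")
    case True
    then show ?thesis using cond[of s "min u t"] su by simp
  next
    case False
    then have m: "min u t = t" "min s t = t" using su by auto
    interpret G: sigma_finite_subalgebra M "F s" by (rule sigma_finite_subalgebra_F[OF su(1)])
    show ?thesis unfolding m
      using False t by (intro G.real_cond_exp_F_meas int borel_measurable_F_mono[OF ad]) auto
  qed
qed

context continuous_hazard_setting
begin

text \<open>\<open>Z\<close> is at most 1 and \<open>C\<close> increases, so the supremum up to
  \<open>t\<close> is at most the integrable \<open>1 + C t\<close>.\<close>

lemma stopped_X_H1: 
  assumes t: "0 \<le> t" shows "H1_martingale M F (\<lambda>u. X (min u t))"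
  unfolding H1_martingale_def
proof (intro conjI stopped_martingale X_martingale t)
  have "(\<integral>\<^sup>+w. (SUP u\<in>{0..}. ennreal \<bar>X (min u t) w\<bar>) \<partial>M) \<le> (\<integral>\<^sup>+w. ennreal (1 + C t w) \<partial>M)"
  proof (intro nn_integral_mono SUP_least ennreal_leI)
    fix w and u :: real assume w: "w \<in> space M" and u: "u \<in> {0..}"
    then have m: "0 \<le> min u t" "min u t \<le> t" using t by auto
    show "\<bar>X (min u t) w\<bar> \<le> 1 + C t w"
      using Z_pos[OF w m(1)] Z_le_1[OF w m(1)] C_mono[OF w m] C_nonneg[OF w m(1)] by (simp add: X_def)
  qed
  also have "\<dots> = ennreal (\<integral>w. 1 + C t w \<partial>M)"
    using C_integrable[OF t] C_nonneg[OF _ t] by (intro nn_integral_eq_integral AE_I2) auto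
  finally show "(\<integral>\<^sup>+w. (SUP u\<in>{0..}. ennreal \<bar>X (min u t) w\<bar>) \<partial>M) < \<infinity>"
    by (simp add: le_less_trans)
qed

text \<open>Off one null set \<open>X = 1\<close> holds at all rational times and extends to all
  times by right continuity, so \<open>Z = 1 - C\<close> along each path. Then \<open>Z\<close> is
  decreasing, and bounding the increments of \<open>C\<close> by the extreme values of
  \<open>Z\<close> gives exactly the two inequalities that \<open>exp_of_integral_equation\<close>
  needs.\<close>

lemma L_eq_minus_ln_Z:
  assumes pseudo: "pseudo_stopping_time M F \<tau>"
    and left: "AE w in M. left_limit_at \<tau> Z w"
    and tau_pos: "AE w in M. 0 < \<tau> w"
  shows "AE w in M. continuous_on {0..} (\<lambda>t. Z t w) \<and> (\<forall>t\<ge>0. L t w = - ln (Z t w))"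
proof -
  \<comment> \<open>The conditional probability of survival past time 0 is 1 because
    \<open>\<tau>\<close> is almost surely positive.\<close>
  have Z0: "AE w in M. Z 0 w = 1"
  proof -
    interpret G: sigma_finite_subalgebra M "F 0" by (rule sigma_finite_subalgebra_F) simp
    have "AE w in M. real_cond_exp M (F 0) (indicator {w' \<in> space M. ennreal 0 < \<tau> w'}) w = real_cond_exp M (F 0) (\<lambda>_. 1) w"
    proof (rule G.real_cond_exp_cong)
      show "AE w in M. indicator {w' \<in> space M. ennreal 0 < \<tau> w'} w = (1 :: real)"
        using tau_pos AE_space by eventually_elim simp
    qed auto
    moreover have "AE w in M. real_cond_exp M (F 0) (\<lambda>_. 1) w = 1"
      by (intro G.real_cond_exp_F_meas) auto
    ultimately show ?thesis using Z_cond[OF order_refl] by eventually_elim simp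
  qed
  have X1: "AE w in M. X t w = 1" if t: "0 \<le> t" for t
  proof (rule X_eq_1[OF t left tau_pos Z0])
    have "(\<integral>w. value_at (\<lambda>u. X (min u t)) \<tau> w \<partial>M) = (\<integral>w. X (min 0 t) w \<partial>M)"
      using pseudo stopped_X_H1[OF t] unfolding pseudo_stopping_time_def by blast
    then show "(\<integral>w. X (stopped_at \<tau> t w) w \<partial>M) = (\<integral>w. X 0 w \<partial>M)"
      using t by (simp add: value_at_stopped)
  qed
  have "AE w in M. \<forall>q\<in>\<rat> \<inter> {0..}. X q w = 1"
    using X1 by (subst AE_ball_countable) (auto intro: countable_Int1 countable_rat)
  then show ?thesis
    using AE_space
  proof eventually_elim
    fix w assume *: "\<forall>q\<in>\<rat> \<inter> {0..}. X q w = 1" and w: "w \<in> space M"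
    have Z: "Z t w = 1 - C t w" if t: "0 \<le> t" for t
    proof -
      have "X t w \<le> 1"
        using * t by (intro right_continuous_le_of_rats[OF X_right[OF w t]]) auto
      \<comment> \<open>The extension from rational times is one-sided, so the other inequality
        comes from \<open>- X\<close>.\<close>
      moreover have "- X t w \<le> - 1"
        using * t by (intro right_continuous_le_of_rats[OF continuous_minus[OF X_right[OF w t]]]) auto
      ultimately show ?thesis by (simp add: X_def)
    qed
    have cont: "continuous_on {0..} (\<lambda>t. Z t w)"
      using continuous_on_diff[OF continuous_on_const C_continuous[OF w], of 1]
      by (rule continuous_on_cong[THEN iffD1, rotated -1]) (auto simp: Z)
    have anti: "Z v w \<le> Z u w" if "0 \<le> u" "u \<le> v" for u v
      using C_mono[OF w that] that by (simp add: Z)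
    have "L t w = - ln (Z t w)" if t: "0 \<le> t" for t
    proof (rule exp_of_integral_equation[OF t, of "\<lambda>u. Z u w" "\<lambda>u. L u w"])
      show "continuous_on {0..t} (\<lambda>u. Z u w)" using cont by (rule continuous_on_subset) auto
      show "Z 0 w = 1" by (simp add: Z C_0[OF w])
      show "Z v w * (L v w - L u w) \<le> Z u w - Z v w" "Z u w - Z v w \<le> Z u w * (L v w - L u w)"
        if uv: "0 \<le> u" "u \<le> v" "v \<le> t" for u v
      proof -
        have e: "Z u w - Z v w = C v w - C u w" using Z[of u] Z[of v] uv by simp
        show "Z v w * (L v w - L u w) \<le> Z u w - Z v w"
          unfolding e by (rule C_diff_bounds(1)[OF w uv(1,2), of _ "Z u w"]) (use anti uv in auto)
        show "Z u w - Z v w \<le> Z u w * (L v w - L u w)"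
          unfolding e by (rule C_diff_bounds(2)[OF w uv(1,2), of "Z v w"]) (use anti uv in auto)
      qed
    qed (use Z_pos[OF w] L_0[OF w] anti in auto)
    with cont show "continuous_on {0..} (\<lambda>t. Z t w) \<and> (\<forall>t\<ge>0. L t w = - ln (Z t w))" by blast
  qed
qed

end

subsection \<open>Random times avoiding stopping times\<close>

context usual_filtered_prob_space
begin

text \<open>The event that the infimum is below \<open>v\<close> is a countable union over rational
  times before \<open>v\<close>, hence known at \<open>v\<close> by adaptedness; right continuity of
  the filtration turns the strict inequality into the weak one.\<close>

lemma oscillation_time_stopping:
  fixes Y :: "real \<Rightarrow> 'a \<Rightarrow> real"
  assumes Y: "\<And>t. 0 \<le> t \<Longrightarrow> Y t \<in> borel_measurable (F t)" and q: "0 \<le> q"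
  shows "random_stopping_time M F (\<lambda>w. INF r\<in>{r\<in>\<rat>. q < r \<and> e < \<bar>Y r w - Y q w\<bar>}. ennreal r)"
    (is "random_stopping_time M F ?T")
proof (rule iffD2[OF random_stopping_time_iff[OF space_F_eq]], assumption, intro allI impI)
  fix t :: real assume t: "0 \<le> t"
  have less: "{w \<in> space M. ?T w < ennreal v} \<in> sets (F s)" if v: "0 \<le> v" "v \<le> s" for v s
  proof -
    have s: "0 \<le> s" using v by simp
    have eq: "{w \<in> space M. ?T w < ennreal v}
      = (\<Union>r\<in>\<rat> \<inter> {q<..<v}. {w \<in> space (F s). e < \<bar>Y r w - Y q w\<bar>})"
      using q s by (auto simp: INF_less_iff ennreal_less_iff space_F_eq)
    show ?thesis
      unfolding eq
    proof (intro sets.countable_UN'' countable_Int1 countable_rat)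
      fix r assume "r \<in> \<rat> \<inter> {q<..<v}"
      then have [measurable]: "Y r \<in> borel_measurable (F s)" "Y q \<in> borel_measurable (F s)"
        using q v by (auto intro!: borel_measurable_F_mono[OF Y])
      show "{w \<in> space (F s). e < \<bar>Y r w - Y q w\<bar>} \<in> sets (F s)" by measurable
    qed
  qed
  have "{w \<in> space M. ?T w \<le> ennreal t} \<in> sets (F s)" if ts: "t < s" for s
  proof -
    \<comment> \<open>A sequence decreasing strictly to \<open>t\<close> that starts at
      \<open>s\<close>, so that all its members stay in \<open>{t<..s}\<close>.\<close>
    define v where "v n = t + (s - t) / real (Suc n)" for n
    have "(s - t) / real (Suc n) \<le> s - t" for n
      using ts by (simp add: divide_le_eq mult_left_mono)
    then have v: "t < v n" "v n \<le> s" for n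
      using ts by (auto simp: v_def) (smt (verit))
    from tendsto_add[OF tendsto_const mesh_tendsto_0, of t "s - t"] have v_lim: "v \<longlonglongrightarrow> t" by (simp add: v_def[abs_def])
    have "{w \<in> space M. ?T w \<le> ennreal t} = (\<Inter>n. {w \<in> space M. ?T w < ennreal (v n)})"
    proof (intro equalityI subsetI INT_I)
      fix w n assume *: "w \<in> {w \<in> space M. ?T w \<le> ennreal t}"
      moreover have "ennreal t < ennreal (v n)" using v(1)[of n] t by (simp add: ennreal_less_iff)
      ultimately show "w \<in> {w \<in> space M. ?T w < ennreal (v n)}" by (auto intro: le_less_trans)
    next
      fix w assume *: "w \<in> (\<Inter>n. {w \<in> space M. ?T w < ennreal (v n)})"
      have "?T w \<le> ennreal t"
      proof (rule LIMSEQ_le_const[OF tendsto_ennrealI[OF v_lim]])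
        show "\<exists>N. \<forall>n\<ge>N. ?T w \<le> ennreal (v n)" using * by (auto intro: less_imp_le)
      qed
      then show "w \<in> {w \<in> space M. ?T w \<le> ennreal t}" using * by auto
    qed
    also have "\<dots> \<in> sets (F s)"
      using v less_imp_le[OF order.strict_trans1[OF t v(1)]] by (intro sets.countable_INT less image_subsetI) auto
    finally show ?thesis .
  qed
  then show "{w \<in> space M. ?T w \<le> ennreal t} \<in> sets (F t)"
    unfolding right_continuous_F[OF t] by blast
qed

lemma avoiding_time_AE_neq:
  assumes avoid: "\<And>T. random_stopping_time M F T \<Longrightarrow> measure M {w \<in> space M. \<tau> w = T w} = 0"
    and [measurable]: "\<tau> \<in> borel_measurable M" and T: "random_stopping_time M F T"
  shows "AE w in M. \<tau> w \<noteq> T w"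
proof -
  have [measurable]: "T \<in> borel_measurable M"
  proof (rule measurable_stopping_time[OF T])
    show "sets (extend_filtration M F t) \<subseteq> sets M" for t
      using sets_F_mono[of t \<infinity>] by (simp add: extend_filtration_def)
    show "space (extend_filtration M F t) = space M" for t by (rule space_F)
  qed
  have "{w \<in> space M. \<tau> w = T w} \<in> null_sets M"
    using avoid[OF T] by (intro null_setsI) (auto simp: emeasure_eq_measure)
  then show ?thesis by (rule AE_I') auto
qed

text \<open>All jump times of \<open>Y\<close> are among countably many oscillation times, and
  \<open>\<tau>\<close> almost surely differs from each of these stopping times.\<close>

lemma avoiding_time_left_continuous:
  fixes Y :: "real \<Rightarrow> 'a \<Rightarrow> real"
  assumes avoid: "\<And>T. random_stopping_time M F T \<Longrightarrow> measure M {w \<in> space M. \<tau> w = T w} = 0"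
    and tau: "\<tau> \<in> borel_measurable M"
    and Y: "\<And>t. 0 \<le> t \<Longrightarrow> Y t \<in> borel_measurable (F t)"
    and rc: "\<And>w t. w \<in> space M \<Longrightarrow> 0 \<le> t \<Longrightarrow> continuous (at_right t) (\<lambda>s. Y s w)"
    and ll: "\<And>w t. w \<in> space M \<Longrightarrow> 0 < t \<Longrightarrow> \<exists>l. ((\<lambda>s. Y s w) \<longlongrightarrow> l) (at_left t)"
  shows "AE w in M. left_limit_at \<tau> Y w"
proof -
  define T where "T q k w = (INF r\<in>{r\<in>\<rat>. q < r \<and> 1 / real (Suc k) < \<bar>Y r w - Y q w\<bar>}. ennreal r)" for q k w
  have "AE w in M. \<forall>q\<in>\<rat> \<inter> {0..}. \<forall>k. \<tau> w \<noteq> T q k w"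
    by (subst AE_ball_countable) (auto simp: AE_all_countable T_def intro!: countable_Int1 countable_rat
      avoiding_time_AE_neq[OF avoid tau] oscillation_time_stopping Y)
  then show ?thesis
    using AE_space
  proof (eventually_elim, intro impI)
    fix w assume ne: "\<forall>q\<in>\<rat> \<inter> {0..}. \<forall>k. \<tau> w \<noteq> T q k w" and w: "w \<in> space M"
      and tau: "0 < \<tau> w \<and> \<tau> w < \<infinity>"
    define r where "r = enn2real (\<tau> w)"
    have r: "\<tau> w = ennreal r" "0 < r" using tau by (auto simp: r_def enn2real_positive_iff)
    obtain l where l: "((\<lambda>s. Y s w) \<longlongrightarrow> l) (at_left r)" using ll[OF w r(2)] by blast
    have "l = Y r w"
    proof (rule ccontr)
      assume "l \<noteq> Y r w"
      then obtain q k where "q \<in> \<rat>" "0 \<le> q" "T q k w = ennreal r"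
        unfolding T_def using r(2) rc[OF w, of r] l
        by (elim jump_time_is_oscillation_time[of r "\<lambda>s. Y s w" l, rotated -1]) auto
      moreover from this have "\<tau> w \<noteq> T q k w" by (intro ne[rule_format]) simp
      ultimately show False using r by simp
    qed
    then show "((\<lambda>s. Y s w) \<longlongrightarrow> Y (enn2real (\<tau> w)) w) (at_left (enn2real (\<tau> w)))"
      using l by (simp add: r_def)
  qed
qed

section \<open>The predictable sigma-algebra\<close>

lemma predictable_generator_Pow:
  "{{0} \<times> A | A. A \<in> sets (F 0)} \<union> {{s<..t} \<times> A | s t A. 0 \<le> s \<and> s \<le> t \<and> A \<in> sets (F s)}
    \<subseteq> Pow ({0..} \<times> space M)"
proof -
  have "A \<subseteq> space M" if "A \<in> sets (F s)" "0 \<le> s" for A s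
    using sets.sets_into_space[OF that(1)] space_F_eq[OF that(2)] by simp
  then show ?thesis by fastforce
qed

lemma space_predictable_sigma: "space (predictable_sigma M F) = {0..} \<times> space M"
  unfolding predictable_sigma_def by (rule space_measure_of[OF predictable_generator_Pow])

lemma sets_predictable_sigma:
  "sets (predictable_sigma M F) = sigma_sets ({0..} \<times> space M)
    ({{0} \<times> A | A. A \<in> sets (F 0)} \<union> {{s<..t} \<times> A | s t A. 0 \<le> s \<and> s \<le> t \<and> A \<in> sets (F s)})"
  unfolding predictable_sigma_def by (rule sets_measure_of[OF predictable_generator_Pow])

lemma predictable_0: "A \<in> sets (F 0) \<Longrightarrow> {0} \<times> A \<in> sets (predictable_sigma M F)"
  unfolding sets_predictable_sigma by (intro sigma_sets.Basic) blast

lemma predictable_Ioc: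
  "0 \<le> s \<Longrightarrow> s \<le> t \<Longrightarrow> A \<in> sets (F s) \<Longrightarrow> {s<..t} \<times> A \<in> sets (predictable_sigma M F)"
  unfolding sets_predictable_sigma by (intro sigma_sets.Basic) blast

lemma predictable_Ioi:
  assumes "0 \<le> s" "A \<in> sets (F s)"
  shows "{s<..} \<times> A \<in> sets (predictable_sigma M F)"
proof -
  have "{s<..} \<times> A = (\<Union>n. {s<..s + real n} \<times> A)"
    by (auto simp: ) (metis add.commute diff_le_eq real_arch_simple)
  also have "\<dots> \<in> sets (predictable_sigma M F)"
    using assms by (intro sets.countable_UN'' predictable_Ioc) auto
  finally show ?thesis .
qed

text \<open>Predictable sets belong to the product of the Borel sets with \<open>M\<close>, so
  measurability of both components suffices; it is checked on the generating rectangles.\<close>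

lemma measurable_into_predictable:
  assumes f: "f \<in> borel_measurable N" "\<And>y. y \<in> space N \<Longrightarrow> 0 \<le> f y" and g: "g \<in> measurable N M"
  shows "(\<lambda>y. (f y, g y)) \<in> measurable N (predictable_sigma M F)"
  unfolding predictable_sigma_def
proof (rule measurable_sigma_sets[OF sets_measure_of[OF predictable_generator_Pow] predictable_generator_Pow])
  show "(\<lambda>y. (f y, g y)) \<in> space N \<rightarrow> {0..} \<times> space M"
    using f(2) measurable_space[OF g] by auto
  fix B assume "B \<in> {{0} \<times> A | A. A \<in> sets (F 0)} \<union> {{s<..t} \<times> A | s t A. 0 \<le> s \<and> s \<le> t \<and> A \<in> sets (F s)}"
  then consider (zero) A where "B = {0} \<times> A" "A \<in> sets (F 0)"
    | (ioc) s t A where "B = {s<..t} \<times> A" "0 \<le> s" "A \<in> sets (F s)" by blast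
  then show "(\<lambda>y. (f y, g y)) -` B \<inter> space N \<in> sets N"
  proof cases
    case zero
    then have [measurable]: "A \<in> sets M" using sets_F_subset[of 0] by auto
    have "(\<lambda>y. (f y, g y)) -` B \<inter> space N = {y \<in> space N. f y = 0 \<and> g y \<in> A}" using zero by auto
    then show ?thesis using f g by simp
  next
    case ioc
    then have [measurable]: "A \<in> sets M" using sets_F_subset[of s] by auto
    have "(\<lambda>y. (f y, g y)) -` B \<inter> space N = {y \<in> space N. s < f y \<and> f y \<le> t \<and> g y \<in> A}" using ioc by auto
    then show ?thesis using f g by simp
  qed
qed

lemma measurable_fst_predictable: "fst \<in> borel_measurable (predictable_sigma M F)"
proof (subst borel_measurable_iff_le, intro allI)
  fix a :: real
  have sp: "space M \<in> sets (F 0)" using sets.top[of "F 0"] by (simp add: space_F_eq)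
  show "{p \<in> space (predictable_sigma M F). fst p \<le> a} \<in> sets (predictable_sigma M F)"
  proof (cases "0 \<le> a")
    case True
    have "{p \<in> space (predictable_sigma M F). fst p \<le> a} = {0} \<times> space M \<union> {0<..a} \<times> space M"
      using True by (auto simp: space_predictable_sigma)
    then show ?thesis using True sp by (auto intro: predictable_0 predictable_Ioc)
  next
    case False
    have "{p \<in> space (predictable_sigma M F). fst p \<le> a} = {}"
      using False by (auto simp: space_predictable_sigma)
    then show ?thesis by (simp only: sets.empty_sets)
  qed
qed

text \<open>A rectangle \<open>{s<..v} \<times> A\<close> meets time \<open>t\<close> only if
  \<open>s < t\<close>, and then \<open>A\<close> belongs to \<open>F t\<close>.\<close>

lemma predictable_section_measurable:
  assumes X: "predictable M F X" and t: "0 \<le> t"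
  shows "X t \<in> borel_measurable (F t)"
proof -
  have "(\<lambda>w. (t, w)) \<in> measurable (F t) (predictable_sigma M F)"
    unfolding predictable_sigma_def
  proof (rule measurable_sigma_sets[OF sets_measure_of[OF predictable_generator_Pow] predictable_generator_Pow])
    show "(\<lambda>w. (t, w)) \<in> space (F t) \<rightarrow> {0..} \<times> space M" using t by (simp add: space_F_eq)
    fix B assume "B \<in> {{0} \<times> A | A. A \<in> sets (F 0)} \<union> {{s<..t} \<times> A | s t A. 0 \<le> s \<and> s \<le> t \<and> A \<in> sets (F s)}"
    then consider (zero) A where "B = {0} \<times> A" "A \<in> sets (F 0)"
      | (ioc) s v A where "B = {s<..v} \<times> A" "0 \<le> s" "A \<in> sets (F s)" by blast
    then show "(\<lambda>w. (t, w)) -` B \<inter> space (F t) \<in> sets (F t)"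
    proof cases
      case zero
      then have "(\<lambda>w. (t, w)) -` B \<inter> space (F t) = (if t = 0 then A \<inter> space (F t) else {})" by auto
      then show ?thesis using zero by auto
    next
      case ioc
      then have eq: "(\<lambda>w. (t, w)) -` B \<inter> space (F t) = (if s < t \<and> t \<le> v then A \<inter> space (F t) else {})" by auto
      show ?thesis
      proof (cases "s < t \<and> t \<le> v")
        case True
        then have "A \<in> sets (F t)" using sets_F_le[of s t] ioc by auto
        then show ?thesis unfolding eq using True by auto
      next
        case False
        then show ?thesis unfolding eq if_not_P[OF False] by simp
      qed
    qed
  qed
  from measurable_compose[OF this X[unfolded predictable_def]] show ?thesis by simp
qed

text \<open>In the complement the strict comparison of the two values of \<open>X\<close> is
  separated by a rational \<open>r\<close>. For fixed \<open>r\<close> the condition on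
  \<open>X q\<close> gives a rectangle starting at \<open>q\<close>, predictable because
  \<open>X q\<close> is known at time \<open>q\<close>.\<close>

lemma predictable_increment_set:
  assumes X: "predictable M F X" and q: "0 \<le> q"
  shows "{p \<in> space (predictable_sigma M F). q < fst p \<longrightarrow> X q (snd p) + c \<le> X (fst p) (snd p)}
    \<in> sets (predictable_sigma M F)"
proof -
  let ?P = "predictable_sigma M F"
  have Xm [measurable]: "(\<lambda>p. X (fst p) (snd p)) \<in> borel_measurable ?P"
    using X by (simp add: predictable_def split_beta')
  have [measurable]: "X q \<in> borel_measurable (F q)" using X q by (rule predictable_section_measurable)
  have "{p \<in> space ?P. q < fst p \<and> X (fst p) (snd p) < X q (snd p) + c}
    = (\<Union>r\<in>\<rat>. {p \<in> space ?P. X (fst p) (snd p) < r + c} \<inter> ({q<..} \<times> {w \<in> space (F q). r < X q w}))"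
  proof (intro equalityI subsetI)
    fix p assume p: "p \<in> {p \<in> space ?P. q < fst p \<and> X (fst p) (snd p) < X q (snd p) + c}"
    then have "X (fst p) (snd p) - c < X q (snd p)" by auto
    then obtain r where "r \<in> \<rat>" "X (fst p) (snd p) - c < r" "r < X q (snd p)"
      using Rats_dense_in_real by blast
    then show "p \<in> (\<Union>r\<in>\<rat>. {p \<in> space ?P. X (fst p) (snd p) < r + c} \<inter> ({q<..} \<times> {w \<in> space (F q). r < X q w}))"
      using p q by (cases p) (auto simp: space_predictable_sigma space_F_eq intro!: bexI[of _ r])
  qed (auto simp: space_predictable_sigma)
  also have "\<dots> \<in> sets ?P"
    by (intro sets.countable_UN'' countable_rat sets.Int predictable_Ioi q) measurable
  finally have "space ?P - {p \<in> space ?P. q < fst p \<and> X (fst p) (snd p) < X q (snd p) + c} \<in> sets ?P" by auto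
  also have "space ?P - {p \<in> space ?P. q < fst p \<and> X (fst p) (snd p) < X q (snd p) + c} =
    {p \<in> space ?P. q < fst p \<longrightarrow> X q (snd p) + c \<le> X (fst p) (snd p)}" by auto
  finally show ?thesis .
qed

end

section \<open>Two measures on the predictable sets: passage of levels and law of the random
  time\<close>

context hazard_setting
begin

lemma stopped_at_le: "0 \<le> t \<Longrightarrow> stopped_at \<tau> t w \<le> t"
  by (simp add: stopped_at_def enn2real_leI)

lemma L_stopped_mono: "w \<in> space M \<Longrightarrow> s \<le> t \<Longrightarrow> L_tau s w \<le> L_tau t w"
  by (intro L_mono stopped_at_nonneg stopped_at_mono)

text \<open>\<open>passage_measure t\<close> is the measure \<open>B \<mapsto> E \<integral>\<^bsub>(0, t \<and> \<tau>]\<^esub> 1\<^sub>B(u, \<cdot>) dL\<^sub>u\<close> on the predictable sets.\<close>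

definition passage_region :: "real \<Rightarrow> ('a \<times> real) set" where
  "passage_region t = {p \<in> space (M \<Otimes>\<^sub>M lborel). 0 < snd p \<and> snd p \<le> L (stopped_at \<tau> t (fst p)) (fst p)}"

text \<open>The value 0 is a default for levels not reached by time \<open>t\<close>, which lie
  outside \<open>passage_region t\<close>. \<open>L 0\<close> stands in place of 0 to match
  \<open>passage_measurable\<close>.\<close>

definition passage_map :: "real \<Rightarrow> 'a \<times> real \<Rightarrow> real \<times> 'a" where
  "passage_map t p = (if L 0 (fst p) < snd p \<and> snd p \<le> L t (fst p) then passage (snd p) (fst p) else 0, fst p)"

definition passage_measure :: "real \<Rightarrow> (real \<times> 'a) measure" where
  "passage_measure t = distr (density (M \<Otimes>\<^sub>M lborel) (indicator (passage_region t)))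
    (predictable_sigma M F) (passage_map t)"

lemma L_stopped_measurable: "0 \<le> t \<Longrightarrow> (\<lambda>w. L_tau t w) \<in> borel_measurable M"
  using L_integrable by auto

lemma passage_region_sets: "0 \<le> t \<Longrightarrow> passage_region t \<in> sets (M \<Otimes>\<^sub>M lborel)"
proof -
  assume "0 \<le> t"
  then have [measurable]: "(\<lambda>w. L_tau t w) \<in> borel_measurable M" by (rule L_stopped_measurable)
  have [measurable]: "(\<lambda>p. L (stopped_at \<tau> t (fst p)) (fst p)) \<in> borel_measurable (M \<Otimes>\<^sub>M lborel)"
    by (rule measurable_compose[OF measurable_fst]) measurable
  show ?thesis unfolding passage_region_def by measurable
qed

lemma passage_map_measurable:
  assumes t: "0 \<le> t"
  shows "passage_map t \<in> measurable (M \<Otimes>\<^sub>M lborel) (predictable_sigma M F)"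
  unfolding passage_map_def[abs_def]
proof (rule measurable_into_predictable)
  have "(\<lambda>(w, x). if L 0 w < x \<and> x \<le> L t w then passage x w else 0) \<in> borel_measurable (M \<Otimes>\<^sub>M lborel)"
    by (intro passage_measurable[OF _ t, where f = "\<lambda>u w. u"])
      (auto intro: continuous_ident borel_measurable_F_M[OF L_adapted])
  then show "(\<lambda>p. if L 0 (fst p) < snd p \<and> snd p \<le> L t (fst p) then passage (snd p) (fst p) else 0)
      \<in> borel_measurable (M \<Otimes>\<^sub>M lborel)"
    by (simp only: split_beta')
  show "0 \<le> (if L 0 (fst p) < snd p \<and> snd p \<le> L t (fst p) then passage (snd p) (fst p) else 0)"
    if "p \<in> space (M \<Otimes>\<^sub>M lborel)" for p
  proof -
    have "fst p \<in> space M" using that by (auto simp: space_pair_measure)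
    then show ?thesis using passage_interval(1)[of "fst p" 0 t "snd p"] t by (auto simp: less_imp_le)
  qed
qed simp

abbreviation passage_levels :: "real \<Rightarrow> (real \<times> 'a) set \<Rightarrow> 'a \<Rightarrow> real set" where
  "passage_levels t B w \<equiv> {x. 0 < x \<and> x \<le> L_tau t w \<and> (passage x w, w) \<in> B}"

definition passage_set :: "real \<Rightarrow> (real \<times> 'a) set \<Rightarrow> ('a \<times> real) set" where
  "passage_set t B = passage_region t \<inter> (passage_map t -` B \<inter> space (M \<Otimes>\<^sub>M lborel))"

lemma passage_set_sets:
  assumes "0 \<le> t" "B \<in> sets (predictable_sigma M F)"
  shows "passage_set t B \<in> sets (M \<Otimes>\<^sub>M lborel)"
  unfolding passage_set_def
  by (intro sets.Int passage_region_sets measurable_sets[OF passage_map_measurable] assms)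

lemma passage_section:
  assumes t: "0 \<le> t" and w: "w \<in> space M"
  shows "Pair w -` passage_set t B = passage_levels t B w"
proof -
  have "L_tau t w \<le> L t w"
    using L_mono[OF w stopped_at_nonneg stopped_at_le[OF t]] .
  then show ?thesis
    using w L_0[OF w]
    by (auto simp: passage_set_def passage_region_def passage_map_def space_pair_measure split: if_splits)
qed

lemma passage_section_sets:
  assumes t: "0 \<le> t" and B: "B \<in> sets (predictable_sigma M F)" and w: "w \<in> space M"
  shows "passage_levels t B w \<in> sets lborel"
  unfolding passage_section[OF t w, symmetric] by (rule sets_Pair1[OF passage_set_sets[OF t B]])

lemma passage_section_measurable:
  assumes t: "0 \<le> t" and B: "B \<in> sets (predictable_sigma M F)"
  shows "(\<lambda>w. emeasure lborel (passage_levels t B w))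
    \<in> borel_measurable M"
  using lborel.measurable_emeasure_Pair[OF passage_set_sets[OF t B]]
  by (rule measurable_cong[THEN iffD1, rotated]) (simp only: passage_section[OF t])

lemma passage_measure_eq:
  assumes t: "0 \<le> t" and B: "B \<in> sets (predictable_sigma M F)"
  shows "emeasure (passage_measure t) B
    = (\<integral>\<^sup>+w. emeasure lborel (passage_levels t B w) \<partial>M)"
proof -
  let ?N = "M \<Otimes>\<^sub>M lborel" and ?R = "passage_region t"
  let ?S = "passage_map t -` B \<inter> space ?N"
  note [measurable] = passage_region_sets[OF t]
  have S [measurable]: "?S \<in> sets ?N" using passage_map_measurable[OF t] B by (rule measurable_sets)
  have "emeasure (passage_measure t) B = emeasure (density ?N (indicator ?R)) ?S"
    unfolding passage_measure_def using passage_map_measurable[OF t] B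
    by (subst emeasure_distr) (auto simp: measurable_density_eq2)
  also have "\<dots> = (\<integral>\<^sup>+p. indicator ?R p * indicator ?S p \<partial>?N)"
    by (rule emeasure_density[OF _ S]) measurable
  also have "\<dots> = (\<integral>\<^sup>+p. indicator (passage_set t B) p \<partial>?N)"
    by (simp add: indicator_inter_arith passage_set_def)
  also have "\<dots> = emeasure ?N (passage_set t B)"
    by (rule nn_integral_indicator[OF passage_set_sets[OF t B]])
  also have "\<dots> = (\<integral>\<^sup>+w. emeasure lborel (Pair w -` passage_set t B) \<partial>M)"
    by (rule lborel.emeasure_pair_measure_alt[OF passage_set_sets[OF t B]])
  also have "\<dots> = (\<integral>\<^sup>+w. emeasure lborel (passage_levels t B w) \<partial>M)"
    by (rule nn_integral_cong) (simp only: passage_section[OF t])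
  finally show ?thesis .
qed

text \<open>Time 0 is removed because \<open>passage_measure\<close> integrates against
  \<open>L\<close> over positive times only.\<close>

definition random_time_measure :: "real \<Rightarrow> (real \<times> 'a) measure" where
  "random_time_measure t = distr (density M (indicator {w \<in> space M. 0 < \<tau> w \<and> \<tau> w \<le> ennreal t}))
    (predictable_sigma M F) (\<lambda>w. (enn2real (\<tau> w), w))"

lemma random_time_measure_eq:
  assumes B: "B \<in> sets (predictable_sigma M F)"
  shows "emeasure (random_time_measure t) B
    = emeasure M {w \<in> space M. 0 < \<tau> w \<and> \<tau> w \<le> ennreal t \<and> (enn2real (\<tau> w), w) \<in> B}"
    and "{w \<in> space M. 0 < \<tau> w \<and> \<tau> w \<le> ennreal t \<and> (enn2real (\<tau> w), w) \<in> B} \<in> sets M"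
proof -
  let ?D = "{w \<in> space M. 0 < \<tau> w \<and> \<tau> w \<le> ennreal t}" and ?g = "\<lambda>w. (enn2real (\<tau> w), w)"
  have g: "?g \<in> measurable M (predictable_sigma M F)"
    by (rule measurable_into_predictable) auto
  let ?S = "?g -` B \<inter> space M"
  have S [measurable]: "?S \<in> sets M" using g B by (rule measurable_sets)
  have D [measurable]: "?D \<in> sets M" by measurable
  have eq: "?D \<inter> ?S = {w \<in> space M. 0 < \<tau> w \<and> \<tau> w \<le> ennreal t \<and> (enn2real (\<tau> w), w) \<in> B}" by auto
  have "emeasure (random_time_measure t) B = emeasure (density M (indicator ?D)) ?S"
    unfolding random_time_measure_def using g B by (subst emeasure_distr) (auto simp: measurable_density_eq2)
  also have "\<dots> = (\<integral>\<^sup>+p. indicator ?D p * indicator ?S p \<partial>M)"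
    by (rule emeasure_density) (use D S in auto)
  also have "\<dots> = (\<integral>\<^sup>+p. indicator (?D \<inter> ?S) p \<partial>M)" by (simp only: indicator_inter_arith)
  also have "\<dots> = emeasure M (?D \<inter> ?S)" by (rule nn_integral_indicator) (use D S in auto)
  finally show "emeasure (random_time_measure t) B
    = emeasure M {w \<in> space M. 0 < \<tau> w \<and> \<tau> w \<le> ennreal t \<and> (enn2real (\<tau> w), w) \<in> B}" unfolding eq .
  show "{w \<in> space M. 0 < \<tau> w \<and> \<tau> w \<le> ennreal t \<and> (enn2real (\<tau> w), w) \<in> B} \<in> sets M"
    unfolding eq[symmetric] using D S by (rule sets.Int)
qed

text \<open>For \<open>s \<le> t\<close> and \<open>w\<close> in \<open>A\<close> the levels passed
  in \<open>{s<..v}\<close> form the interval between the stopped values of \<open>L\<close> at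
  \<open>s\<close> and at \<open>min v t\<close>. The passage measure is thus the expected increment
  of the stopped \<open>L\<close> over \<open>A\<close>, and the claim is
  \<open>L_compensates\<close>.\<close>

lemma measures_agree_on_rectangles:
  assumes t: "0 \<le> t" and sv: "0 \<le> s" "s \<le> v" and A: "A \<in> sets (F s)"
  shows "emeasure (random_time_measure t) ({s<..v} \<times> A) = emeasure (passage_measure t) ({s<..v} \<times> A)"
proof -
  have sub: "A \<subseteq> space M" using sets.sets_into_space[OF A] space_F_eq[OF sv(1)] by simp
  note P = predictable_Ioc[OF sv A]
  have real_tau: thesis if "\<tau> w \<noteq> 0" "\<tau> w \<le> ennreal t"
    "\<And>r. \<tau> w = ennreal r \<Longrightarrow> 0 < r \<Longrightarrow> r \<le> t \<Longrightarrow> thesis" for w thesis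
  proof (cases "\<tau> w" rule: ennreal_cases)
    case (real r)
    then show thesis using that t by (intro that(3)[of r]) (auto simp: ennreal_le_iff)
  next
    case top
    then show thesis using that(2) by (simp add: top_unique)
  qed
  show ?thesis
  proof (cases "s \<le> t")
    \<comment> \<open>Both sides vanish, since \<open>\<tau>\<close> on the event considered and all
      relevant passage times are at most \<open>t\<close>, which is less than
      \<open>s\<close>.\<close>
    case False
    have e1: "{w \<in> space M. 0 < \<tau> w \<and> \<tau> w \<le> ennreal t \<and> (enn2real (\<tau> w), w) \<in> {s<..v} \<times> A} = {}"
      using False by (auto elim!: real_tau)
    have e2: "passage_levels t ({s<..v} \<times> A) w = {}"
      if w: "w \<in> space M" for w
      using passage_interval(2)[OF w order_refl stopped_at_nonneg, of _ \<tau> t w] False L_0[OF w]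
        stopped_at_le[OF t, of w] by fastforce
    have "emeasure (passage_measure t) ({s<..v} \<times> A) = (\<integral>\<^sup>+w. 0 \<partial>M)"
      unfolding passage_measure_eq[OF t P] by (rule nn_integral_cong) (simp only: e2 emeasure_empty)
    then show ?thesis unfolding random_time_measure_eq(1)[OF P] e1 by simp
  next
    case True
    define m where "m = min v t"
    have m: "s \<le> m" "m \<le> t" "m \<le> v" "0 \<le> m" using True sv by (auto simp: m_def)
    have [measurable]: "A \<in> sets M" using A sets_F_subset[OF sv(1)] by auto
    let ?h = "\<lambda>w. indicator A w * (L_tau m w - L_tau s w)"
    have "{w \<in> space M. 0 < \<tau> w \<and> \<tau> w \<le> ennreal t \<and> (enn2real (\<tau> w), w) \<in> {s<..v} \<times> A}
      = {w \<in> A. ennreal s < \<tau> w \<and> \<tau> w \<le> ennreal m}"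
    proof -
      have "0 < \<tau> w \<and> \<tau> w \<le> ennreal t \<and> s < enn2real (\<tau> w) \<and> enn2real (\<tau> w) \<le> v \<longleftrightarrow>
          ennreal s < \<tau> w \<and> \<tau> w \<le> ennreal m" for w
      proof (cases "\<tau> w" rule: ennreal_cases)
        case (real r)
        then show ?thesis using sv t m by (auto simp: m_def ennreal_less_iff ennreal_le_iff)
      next
        case top
        then show ?thesis by (simp add: top_unique)
      qed
      then show ?thesis using sub by auto
    qed
    then have "emeasure (random_time_measure t) ({s<..v} \<times> A)
      = ennreal (measure M {w \<in> A. ennreal s < \<tau> w \<and> \<tau> w \<le> ennreal m})"
      by (simp add: random_time_measure_eq[OF P] emeasure_eq_measure)
    also have "\<dots> = ennreal (\<integral>w. ?h w \<partial>M)"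
      by (simp add: L_compensates[OF sv(1) m(1) A])
    also have "\<dots> = (\<integral>\<^sup>+w. ennreal (?h w) \<partial>M)"
    proof (rule nn_integral_eq_integral[symmetric])
      have "integrable M (\<lambda>w. L_tau m w - L_tau s w)"
        using m sv by (intro Bochner_Integration.integrable_diff L_integrable) auto
      from integrable_mult_indicator[OF \<open>A \<in> sets M\<close> this] show "integrable M ?h" by simp
      show "AE w in M. 0 \<le> ?h w"
        using L_stopped_mono[OF _ m(1)] by (auto intro!: AE_I2 mult_nonneg_nonneg)
    qed
    also have "\<dots> = emeasure (passage_measure t) ({s<..v} \<times> A)"
      unfolding passage_measure_eq[OF t P]
    proof (rule nn_integral_cong)
      fix w assume w: "w \<in> space M"
      define a where "a = stopped_at \<tau> t w"
      have a: "0 \<le> a" "a \<le> t" using stopped_at_nonneg stopped_at_le[OF t] by (auto simp: a_def)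
      have st: "stopped_at \<tau> u w = min u a" if "0 \<le> u" "u \<le> t" for u
      proof (cases "\<tau> w" rule: ennreal_cases)
        case (real r)
        then show ?thesis using that t by (auto simp: a_def stopped_at_def min_def ennreal_le_iff)
      next
        case top
        then show ?thesis using that t by (simp add: a_def stopped_at_def)
      qed
      have sec: "{x. 0 < x \<and> x \<le> L a w \<and> (passage x w, w) \<in> {s<..v} \<times> A}
        = (if w \<in> A then {L (min s a) w<..L (min m a) w} else {})"
      proof (cases "w \<in> A")
        case True
        have key: "0 < x \<and> x \<le> L a w \<and> s < passage x w \<and> passage x w \<le> v \<longleftrightarrow> L (min s a) w < x \<and> x \<le> L (min m a) w" for x
        proof (cases "x \<le> L a w")
          case x: True
          have 1: "s < passage x w \<longleftrightarrow> L s w < x" "passage x w \<le> v \<longleftrightarrow> x \<le> L v w"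
            using passage_le_iff[OF w a(1) x, of s] passage_le_iff[OF w a(1) x, of v] sv by auto
          have 2: "L s w < x \<longleftrightarrow> L (min s a) w < x"
            using x L_mono[OF w a(1), of s] by (cases "s \<le> a") (auto simp: min_def)
          have 3: "x \<le> L v w \<longleftrightarrow> x \<le> L (min m a) w"
            using x L_mono[OF w a(1), of v] a by (cases "v \<le> a") (auto simp: min_def m_def)
          have "0 < x" if "L s w < x" using that L_nonneg[OF w sv(1)] by simp
          then show ?thesis using x 1 2 3 by blast
        next
          case False
          have "L (min m a) w \<le> L a w" using m a by (intro L_mono[OF w]) auto
          then show ?thesis using False by auto
        qed
        show ?thesis
        proof (rule set_eqI)
          fix x
          show "x \<in> {x. 0 < x \<and> x \<le> L a w \<and> (passage x w, w) \<in> {s<..v} \<times> A}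
            \<longleftrightarrow> x \<in> (if w \<in> A then {L (min s a) w<..L (min m a) w} else {})"
            using key[of x] True by simp
        qed
      qed simp
      have "L (min s a) w \<le> L (min m a) w" using sv a m by (intro L_mono[OF w]) auto
      moreover have "stopped_at \<tau> s w = min s a" "stopped_at \<tau> m w = min m a"
        using st[of s] st[of m] sv m True by auto
      ultimately show "ennreal (?h w) =
        emeasure lborel (passage_levels t ({s<..v} \<times> A) w)"
        unfolding a_def[symmetric] sec by (cases "w \<in> A") simp_all
    qed
    finally show ?thesis .
  qed
qed

text \<open>Uniqueness of measures on an intersection-stable generator. Sets at time 0 are null for
  both measures, and the covering rectangles have finite mass because the law of
  \<open>\<tau>\<close> comes from a probability measure.\<close>

lemma random_time_measure_eq_passage_measure:
  assumes t: "0 \<le> t"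
  shows "random_time_measure t = passage_measure t"
proof -
  let ?E = "{{0} \<times> A | A. A \<in> sets (F 0)} \<union> {{s<..v} \<times> A | s v A. 0 \<le> s \<and> s \<le> v \<and> A \<in> sets (F s)}"
  let ?C = "insert ({0} \<times> space M) (range (\<lambda>n. {0<..real n} \<times> space M))"
  have sp: "space M \<in> sets (F 0)" using sets.top[of "F 0"] by (simp add: space_F_eq)
  show ?thesis
  proof (rule measure_eqI_generator_eq_countable)
    show "?E \<subseteq> Pow ({0..} \<times> space M)" by (rule predictable_generator_Pow)
    show "sets (random_time_measure t) = sigma_sets ({0..} \<times> space M) ?E"
      "sets (passage_measure t) = sigma_sets ({0..} \<times> space M) ?E"
      by (simp_all add: random_time_measure_def passage_measure_def sets_predictable_sigma)
    have "{0<..real n} \<times> space M \<in> ?E" for n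
      by (intro UnI2 CollectI exI[of _ 0] exI[of _ "real n"] exI[of _ "space M"]) (use sp in auto)
    then show "?C \<subseteq> ?E" using sp by blast
    show "countable ?C" by auto
    show "\<Union>?C = {0..} \<times> space M"
    proof (intro equalityI subsetI)
      fix p :: "real \<times> 'a" assume p: "p \<in> {0..} \<times> space M"
      obtain n where "fst p \<le> real n" using real_arch_simple by blast
      then show "p \<in> \<Union>?C" using p by (cases "fst p = 0") (auto intro!: exI[of _ n])
    qed auto
    show "emeasure (random_time_measure t) B \<noteq> \<infinity>" if "B \<in> ?C" for B
    proof -
      have "B \<in> sets (predictable_sigma M F)" using that sp by (auto intro: predictable_0 predictable_Ioc)
      then show ?thesis by (simp add: random_time_measure_eq(1))
    qed
    show "emeasure (random_time_measure t) B = emeasure (passage_measure t) B" if BE: "B \<in> ?E" for B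
    proof -
      consider (zero) A where "B = {0} \<times> A" "A \<in> sets (F 0)"
        | (ioc) s v A where "B = {s<..v} \<times> A" "0 \<le> s" "s \<le> v" "A \<in> sets (F s)" using BE by blast
      then show ?thesis
      proof cases
        case ioc
        then show ?thesis by (simp add: measures_agree_on_rectangles[OF t])
      next
        case zero
        have P: "B \<in> sets (predictable_sigma M F)" using zero by (auto intro: predictable_0)
        have e1: "{w \<in> space M. 0 < \<tau> w \<and> \<tau> w \<le> ennreal t \<and> (enn2real (\<tau> w), w) \<in> B} = {}"
          using zero by (auto simp: enn2real_eq_0_iff top_unique)
        have e2: "passage_levels t B w = {}"
          if w: "w \<in> space M" for w
          using passage_interval(1)[OF w order_refl stopped_at_nonneg, of _ \<tau> t w] zero L_0[OF w] by fastforce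
        have "emeasure (passage_measure t) B = (\<integral>\<^sup>+w. 0 \<partial>M)"
          unfolding passage_measure_eq[OF t P] by (rule nn_integral_cong) (simp only: e2 emeasure_empty)
        then show ?thesis unfolding random_time_measure_eq(1)[OF P] e1 by simp
      qed
    qed
    show "Int_stable ?E"
    proof (rule Int_stableI)
      fix a b assume ab: "a \<in> ?E" "b \<in> ?E"
      have empty: "{} \<in> ?E" by (auto intro!: exI[of _ "{}"])
      consider (zz) A A' where "a = {0} \<times> A" "b = {0} \<times> A'" "A \<in> sets (F 0)" "A' \<in> sets (F 0)"
        | (zi) A s v A' where "a = {0} \<times> A" "b = {s<..v} \<times> A'" "0 \<le> s"
        | (iz) A s v A' where "b = {0} \<times> A" "a = {s<..v} \<times> A'" "0 \<le> s"
        | (ii) s v A s' v' A' where "a = {s<..v} \<times> A" "b = {s'<..v'} \<times> A'" "0 \<le> s" "0 \<le> s'"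
          "A \<in> sets (F s)" "A' \<in> sets (F s')"
        using ab by blast
      then show "a \<inter> b \<in> ?E"
      proof cases
        case zz
        then have "a \<inter> b = {0} \<times> (A \<inter> A')" by auto
        then show ?thesis using zz by blast
      next
        case zi
        then have "a \<inter> b = {}" by auto
        then show ?thesis using empty by simp
      next
        case iz
        then have "a \<inter> b = {}" by auto
        then show ?thesis using empty by simp
      next
        case ii
        have m: "A \<in> sets (F (max s s'))" "A' \<in> sets (F (max s s'))"
          using ii sets_F_le[of s "max s s'"] sets_F_le[of s' "max s s'"] by auto
        have e: "a \<inter> b = {max s s'<..min v v'} \<times> (A \<inter> A')" using ii by auto
        show ?thesis
        proof (cases "max s s' \<le> min v v'")
          case True
          then show ?thesis
            unfolding e
            by (intro UnI2 CollectI exI[of _ "max s s'"] exI[of _ "min v v'"] exI[of _ "A \<inter> A'"]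
                conjI refl sets.Int m) (use ii(3) in auto)
        next
          case False
          then have "a \<inter> b = {}" unfolding e by auto
          then show ?thesis using empty by simp
        qed
      qed
    qed
  qed
qed

end

section \<open>Jumps of \<open>L\<close> and their absence for avoiding times\<close>

context hazard_setting
begin

text \<open>Stated through rational earlier times instead of a left limit, so that the set of jump
  times arises from predictable sets by countable operations. For the increasing \<open>L\<close>
  the condition is that the jump at \<open>u\<close> has size at least
  \<open>1 / real (Suc k)\<close>.\<close>

definition jump :: "real \<Rightarrow> 'a \<Rightarrow> bool" where
  "jump u w \<longleftrightarrow> 0 < u \<and> (\<exists>k::nat. \<forall>q\<in>\<rat> \<inter> {0..}. q < u \<longrightarrow> L q w + 1 / real (Suc k) \<le> L u w)"

lemma jump_set_predictable:
  assumes "predictable M F L"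
  shows "{p \<in> space (predictable_sigma M F). jump (fst p) (snd p)} \<in> sets (predictable_sigma M F)"
proof -
  let ?P = "predictable_sigma M F"
  note [measurable] = measurable_fst_predictable
  have "{p \<in> space ?P. jump (fst p) (snd p)} = {p \<in> space ?P. 0 < fst p} \<inter>
    (\<Union>k. \<Inter>q\<in>\<rat> \<inter> {0..}. {p \<in> space ?P. q < fst p \<longrightarrow> L q (snd p) + 1 / real (Suc k) \<le> L (fst p) (snd p)})"
    (is "_ = ?A \<inter> ?B")
    by (auto simp: jump_def)
  moreover have "?A \<in> sets ?P" by measurable
  moreover have "?B \<in> sets ?P"
  proof (intro sets.countable_UN'' sets.countable_INT')
    have "0 \<in> \<rat> \<inter> {0::real..}" by simp
    then show "\<rat> \<inter> {0::real..} \<noteq> {}" by blast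
  qed (auto intro: countable_Int1 countable_rat predictable_increment_set[OF assms] simp del: of_nat_Suc)
  ultimately show ?thesis by simp
qed

lemma no_jump_left_continuous:
  assumes w: "w \<in> space M" and u: "0 < u" and no: "\<not> jump u w"
  shows "((\<lambda>s. L s w) \<longlongrightarrow> L u w) (at_left u)"
proof (rule tendstoI)
  fix e :: real assume "0 < e"
  then obtain k where k: "1 / real (Suc k) < e" using nat_approx_posE by blast
  obtain q where q: "q \<in> \<rat>" "0 \<le> q" "q < u" "L u w < L q w + 1 / real (Suc k)"
    using no u unfolding jump_def by (auto simp: not_le)
  have "dist (L s w) (L u w) < e" if "s \<in> {q<..<u}" for s
    using L_mono[OF w, of q s] L_mono[OF w, of s u] that q k by (auto simp: dist_real_def)
  then show "\<forall>\<^sub>F s in at_left u. dist (L s w) (L u w) < e"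
    using eventually_at_left_real[OF q(3)] by (rule eventually_mono[rotated])
qed

lemma L_continuous_within:
  assumes w: "w \<in> space M" and u: "0 \<le> u" and no: "0 < u \<Longrightarrow> \<not> jump u w"
  shows "continuous (at u within {0..}) (\<lambda>s. L s w)"
proof (cases "u = 0")
  case True
  then show ?thesis
    using L_right[OF w u] by (simp add: continuous_within at_within_Ici_at_right)
next
  case False
  then have "isCont (\<lambda>s. L s w) u"
    using no_jump_left_continuous[OF w, of u] L_right[OF w u] u no
    by (simp add: isCont_def filterlim_at_split continuous_within)
  then show ?thesis by (rule continuous_at_imp_continuous_at_within)
qed

lemma left_continuous_no_jump:
  assumes u: "0 < u" and l: "((\<lambda>s. L s w) \<longlongrightarrow> L u w) (at_left u)"
  shows "\<not> jump u w"
proof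
  assume "jump u w"
  then obtain k where k: "\<And>q. q \<in> \<rat> \<Longrightarrow> 0 \<le> q \<Longrightarrow> q < u \<Longrightarrow> L q w + 1 / real (Suc k) \<le> L u w"
    unfolding jump_def by auto
  have "\<forall>\<^sub>F s in at_left u. L u w - 1 / real (Suc k) < L s w"
    using l by (rule order_tendstoD) simp
  then obtain b where b: "b < u" "\<And>s. b < s \<Longrightarrow> s < u \<Longrightarrow> L u w - 1 / real (Suc k) < L s w"
    unfolding eventually_at_left_field by blast
  obtain q where "q \<in> \<rat>" "max 0 b < q" "q < u"
    using Rats_dense_in_real[of "max 0 b" u] b u by auto
  then show False using k[of q] b(2)[of q] by simp
qed

lemma L_left_limit:
  assumes w: "w \<in> space M" and u: "0 < u"
  shows "\<exists>l. ((\<lambda>s. L s w) \<longlongrightarrow> l) (at_left u)"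
proof -
  let ?S = "(\<lambda>s. L s w) ` {0..<u}"
  have ne: "?S \<noteq> {}" using u by auto
  have bdd: "bdd_above ?S" using L_mono[OF w, of _ u] by (auto intro!: bdd_aboveI[of _ "L u w"])
  have "((\<lambda>s. L s w) \<longlongrightarrow> Sup ?S) (at_left u)"
  proof (rule tendstoI)
    fix e :: real assume "0 < e"
    then obtain v where v: "0 \<le> v" "v < u" "Sup ?S - e < L v w"
      using less_cSup_iff[OF ne bdd, of "Sup ?S - e"] by auto
    have "dist (L s w) (Sup ?S) < e" if "s \<in> {v<..<u}" for s
    proof -
      have "L s w \<le> Sup ?S" using that v by (intro cSup_upper bdd) auto
      then show ?thesis using L_mono[OF w, of v s] that v by (auto simp: dist_real_def)
    qed
    then show "\<forall>\<^sub>F s in at_left u. dist (L s w) (Sup ?S) < e"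
      using eventually_at_left_real[OF v(2)] by (rule eventually_mono[rotated])
  qed
  then show ?thesis by blast
qed

text \<open>A jump at \<open>u\<close> skips an interval of levels, all of them passed at
  \<open>u\<close>. Its positive length is what makes a single jump visible to the passage
  measure.\<close>

lemma passage_in_jump:
  assumes w: "w \<in> space M" and a: "0 \<le> u"
    and jump: "\<And>q. q \<in> \<rat> \<Longrightarrow> 0 \<le> q \<Longrightarrow> q < u \<Longrightarrow> L q w + c \<le> L u w"
    and x: "L u w - c < x" "x \<le> L u w"
  shows "passage x w = u"
proof (rule antisym)
  show "passage x w \<le> u" using passage_le_iff[OF w a x(2) a] x by simp
  show "u \<le> passage x w"
  proof (rule ccontr)
    assume "\<not> u \<le> passage x w"
    then obtain q where q: "q \<in> \<rat>" "passage x w < q" "q < u"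
      using Rats_dense_in_real[of "passage x w" u] by auto
    moreover have "0 \<le> passage x w"
      by (rule first_passage_nonneg[OF L_mono_on[OF w] L_right[OF w] a x(2)])
    ultimately have "x \<le> L q w" using passage_le_iff[OF w a x(2), of q] by simp
    then show False using jump[of q] q \<open>0 \<le> passage x w\<close> x by simp
  qed
qed

lemma avoiding_continuous:
  assumes pred: "predictable M F L"
    and avoid: "\<And>T. random_stopping_time M F T \<Longrightarrow> measure M {w \<in> space M. \<tau> w = T w} = 0"
  shows "AE w in M. continuous_on {0..} (\<lambda>t. L t w)"
proof -
  let ?J = "{p \<in> space (predictable_sigma M F). jump (fst p) (snd p)}"
  have J: "?J \<in> sets (predictable_sigma M F)" by (rule jump_set_predictable[OF pred])
  have left: "AE w in M. left_limit_at \<tau> L w"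
    by (rule avoiding_time_left_continuous[OF avoid tau_measurable L_adapted L_right L_left_limit])
  \<comment> \<open>\<open>L\<close> is left continuous at \<open>\<tau>\<close>, so the jump set is
    null for the law of \<open>\<tau>\<close> and therefore for the passage measure; a jump up to
    \<open>\<tau>\<close> would contribute an interval of levels of positive length.\<close>
  have no_jump: "AE w in M. \<forall>u. 0 < u \<and> u \<le> stopped_at \<tau> t w \<longrightarrow> \<not> jump u w" if t: "0 \<le> t" for t
  proof -
    let ?D = "{w \<in> space M. 0 < \<tau> w \<and> \<tau> w \<le> ennreal t \<and> (enn2real (\<tau> w), w) \<in> ?J}"
    have D [measurable]: "?D \<in> sets M" by (rule random_time_measure_eq(2)[OF J])
    have "AE w in M. w \<notin> ?D"
      using left
    proof eventually_elim
      fix w assume l: "left_limit_at \<tau> L w"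
      show "w \<notin> ?D"
      proof
        assume d: "w \<in> ?D"
        then have "\<tau> w < \<infinity>" by (auto intro: le_less_trans)
        moreover have "jump (enn2real (\<tau> w)) w" "0 < \<tau> w" using d by auto
        ultimately show False
          using left_continuous_no_jump[of "enn2real (\<tau> w)" w] l by (auto simp: jump_def)
      qed
    qed
    then have "?D \<in> null_sets M" by (simp add: null_sets_iff_AE subset_iff)
    then have "emeasure M ?D = 0" by (rule null_setsD1)
    then have "emeasure (passage_measure t) ?J = 0"
      by (simp add: random_time_measure_eq_passage_measure[OF t, symmetric] random_time_measure_eq(1)[OF J])
    then have "(\<integral>\<^sup>+w. emeasure lborel (passage_levels t ?J w) \<partial>M) = 0"
      by (simp only: passage_measure_eq[OF t J])
    moreover have "(\<lambda>w. emeasure lborel (passage_levels t ?J w))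
      \<in> borel_measurable M"
      by (rule passage_section_measurable[OF t J])
    ultimately have "AE w in M. emeasure lborel (passage_levels t ?J w) = 0"
      by (simp only: nn_integral_0_iff_AE)
    then show ?thesis
      using AE_space
    proof eventually_elim
      fix w assume null: "emeasure lborel (passage_levels t ?J w) = 0"
        and w: "w \<in> space M"
      let ?S = "passage_levels t ?J w"
      show "\<forall>u. 0 < u \<and> u \<le> stopped_at \<tau> t w \<longrightarrow> \<not> jump u w"
      proof (intro allI impI notI)
        fix u assume u: "0 < u \<and> u \<le> stopped_at \<tau> t w" and j: "jump u w"
        then obtain k where k: "\<And>q. q \<in> \<rat> \<Longrightarrow> 0 \<le> q \<Longrightarrow> q < u \<Longrightarrow> L q w + 1 / real (Suc k) \<le> L u w"
          unfolding jump_def by auto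
        have l0: "0 \<le> L u w - 1 / real (Suc k)" using k[of 0] u L_0[OF w] by simp
        have lu: "L u w \<le> L_tau t w" using u by (intro L_mono[OF w]) auto
        have "{L u w - 1 / real (Suc k)<..L u w} \<subseteq> ?S"
        proof
          fix x assume x: "x \<in> {L u w - 1 / real (Suc k)<..L u w}"
          then have "passage x w = u" using u k by (intro passage_in_jump[OF w]) auto
          then show "x \<in> ?S" using x l0 lu j u w by (auto simp: space_predictable_sigma)
        qed
        moreover have "?S \<in> sets lborel" by (rule passage_section_sets[OF t J w])
        ultimately have "emeasure lborel {L u w - 1 / real (Suc k)<..L u w} \<le> emeasure lborel ?S"
          by (rule emeasure_mono)
        then show False using null by simp
      qed
    qed
  qed
  have no_jump_before: "AE w in M. \<forall>u. 0 < u \<and> u \<le> t \<longrightarrow> \<not> jump u w" if t: "0 \<le> t" for t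
  proof -
    \<comment> \<open>Replaces the uncountable union over jump times by an event of
      \<open>F t\<close> expressed through countably many grid values. It contains every path with a
      jump in \<open>{0<..t}\<close> and no path that is continuous on \<open>{0..t}\<close>, since
      for the latter the sums of squared increments vanish.\<close>
    define E where "E = {w \<in> space (F t). \<exists>k. \<forall>n. \<exists>i\<in>{..<Suc n}.
      1 / real (Suc k) \<le> L (grid 0 t n (Suc i)) w - L (grid 0 t n i) w}"
    have [measurable]: "L (grid 0 t n i) \<in> borel_measurable (F t)" if "i \<le> Suc n" for n i
      using grid_ge[OF t, of n i] grid_le[OF t that] by (intro borel_measurable_F_mono[OF L_adapted])
    have E: "E \<in> sets (F t)"
      unfolding E_def by (intro sets.sets_Collect_countable_Ex sets.sets_Collect_countable_All
          sets.sets_Collect_finite_Ex) (auto simp del: of_nat_Suc)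
    then have [measurable]: "E \<in> sets M" using sets_F_subset[OF t] by auto
    have "AE w in M. indicator E w * (if ennreal t < \<tau> w then 1 else 0 :: real) = 0"
      using no_jump[OF t] AE_space
    proof eventually_elim
      fix w assume nj: "\<forall>u. 0 < u \<and> u \<le> stopped_at \<tau> t w \<longrightarrow> \<not> jump u w" and w: "w \<in> space M"
      have "w \<notin> E" if less: "ennreal t < \<tau> w"
      proof
        assume "w \<in> E"
        then obtain k where k: "\<And>n. \<exists>i\<in>{..<Suc n}. 1 / real (Suc k) \<le> L (grid 0 t n (Suc i)) w - L (grid 0 t n i) w"
          unfolding E_def by blast
        have cont: "continuous_on {0..t} (\<lambda>u. L u w)"
          unfolding continuous_on_eq_continuous_within
        proof
          fix u assume u: "u \<in> {0..t}"
          have "continuous (at u within {0..}) (\<lambda>s. L s w)"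
            using u nj stopped_at_before[of t \<tau> w] less t by (intro L_continuous_within[OF w]) auto
          then show "continuous (at u within {0..t}) (\<lambda>s. L s w)"
            by (rule continuous_within_subset) auto
        qed
        let ?Q = "\<lambda>n. \<Sum>i<Suc n. (L (grid 0 t n (Suc i)) w - L (grid 0 t n i) w)\<^sup>2"
        have "?Q \<longlonglongrightarrow> 0"
          using cont by (intro sum_square_increments_tendsto_0[OF t]) (auto intro!: mono_onI L_mono[OF w])
        moreover have "(1 / real (Suc k))\<^sup>2 \<le> ?Q n" for n
        proof -
          obtain i where i: "i \<in> {..<Suc n}" "1 / real (Suc k) \<le> L (grid 0 t n (Suc i)) w - L (grid 0 t n i) w"
            using k by blast
          have "(1 / real (Suc k))\<^sup>2 \<le> (L (grid 0 t n (Suc i)) w - L (grid 0 t n i) w)\<^sup>2"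
            using i(2) by (intro power_mono) auto
          also have "\<dots> \<le> ?Q n" using i(1) by (intro member_le_sum) auto
          finally show ?thesis .
        qed
        ultimately have "(1 / real (Suc k))\<^sup>2 \<le> 0" by (intro LIMSEQ_le_const) auto
        then show False by simp
      qed
      then show "indicator E w * (if ennreal t < \<tau> w then 1 else 0 :: real) = 0" by auto
    qed
    then have "(\<integral>w. indicator E w * (if ennreal t < \<tau> w then 1 else 0 :: real) \<partial>M) = 0"
      by (rule integral_eq_zero_AE)
    moreover have "(\<integral>w. indicator E w * Z t w \<partial>M) = (\<integral>w. indicator E w * (if ennreal t < \<tau> w then 1 else 0) \<partial>M)"
      using E by (intro Z_integrable_mult t) (auto intro!: integrable_const_bound[of _ 1] simp: indicator_def)
    ultimately have zero: "(\<integral>w. indicator E w * Z t w \<partial>M) = 0" by simp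
    have [measurable]: "Z t \<in> borel_measurable M" by (rule borel_measurable_F_M[OF Z_adapted[OF t] t])
    have "integrable M (\<lambda>w. indicator E w * Z t w)"
      using Z_pos[OF _ t] Z_le_1[OF _ t]
      by (intro integrable_const_bound[of _ 1] AE_I2) (auto simp: indicator_def abs_of_pos)
    moreover have "AE w in M. 0 \<le> indicator E w * Z t w"
      using Z_pos[OF _ t] by (auto intro!: AE_I2 mult_nonneg_nonneg simp: less_imp_le)
    \<comment> \<open>As \<open>Z t\<close> is strictly positive, \<open>E\<close> is null outright,
      although so far it was excluded only on \<open>t < \<tau>\<close>.\<close>
    ultimately have "AE w in M. indicator E w * Z t w = 0"
      using integral_nonneg_eq_0_iff_AE zero by blast
    then show ?thesis
      using AE_space
    proof eventually_elim
      fix w assume z: "indicator E w * Z t w = 0" and w: "w \<in> space M"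
      then have nE: "w \<notin> E" using Z_pos[OF w t] by (auto simp: indicator_def)
      show "\<forall>u. 0 < u \<and> u \<le> t \<longrightarrow> \<not> jump u w"
      proof (intro allI impI notI)
        fix u assume u: "0 < u \<and> u \<le> t" and "jump u w"
        then obtain k where k: "\<And>q. q \<in> \<rat> \<Longrightarrow> 0 \<le> q \<Longrightarrow> q < u \<Longrightarrow> L q w + 1 / real (Suc k) \<le> L u w"
          unfolding jump_def by auto
        have "\<exists>i\<in>{..<Suc n}. 1 / real (Suc k) \<le> L (grid 0 t n (Suc i)) w - L (grid 0 t n i) w" for n
        proof -
          obtain i where i: "i < Suc n" "\<And>j. grid 0 t n j < u \<and> u \<le> grid 0 t n (Suc j) \<longleftrightarrow> j = i"
            using grid_cell[of 0 u t n] u by blast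
          then have gi: "grid 0 t n i < u" "u \<le> grid 0 t n (Suc i)" "0 \<le> grid 0 t n i" using grid_ge[OF t] by auto
          obtain q where q: "q \<in> \<rat>" "grid 0 t n i < q" "q < u" using Rats_dense_in_real[OF gi(1)] by blast
          have "L (grid 0 t n i) w \<le> L q w" "L u w \<le> L (grid 0 t n (Suc i)) w"
            using gi q u by (auto intro!: L_mono[OF w])
          then show ?thesis using k[of q] q gi i(1) by (intro bexI[of _ i]) auto
        qed
        then have "w \<in> E" unfolding E_def space_F_eq[OF t] using w by blast
        then show False using nE by simp
      qed
    qed
  qed
  have "AE w in M. \<forall>n::nat. \<forall>u. 0 < u \<and> u \<le> real n \<longrightarrow> \<not> jump u w"
    using no_jump_before by (simp add: AE_all_countable)
  then show ?thesis
    using AE_space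
  proof eventually_elim
    fix w assume nj: "\<forall>n::nat. \<forall>u. 0 < u \<and> u \<le> real n \<longrightarrow> \<not> jump u w" and w: "w \<in> space M"
    show "continuous_on {0..} (\<lambda>t. L t w)"
      unfolding continuous_on_eq_continuous_within
    proof
      fix u :: real assume u: "u \<in> {0..}"
      obtain n where "u \<le> real n" using real_arch_simple by blast
      then show "continuous (at u within {0..}) (\<lambda>s. L s w)"
        using u nj by (intro L_continuous_within[OF w]) auto
    qed
  qed
qed

end

subsection \<open>Passage to everywhere regular versions\<close>

context usual_filtered_prob_space
begin

lemma enlargement_pre_sets:
  assumes t: "0 \<le> t" and tau [measurable]: "\<tau> \<in> borel_measurable M"
  shows "sets (enlargement_pre M F \<tau> t) \<subseteq> sets M" "sets (F t) \<subseteq> sets (enlargement_pre M F \<tau> t)"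
proof -
  let ?V = "vimage_algebra (space M) (\<lambda>w. min (\<tau> w) (ennreal t)) borel"
  have V: "sets ?V \<subseteq> sets M"
  proof
    fix B assume "B \<in> sets ?V"
    then obtain D where D: "D \<in> sets borel" "B = (\<lambda>w. min (\<tau> w) (ennreal t)) -` D \<inter> space M"
      by (auto simp: sets_vimage_algebra2)
    have "(\<lambda>w. min (\<tau> w) (ennreal t)) \<in> borel_measurable M" by measurable
    then show "B \<in> sets M" unfolding D(2) using D(1) by (rule measurable_sets)
  qed
  let ?G = "sets (F t) \<union> sets ?V"
  have G: "?G \<subseteq> sets M" using V sets_F_subset[OF t] by blast
  then have Pow: "?G \<subseteq> Pow (space M)" using sets.space_closed[of M] by blast
  have eq: "sets (enlargement_pre M F \<tau> t) = sigma_sets (space M) ?G"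
    unfolding enlargement_pre_def by (rule sets_measure_of[OF Pow])
  show "sets (enlargement_pre M F \<tau> t) \<subseteq> sets M"
    unfolding eq by (rule sets.sigma_sets_subset[OF G])
  show "sets (F t) \<subseteq> sets (enlargement_pre M F \<tau> t)" unfolding eq by blast
qed

lemma
  assumes t: "0 \<le> t" and tau: "\<tau> \<in> borel_measurable M"
  shows subalgebra_enlargement: "subalgebra M (enlargement M F \<tau> t)"
    and sets_F_enlargement: "sets (F t) \<subseteq> sets (enlargement M F \<tau> t)"
proof -
  let ?G = "\<Inter>s\<in>{t<..}. sets (enlargement_pre M F \<tau> s)"
  have G: "?G \<subseteq> sets M" using enlargement_pre_sets(1)[of "t + 1" \<tau>] t tau by fastforce
  then have Pow: "?G \<subseteq> Pow (space M)" using sets.space_closed[of M] by blast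
  have eq: "sets (enlargement M F \<tau> t) = sigma_sets (space M) ?G"
    unfolding enlargement_def by (rule sets_measure_of[OF Pow])
  show "subalgebra M (enlargement M F \<tau> t)"
    unfolding subalgebra_def eq using sets.sigma_sets_subset[OF G]
    by (simp add: enlargement_def space_measure_of[OF Pow])
  have "sets (F t) \<subseteq> ?G"
  proof (intro subsetI INT_I)
    fix A s assume "A \<in> sets (F t)" "s \<in> {t<..}"
    then show "A \<in> sets (enlargement_pre M F \<tau> s)"
      using sets_F_le[of t s] enlargement_pre_sets(2)[of s \<tau>] t tau by auto
  qed
  then show "sets (F t) \<subseteq> sets (enlargement M F \<tau> t)" unfolding eq by blast
qed

text \<open>The martingale property in the enlarged filtration enters the proof only through these
  two facts. It is integrated over events of \<open>F s\<close>, which belong to the enlargement at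
  time \<open>s\<close>.\<close>

lemma
  assumes tau [measurable]: "\<tau> \<in> borel_measurable M" and \<Lambda>: "martingale_hazard_process M F \<tau> \<Lambda>"
  shows hazard_integrable: "0 \<le> t \<Longrightarrow> integrable M (\<lambda>w. \<Lambda> (stopped_at \<tau> t w) w)"
    and hazard_compensates: "0 \<le> s \<Longrightarrow> s \<le> t \<Longrightarrow> A \<in> sets (F s) \<Longrightarrow>
      (\<integral>w. indicator A w * (\<Lambda> (stopped_at \<tau> t w) w - \<Lambda> (stopped_at \<tau> s w) w) \<partial>M)
      = measure M {w \<in> A. ennreal s < \<tau> w \<and> \<tau> w \<le> ennreal t}"
proof -
  define J :: "real \<Rightarrow> 'a \<Rightarrow> real" where "J t = indicator {w \<in> space M. \<tau> w \<le> ennreal t}" for t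
  define V where "V t w = J t w - \<Lambda> (stopped_at \<tau> t w) w" for t w
  have mart: "martingale M (enlargement M F \<tau>) V"
    using \<Lambda> unfolding martingale_hazard_process_def V_def[abs_def] J_def stopped_at_def by simp
  have V_int: "integrable M (V t)" if "0 \<le> t" for t using mart that by (simp add: martingale_def)
  have J_int: "integrable M (J t)" for t
    unfolding J_def by (intro integrable_real_indicator) (auto simp: emeasure_eq_measure)
  have eq: "\<Lambda> (stopped_at \<tau> t w) w = J t w - V t w" for t w by (simp add: V_def)
  show "integrable M (\<lambda>w. \<Lambda> (stopped_at \<tau> t w) w)" if "0 \<le> t" for t
    unfolding eq by (intro Bochner_Integration.integrable_diff J_int V_int that)
  assume st: "0 \<le> s" "s \<le> t" and A: "A \<in> sets (F s)"
  have t: "0 \<le> t" using st by simp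
  have [measurable]: "A \<in> sets M" using A sets_F_subset[OF st(1)] by auto
  have i: "integrable M (\<lambda>w. indicator A w * f w)" if "integrable M f" for f :: "'a \<Rightarrow> real"
    using integrable_mult_indicator[OF \<open>A \<in> sets M\<close> that] by simp
  interpret G: sigma_finite_subalgebra M "enlargement M F \<tau> s"
    by (intro finite_measure_subalgebra_is_sigma_finite)
      (simp add: finite_measure_subalgebra_def finite_measure_subalgebra_axioms_def
        finite_measure_axioms subalgebra_enlargement[OF st(1) tau])
  have "(\<integral>w. indicator A w * V t w \<partial>M) = (\<integral>w. indicator A w * real_cond_exp M (enlargement M F \<tau> s) (V t) w \<partial>M)"
    using G.real_cond_exp_intA[OF V_int[OF t], of A] sets_F_enlargement[OF st(1) tau] A
    by (auto simp: set_lebesgue_integral_def)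
  also have "\<dots> = (\<integral>w. indicator A w * V s w \<partial>M)"
  proof (rule integral_cong_AE)
    have "AE w in M. real_cond_exp M (enlargement M F \<tau> s) (V t) w = V s w"
      using mart st by (simp add: martingale_def)
    then show "AE w in M. indicator A w * real_cond_exp M (enlargement M F \<tau> s) (V t) w = indicator A w * V s w"
      by eventually_elim simp
    show "(\<lambda>w. indicator A w * V s w) \<in> borel_measurable M" using i[OF V_int[OF st(1)]] by auto
  qed auto
  finally have VV: "(\<integral>w. indicator A w * V t w \<partial>M) = (\<integral>w. indicator A w * V s w \<partial>M)" .
  have "(\<integral>w. indicator A w * (\<Lambda> (stopped_at \<tau> t w) w - \<Lambda> (stopped_at \<tau> s w) w) \<partial>M)
    = (\<integral>w. (indicator A w * J t w - indicator A w * J s w) - (indicator A w * V t w - indicator A w * V s w) \<partial>M)"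
    unfolding eq by (intro Bochner_Integration.integral_cong refl) (simp add: algebra_simps)
  also have "\<dots> = (\<integral>w. indicator A w * J t w - indicator A w * J s w \<partial>M)"
    using i[OF J_int] i[OF V_int[OF t]] i[OF V_int[OF st(1)]] by (simp add: VV)
  also have "\<dots> = (\<integral>w. indicator {w \<in> A. ennreal s < \<tau> w \<and> \<tau> w \<le> ennreal t} w \<partial>M)"
    using ennreal_leI[OF st(2)]
    by (intro Bochner_Integration.integral_cong refl) (auto simp: J_def indicator_def)
  also have "\<dots> = measure M {w \<in> A. ennreal s < \<tau> w \<and> \<tau> w \<le> ennreal t}"
  proof -
    have "{w \<in> A. ennreal s < \<tau> w \<and> \<tau> w \<le> ennreal t} = A \<inter> {w \<in> space M. ennreal s < \<tau> w \<and> \<tau> w \<le> ennreal t}"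
      using sets.sets_into_space[OF \<open>A \<in> sets M\<close>] by auto
    also have "\<dots> \<in> sets M" by measurable
    finally show ?thesis by simp
  qed
  finally show "(\<integral>w. indicator A w * (\<Lambda> (stopped_at \<tau> t w) w - \<Lambda> (stopped_at \<tau> s w) w) \<partial>M)
      = measure M {w \<in> A. ennreal s < \<tau> w \<and> \<tau> w \<le> ennreal t}" .
qed

text \<open>Bundles the pathwise assumptions of \<open>hazard_setting\<close>, so that one null set
  carries all their failures.\<close>

definition regular_at :: "(real \<Rightarrow> 'a \<Rightarrow> real) \<Rightarrow> (real \<Rightarrow> 'a \<Rightarrow> real) \<Rightarrow> 'a \<Rightarrow> bool" where
  "regular_at Z \<Lambda> w \<longleftrightarrow>
    (\<forall>t\<ge>0. continuous (at_right t) (\<lambda>s. Z s w)) \<and> (\<forall>t>0. \<exists>l. ((\<lambda>s. Z s w) \<longlongrightarrow> l) (at_left t)) \<and>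
    (\<forall>t\<ge>0. 0 < Z t w) \<and> (\<forall>t\<ge>0. Z t w \<le> 1) \<and>
    (\<forall>t\<ge>0. continuous (at_right t) (\<lambda>s. \<Lambda> s w)) \<and> mono_on {0..} (\<lambda>t. \<Lambda> t w) \<and> \<Lambda> 0 w = 0"

text \<open>The bound \<open>Z \<le> 1\<close> comes from conditional expectations at fixed times:
  it holds simultaneously at all rational times and extends by right continuity.\<close>

lemma AE_regular_at:
  assumes tau [measurable]: "\<tau> \<in> borel_measurable M" and Z: "azema_supermartingale M F \<tau> Z"
    and Z_pos: "AE w in M. \<forall>t\<ge>0. 0 < Z t w" and \<Lambda>: "martingale_hazard_process M F \<tau> \<Lambda>"
  shows "AE w in M. regular_at Z \<Lambda> w"
proof -
  have Zq: "AE w in M. Z q w \<le> 1" if q: "0 \<le> q" for q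
  proof -
    interpret G: sigma_finite_subalgebra M "F q" by (rule sigma_finite_subalgebra_F[OF q])
    have "AE w in M. real_cond_exp M (F q) (indicator {w' \<in> space M. ennreal q < \<tau> w'}) w \<le> 1"
      by (intro G.real_cond_exp_le_c integrable_real_indicator) (auto simp: emeasure_eq_measure indicator_def)
    moreover have "AE w in M. Z q w = real_cond_exp M (F q) (indicator {w' \<in> space M. ennreal q < \<tau> w'}) w"
      using Z q by (simp add: azema_supermartingale_def)
    ultimately show ?thesis by eventually_elim simp
  qed
  have "AE w in M. \<forall>q\<in>\<rat> \<inter> {0..}. Z q w \<le> 1"
    using Zq by (subst AE_ball_countable) (auto intro: countable_Int1 countable_rat)
  moreover have "AE w in M. \<forall>t\<ge>0. continuous (at_right t) (\<lambda>s. Z s w)"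
    "AE w in M. \<forall>t>0. \<exists>l. ((\<lambda>s. Z s w) \<longlongrightarrow> l) (at_left t)"
    using Z by (auto simp: azema_supermartingale_def cadlag_paths_def right_continuous_paths_def)
  moreover have "AE w in M. \<forall>t\<ge>0. continuous (at_right t) (\<lambda>s. \<Lambda> s w)"
    "AE w in M. mono_on {0..} (\<lambda>t. \<Lambda> t w)" "AE w in M. \<Lambda> 0 w = 0"
    using \<Lambda> by (auto simp: martingale_hazard_process_def right_continuous_paths_def increasing_paths_def)
  ultimately show ?thesis
    using Z_pos
  proof eventually_elim
    fix w assume q: "\<forall>q\<in>\<rat> \<inter> {0..}. Z q w \<le> 1" and r: "\<forall>t\<ge>0. continuous (at_right t) (\<lambda>s. Z s w)"
      and *: "\<forall>t>0. \<exists>l. ((\<lambda>s. Z s w) \<longlongrightarrow> l) (at_left t)"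
      "\<forall>t\<ge>0. continuous (at_right t) (\<lambda>s. \<Lambda> s w)" "mono_on {0..} (\<lambda>t. \<Lambda> t w)" "\<Lambda> 0 w = 0" "\<forall>t\<ge>0. 0 < Z t w"
    have "Z t w \<le> 1" if "0 \<le> t" for t
      using q r that by (intro right_continuous_le_of_rats[of t "\<lambda>s. Z s w"]) auto
    then show "regular_at Z \<Lambda> w" unfolding regular_at_def using r * by blast
  qed
qed

lemma null_set_in_F: "N \<in> null_sets M \<Longrightarrow> 0 \<le> t \<Longrightarrow> N \<in> sets (F t)"
  using null_sets_F0 sets_F_le[of 0 t] by blast

lemma adapted_off_null_set:
  assumes N: "N \<in> null_sets M" and t: "0 \<le> t" and Y: "Y \<in> borel_measurable (F t)"
  shows "(\<lambda>w. if w \<in> N then c else Y w :: real) \<in> borel_measurable (F t)"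
  using null_set_in_F[OF N t] Y by (intro measurable_If_set) auto

text \<open>The constants 1 and 0 satisfy all pathwise requirements, and as \<open>N\<close> lies in
  \<open>F 0\<close> the change on \<open>N\<close> keeps both processes adapted.\<close>

lemma hazard_setting_off_null_set:
  assumes tau [measurable]: "\<tau> \<in> borel_measurable M" and Z: "azema_supermartingale M F \<tau> Z"
    and \<Lambda>: "martingale_hazard_process M F \<tau> \<Lambda>"
    and N: "N \<in> null_sets M" and reg: "\<And>w. w \<in> space M \<Longrightarrow> w \<notin> N \<Longrightarrow> regular_at Z \<Lambda> w"
  shows "hazard_setting M F \<tau> (\<lambda>t w. if w \<in> N then 1 else Z t w) (\<lambda>t w. if w \<in> N then 0 else \<Lambda> t w)"
    (is "hazard_setting M F \<tau> ?Z ?L")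
proof -
  have notN: "AE w in M. w \<notin> N" using N by (rule AE_not_in)
  have Nm [measurable]: "N \<in> sets M" using N by auto
  have pred: "predictable M F \<Lambda>" using \<Lambda> by (simp add: martingale_hazard_process_def)
  have int: "integrable M (\<lambda>w. ?L (stopped_at \<tau> t w) w)" if t: "0 \<le> t" for t
  proof (rule Bochner_Integration.integrable_bound[OF hazard_integrable[OF tau \<Lambda> t]])
    have [measurable]: "(\<lambda>w. \<Lambda> (stopped_at \<tau> t w) w) \<in> borel_measurable M"
      using hazard_integrable[OF tau \<Lambda> t] by auto
    show "(\<lambda>w. ?L (stopped_at \<tau> t w) w) \<in> borel_measurable M" by (intro measurable_If_set) auto
  qed (auto intro!: AE_I2)
  show ?thesis
  proof (unfold_locales)
    show "\<tau> \<in> borel_measurable M" by (rule tau)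
    show "?Z t \<in> borel_measurable (F t)" if "0 \<le> t" for t
      using Z that by (intro adapted_off_null_set N) (auto simp: azema_supermartingale_def adapted_def)
    show "?L t \<in> borel_measurable (F t)" if "0 \<le> t" for t
      using that by (intro adapted_off_null_set N predictable_section_measurable[OF pred])
    show "AE w in M. ?Z t w = real_cond_exp M (F t) (indicator {w' \<in> space M. ennreal t < \<tau> w'}) w"
      if "0 \<le> t" for t
    proof -
      have "AE w in M. Z t w = real_cond_exp M (F t) (indicator {w' \<in> space M. ennreal t < \<tau> w'}) w"
        using Z that by (simp add: azema_supermartingale_def)
      with notN show ?thesis by eventually_elim simp
    qed
    show "integrable M (\<lambda>w. ?L (stopped_at \<tau> t w) w)" if "0 \<le> t" for t by (rule int[OF that])
    show "(\<integral>w. indicator A w * (?L (stopped_at \<tau> t w) w - ?L (stopped_at \<tau> s w) w) \<partial>M)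
      = measure M {w \<in> A. ennreal s < \<tau> w \<and> \<tau> w \<le> ennreal t}"
      if st: "0 \<le> s" "s \<le> t" and A: "A \<in> sets (F s)" for s t A
    proof -
      have [measurable]: "A \<in> sets M" using A sets_F_subset[OF st(1)] by auto
      have m: "(\<lambda>w. indicator A w * (f w - g w)) \<in> borel_measurable M"
        if "integrable M f" "integrable M g" for f g :: "'a \<Rightarrow> real"
        using that by (intro borel_measurable_times borel_measurable_diff) auto
      have "(\<integral>w. indicator A w * (?L (stopped_at \<tau> t w) w - ?L (stopped_at \<tau> s w) w) \<partial>M)
        = (\<integral>w. indicator A w * (\<Lambda> (stopped_at \<tau> t w) w - \<Lambda> (stopped_at \<tau> s w) w) \<partial>M)"
      proof (rule integral_cong_AE)
        show "AE w in M. indicator A w * (?L (stopped_at \<tau> t w) w - ?L (stopped_at \<tau> s w) w)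
          = indicator A w * (\<Lambda> (stopped_at \<tau> t w) w - \<Lambda> (stopped_at \<tau> s w) w)"
          using notN by eventually_elim simp
      qed (use st in \<open>auto intro!: m int hazard_integrable[OF tau \<Lambda>]\<close>)
      then show ?thesis using hazard_compensates[OF tau \<Lambda> st A] by simp
    qed
    fix w assume w: "w \<in> space M"
    note r = reg[OF w, unfolded regular_at_def]
    show "continuous (at_right t) (\<lambda>s. ?Z s w)" if "0 \<le> t" for t using r that by (cases "w \<in> N") auto
    show "\<exists>l. ((\<lambda>s. ?Z s w) \<longlongrightarrow> l) (at_left t)" if "0 < t" for t
      using r that by (cases "w \<in> N") (auto intro: exI[of _ 1])
    show "0 < ?Z t w" "?Z t w \<le> 1" if "0 \<le> t" for t using r that by auto
    show "continuous (at_right t) (\<lambda>s. ?L s w)" if "0 \<le> t" for t using r that by (cases "w \<in> N") auto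
    show "mono_on {0..} (\<lambda>t. ?L t w)" using r by (cases "w \<in> N") (auto intro: mono_onI)
    show "?L 0 w = 0" using r by auto
  qed
qed

text \<open>\<open>N\<close> lies in \<open>F 0\<close>, so the strip of all times over
  \<open>N\<close> is predictable.\<close>

lemma predictable_off_null_set:
  assumes X: "predictable M F X" and N: "N \<in> null_sets M"
  shows "predictable M F (\<lambda>t w. if w \<in> N then 0 else X t w)"
proof -
  let ?P = "predictable_sigma M F"
  have Xm: "(\<lambda>p. X (fst p) (snd p)) \<in> borel_measurable ?P"
    using X by (simp add: predictable_def split_beta')
  have "{p \<in> space ?P. snd p \<in> N} = {0} \<times> N \<union> {0<..} \<times> N"
    using sets.sets_into_space[OF null_setsD2[OF N]] by (auto simp: space_predictable_sigma)
  also have "\<dots> \<in> sets ?P"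
    using null_set_in_F[OF N order_refl] by (intro sets.Un predictable_0 predictable_Ioi) auto
  finally have "(\<lambda>p. if snd p \<in> N then 0 else X (fst p) (snd p)) \<in> borel_measurable ?P"
    by (intro measurable_If Xm) auto
  then show ?thesis by (simp add: predictable_def split_beta')
qed

lemma AE_null_set:
  assumes "AE w in M. P w"
  obtains N where "N \<in> null_sets M" "\<And>w. w \<in> space M \<Longrightarrow> w \<notin> N \<Longrightarrow> P w"
  using assms that[of "{w \<in> space M. \<not> P w}"] AE_iff_null_sets[of P] by auto

text \<open>The common end of both cases, which differ in how \<open>cont\<close>,
  \<open>tau_pos\<close> and \<open>left\<close> are supplied. The hypothesis \<open>left\<close>
  ranges over all everywhere regular versions because the modified pair is constructed only inside
  the proof.\<close>

lemma hazard_process_eq: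
  assumes pseudo: "pseudo_stopping_time M F \<tau>" and Z: "azema_supermartingale M F \<tau> Z"
    and Z_pos: "AE w in M. \<forall>t\<ge>0. 0 < Z t w" and \<Lambda>: "martingale_hazard_process M F \<tau> \<Lambda>"
    and cont: "AE w in M. continuous_on {0..} (\<lambda>t. \<Lambda> t w)" and tau_pos: "AE w in M. 0 < \<tau> w"
    and left: "\<And>Z' L. continuous_hazard_setting M F \<tau> Z' L \<Longrightarrow> AE w in M. left_limit_at \<tau> Z' w"
  shows "AE w in M. continuous_on {0..} (\<lambda>t. hazard_process Z t w) \<and>
    (\<forall>t\<ge>0. hazard_process Z t w = \<Lambda> t w \<and> \<Lambda> t w = - ln (Z t w))"
proof -
  have tau: "\<tau> \<in> borel_measurable M" using pseudo by (simp add: pseudo_stopping_time_def)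
  have "AE w in M. regular_at Z \<Lambda> w \<and> continuous_on {0..} (\<lambda>t. \<Lambda> t w)"
    using AE_regular_at[OF tau Z Z_pos \<Lambda>] cont by eventually_elim simp
  then obtain N where N: "N \<in> null_sets M"
    "\<And>w. w \<in> space M \<Longrightarrow> w \<notin> N \<Longrightarrow> regular_at Z \<Lambda> w \<and> continuous_on {0..} (\<lambda>t. \<Lambda> t w)"
    by (rule AE_null_set) blast
  let ?Z = "\<lambda>t w. if w \<in> N then 1 else Z t w" and ?L = "\<lambda>t w. if w \<in> N then 0 else \<Lambda> t w"
  have "hazard_setting M F \<tau> ?Z ?L"
    using N by (intro hazard_setting_off_null_set tau Z \<Lambda>) auto
  moreover have "continuous_on {0..} (\<lambda>t. ?L t w)" if "w \<in> space M" for w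
    using N(2)[OF that] by (cases "w \<in> N") auto
  ultimately have *: "continuous_hazard_setting M F \<tau> ?Z ?L"
    by (intro continuous_hazard_setting.intro continuous_hazard_setting_axioms.intro)
  have "AE w in M. continuous_on {0..} (\<lambda>t. ?Z t w) \<and> (\<forall>t\<ge>0. ?L t w = - ln (?Z t w))"
    by (rule continuous_hazard_setting.L_eq_minus_ln_Z[OF * pseudo left[OF *] tau_pos])
  then show ?thesis
    using AE_not_in[OF N(1)] Z_pos
  proof eventually_elim
    fix w assume "continuous_on {0..} (\<lambda>t. ?Z t w) \<and> (\<forall>t\<ge>0. ?L t w = - ln (?Z t w))" "w \<notin> N" "\<forall>t\<ge>0. 0 < Z t w"
    then show "continuous_on {0..} (\<lambda>t. hazard_process Z t w) \<and>
        (\<forall>t\<ge>0. hazard_process Z t w = \<Lambda> t w \<and> \<Lambda> t w = - ln (Z t w))"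
      by (auto simp: hazard_process_def less_imp_neq[symmetric] intro!: continuous_intros)
  qed
qed

end

section \<open>The two cases of the theorem\<close>

lemma (in continuous_hazard_setting) left_continuous_of_continuous_martingales:
  assumes "\<And>Y. martingale M F Y \<Longrightarrow> continuous_paths M Y"
  shows "AE w in M. left_limit_at \<tau> Z w"
proof -
  have "AE w in M. continuous_on {0..} (\<lambda>t. X t w)"
    using assms[OF X_martingale] by (simp add: continuous_paths_def)
  then show ?thesis
    using AE_space
  proof (eventually_elim, intro impI)
    fix w assume X: "continuous_on {0..} (\<lambda>t. X t w)" and w: "w \<in> space M" and tau: "0 < \<tau> w \<and> \<tau> w < \<infinity>"
    have "continuous_on {0..} (\<lambda>t. X t w - C t w)"
      by (intro continuous_on_diff X C_continuous[OF w])
    then have "continuous_on {0..} (\<lambda>t. Z t w)" by (simp add: X_def)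
    then show "((\<lambda>s. Z s w) \<longlongrightarrow> Z (enn2real (\<tau> w)) w) (at_left (enn2real (\<tau> w)))"
      by (rule tendsto_at_left_of_continuous_on) (use tau in \<open>simp add: enn2real_positive_iff\<close>)
  qed
qed

text \<open>As \<open>\<Lambda>\<close> starts at 0, the equality in (ii) at time 0 forces
  \<open>Z 0 = 1\<close>, that is, \<open>\<tau> > 0\<close> almost surely; this is the reason for
  the explicit hypothesis on \<open>\<tau> = 0\<close>. In (i) it follows from avoiding the constant
  stopping time 0.\<close>

theorem theorem3p8:
  fixes M :: "'a measure" and F :: "real \<Rightarrow> 'a measure" and \<tau> :: "'a \<Rightarrow> ennreal"
    and Z \<Lambda> :: "real \<Rightarrow> 'a \<Rightarrow> real"
  assumes space: "usual_filtered_prob_space M F"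
    and pseudo: "pseudo_stopping_time M F \<tau>"
    and Z: "azema_supermartingale M F \<tau> Z"
    and Z_pos: "AE \<omega> in M. \<forall>t\<ge>0. 0 < Z t \<omega>"
    and \<Lambda>: "martingale_hazard_process M F \<tau> \<Lambda>"
  shows "((\<forall>T. random_stopping_time M F T \<longrightarrow> measure M {\<omega> \<in> space M. \<tau> \<omega> = T \<omega>} = 0) \<longrightarrow>
           continuous_paths M (hazard_process Z) \<and>
           (AE \<omega> in M. \<forall>t\<ge>0. hazard_process Z t \<omega> = \<Lambda> t \<omega> \<and> \<Lambda> t \<omega> = - ln (Z t \<omega>)))
    \<and>
         (measure M {\<omega> \<in> space M. \<tau> \<omega> = 0} = 0 \<and>
          (\<forall>X. martingale M F X \<longrightarrow> continuous_paths M X) \<and>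
          continuous_paths M \<Lambda> \<longrightarrow>
           (AE \<omega> in M. \<forall>t\<ge>0. hazard_process Z t \<omega> = \<Lambda> t \<omega> \<and> \<Lambda> t \<omega> = - ln (Z t \<omega>)))"
proof -
  interpret usual_filtered_prob_space M F by (rule space)
  have tau [measurable]: "\<tau> \<in> borel_measurable M" using pseudo by (simp add: pseudo_stopping_time_def)
  have tau_pos: "AE w in M. 0 < \<tau> w" if "measure M {w \<in> space M. \<tau> w = 0} = 0"
  proof -
    have "{w \<in> space M. \<tau> w = 0} \<in> null_sets M"
      using that by (intro null_setsI) (auto simp: emeasure_eq_measure)
    then show ?thesis by (rule AE_I') (auto simp: not_less)
  qed
  show ?thesis
  proof (intro conjI[OF impI impI])
    assume "\<forall>T. random_stopping_time M F T \<longrightarrow> measure M {w \<in> space M. \<tau> w = T w} = 0"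
    then have avoid: "\<And>T. random_stopping_time M F T \<Longrightarrow> measure M {w \<in> space M. \<tau> w = T w} = 0" by blast
    obtain N where N: "N \<in> null_sets M" "\<And>w. w \<in> space M \<Longrightarrow> w \<notin> N \<Longrightarrow> regular_at Z \<Lambda> w"
      using AE_regular_at[OF tau Z Z_pos \<Lambda>] by (rule AE_null_set) blast
    interpret H: hazard_setting M F \<tau> "\<lambda>t w. if w \<in> N then 1 else Z t w" "\<lambda>t w. if w \<in> N then 0 else \<Lambda> t w"
      by (rule hazard_setting_off_null_set[OF tau Z \<Lambda> N])
    have pred: "predictable M F (\<lambda>t w. if w \<in> N then 0 else \<Lambda> t w)"
      using \<Lambda> N(1) by (intro predictable_off_null_set) (auto simp: martingale_hazard_process_def)
    have "AE w in M. continuous_on {0..} (\<lambda>t. if w \<in> N then 0 else \<Lambda> t w)"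
      using pred avoid by (rule H.avoiding_continuous)
    then have cont: "AE w in M. continuous_on {0..} (\<lambda>t. \<Lambda> t w)"
      using AE_not_in[OF N(1)] by eventually_elim simp
    have "AE w in M. continuous_on {0..} (\<lambda>t. hazard_process Z t w) \<and>
        (\<forall>t\<ge>0. hazard_process Z t w = \<Lambda> t w \<and> \<Lambda> t w = - ln (Z t w))"
    proof (rule hazard_process_eq[OF pseudo Z Z_pos \<Lambda> cont])
      show "AE w in M. 0 < \<tau> w" using avoid[OF stopping_time_const[of _ 0]] by (rule tau_pos)
      fix Z' L assume "continuous_hazard_setting M F \<tau> Z' L"
      then interpret K: continuous_hazard_setting M F \<tau> Z' L .
      show "AE w in M. left_limit_at \<tau> Z' w"
        by (rule avoiding_time_left_continuous[OF avoid tau K.Z_adapted K.Z_right K.Z_left])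
    qed
    then show "continuous_paths M (hazard_process Z) \<and>
        (AE w in M. \<forall>t\<ge>0. hazard_process Z t w = \<Lambda> t w \<and> \<Lambda> t w = - ln (Z t w))"
      unfolding continuous_paths_def by (simp add: AE_conj_iff)
  next
    assume *: "measure M {w \<in> space M. \<tau> w = 0} = 0 \<and>
      (\<forall>X. martingale M F X \<longrightarrow> continuous_paths M X) \<and> continuous_paths M \<Lambda>"
    have "AE w in M. continuous_on {0..} (\<lambda>t. hazard_process Z t w) \<and>
        (\<forall>t\<ge>0. hazard_process Z t w = \<Lambda> t w \<and> \<Lambda> t w = - ln (Z t w))"
      using * by (intro hazard_process_eq[OF pseudo Z Z_pos \<Lambda>] tau_pos
          continuous_hazard_setting.left_continuous_of_continuous_martingales)
        (auto simp: continuous_paths_def)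
    then show "AE w in M. \<forall>t\<ge>0. hazard_process Z t w = \<Lambda> t w \<and> \<Lambda> t w = - ln (Z t w)"
      by eventually_elim simp
  qed
qed

end
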